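(* Let $N\geq3$, let $\Omega$ be a bounded smooth open subset of $\mathbb{R}^N$, let $p_s:=\frac{2N-2}{N-2}$, let $p\in(2,p_s]$, and let $w\in X^p$ be a positive solution to $-\Delta w=Q_\Omega w^{p-1}$ in $\mathbb{R}^N$. There is $C>1$ such that: 1. if $p\in(2,p_s)$, then $$C^{-1}|x|^{-\frac{2}{p-2}}\leq w(x)\leq C|x|^{-\frac{2}{p-2}}\qquad\text{for all }|x|>1;$$ 2. if $p=p_s=\frac{2N-2}{N-2}$, then $$C^{-1}\Big(|x|\sqrt{\ln(|x|)}\Big)^{2-N}\leq w(x)\leq C\Big(|x|\sqrt{\ln(|x|)}\Big)^{2-N}\qquad\text{for all }|x|>1.$$
   Context: $Q_\Omega(x):=1$ if $x\in\Omega$ and $Q_\Omega(x):=-1$ if $x\in\mathbb{R}^N\setminus\Omega$. $D^{1,2}(\mathbb{R}^N):=\{u\in L^{2^*}(\mathbb{R}^N):\nabla u\in L^2(\mathbb{R}^N)\}$, $2^*:=\frac{2N}{N-2}$, and $X^p:=D^{1,2}(\mathbb{R}^N)\cap L^p(\mathbb{R}^N)$.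
   Formalization: In part 2 the lower bound is proved for all |x| ≥ R, for every R > 1, with C depending on R: as printed it fails, since its left side tends to infinity as |x| → 1+ while w is bounded. The bounds are for the continuous representative of w. *)

theory Defs
  imports "HOL-Analysis.Analysis"
begin

fun continuously_differentiable ::
    "nat \<Rightarrow> ('a::real_normed_vector \<Rightarrow> 'b::real_normed_vector) \<Rightarrow> bool" where
  "continuously_differentiable 0 f \<longleftrightarrow> continuous_on UNIV f"
| "continuously_differentiable (Suc k) f \<longleftrightarrow>
     (\<forall>x. f differentiable (at x)) \<and>
     (\<forall>h. continuously_differentiable k (\<lambda>x. frechet_derivative f (at x) h))"

definition smooth :: "('a::real_normed_vector \<Rightarrow> 'b::real_normed_vector) \<Rightarrow> bool" where
  "smooth f \<longleftrightarrow> (\<forall>k. continuously_differentiable k f)"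

definition grad :: "(real^'n \<Rightarrow> real) \<Rightarrow> real^'n \<Rightarrow> real^'n" where
  "grad f x = (\<chi> i. frechet_derivative f (at x) (axis i 1))"

definition test_function :: "(real^'n \<Rightarrow> real) \<Rightarrow> bool" where
  "test_function \<phi> \<longleftrightarrow> smooth \<phi> \<and> compact (closure {x. \<phi> x \<noteq> 0})"

text \<open>Near each boundary point, after relabelling and possibly reversing a coordinate axis
  (\<open>i\<close> and \<open>\<sigma>\<close>), the set is the region above the graph of a smooth function \<open>\<gamma>\<close> of the other
  coordinates. A function of the coordinates other than \<open>i\<close> is encoded as a function on the whole
  space that is constant in direction \<open>axis i 1\<close>.\<close>

definition smooth_open :: "(real^'n) set \<Rightarrow> bool" where
  "smooth_open \<Omega> \<longleftrightarrow> open \<Omega> \<and>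
     (\<forall>x0\<in>frontier \<Omega>. \<exists>r>0. \<exists>i. \<exists>\<sigma>\<in>{-1, 1}. \<exists>\<gamma>. smooth \<gamma> \<and>
        (\<forall>x t. \<gamma> (x + t *\<^sub>R axis i 1) = \<gamma> x) \<and>
        \<Omega> \<inter> ball x0 r = {x \<in> ball x0 r. \<sigma> * x $ i > \<gamma> x})"

text \<open>Elements of Lebesgue and Sobolev spaces are represented by functions; equality in these
  spaces is equality almost everywhere.\<close>

definition Lspace :: "real \<Rightarrow> (real^'n \<Rightarrow> 'b::euclidean_space) set" where
  "Lspace q = {f. f \<in> borel_measurable lebesgue \<and> integrable lebesgue (\<lambda>x. norm (f x) powr q)}"

definition locally_integrable :: "(real^'n \<Rightarrow> 'b::euclidean_space) \<Rightarrow> bool" where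
  "locally_integrable f \<longleftrightarrow> (\<forall>K. compact K \<longrightarrow> f absolutely_integrable_on K)"

definition weak_gradient :: "(real^'n \<Rightarrow> real) \<Rightarrow> (real^'n \<Rightarrow> real^'n) \<Rightarrow> bool" where
  "weak_gradient u g \<longleftrightarrow> locally_integrable u \<and> locally_integrable g \<and>
     (\<forall>\<phi>. test_function \<phi> \<longrightarrow>
        (\<forall>i. (LINT x|lebesgue. u x * grad \<phi> x $ i) = - (LINT x|lebesgue. g x $ i * \<phi> x)))"

definition critical_exponent :: "nat \<Rightarrow> real" where
  "critical_exponent N = 2 * real N / (real N - 2)"

definition D12 :: "(real^'n \<Rightarrow> real) set" where
  "D12 = {u \<in> Lspace (critical_exponent CARD('n)). \<exists>g \<in> Lspace 2. weak_gradient u g}"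

definition X :: "real \<Rightarrow> (real^'n \<Rightarrow> real) set" where
  "X p = D12 \<inter> Lspace p"

definition Q :: "(real^'n) set \<Rightarrow> real^'n \<Rightarrow> real" where
  "Q \<Omega> x = (if x \<in> \<Omega> then 1 else - 1)"

text \<open>Weak solutions of \<open>-\<Delta>w = Q w\<^sup>p\<^sup>-\<^sup>1\<close>, positive almost everywhere. The weak gradient is unique up
  to a null set, so the existential quantifier only names it.\<close>

definition positive_solution :: "(real^'n) set \<Rightarrow> real \<Rightarrow> (real^'n \<Rightarrow> real) \<Rightarrow> bool" where
  "positive_solution \<Omega> p w \<longleftrightarrow>
     (AE x in lebesgue. w x > 0) \<and>
     (\<exists>g. weak_gradient w g \<and>
       (\<forall>\<phi>. test_function \<phi> \<longrightarrow>
         (LINT x|lebesgue. g x \<bullet> grad \<phi> x) = (LINT x|lebesgue. Q \<Omega> x * w x powr (p - 1) * \<phi> x)))"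

end

theory Submission
  imports Defs
begin

text \<open>
  Outside \<open>\<Omega>\<close> a solution satisfies \<open>\<Delta>w = w\<^sup>p\<^sup>-\<^sup>1\<close>. Radial functions are sub- and supersolutions of this
  equation: multiples of \<open>|x|\<^sup>-\<^sup>2\<^sup>/\<^sup>(\<^sup>p\<^sup>-\<^sup>2\<^sup>)\<close> if \<open>p < p\<^sub>s\<close>, and multiples of \<open>(|x| sqrt(ln |x|))\<^sup>2\<^sup>-\<^sup>N\<close> if
  \<open>p = p\<^sub>s\<close>. The nonlinearity is increasing, so a positive solution that tends to \<open>0\<close> at infinity can be
  compared with them: at a positive maximum of the difference the Laplacians have the wrong order. This
  comparison is \<open>two_sided_barrier_bound\<close>.

  What remains is to give a weak solution the properties which the comparison needs: continuity, boundedness,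
  positivity everywhere, and decay. All of them come from one identity, \<open>mean_value_formula\<close>. Let
  \<open>\<zeta>\<close> be a smooth cutoff function and \<open>\<eta>\<close> the bump function with \<open>\<nabla>\<zeta>(z) = - \<eta>(z) z\<close>, and let
  \<open>W(s)\<close> and \<open>Z(s)\<close> be the integrals of \<open>\<eta>(h) w(x + s h)\<close> and of \<open>\<zeta>(h) f(x + s h)\<close> over all \<open>h\<close>. If
  \<open>-\<Delta>w = f\<close> weakly, then \<open>W' (s) = - s Z(s)\<close> in integrated form.

  Boundedness (\<open>bounded_of_subsolution\<close>) follows from a contraction argument in the space \<open>L\<^sup>1\<close> weighted
  with \<open>w\<^sup>p\<^sup>-\<^sup>2\<close>; it uses the integrability of \<open>w\<^sup>p\<close> and of the critical power of \<open>w\<close>, and the bound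
  \<open>p \<le> p\<^sub>s\<close>. With a bounded right-hand side, \<open>W(s)\<close> converges uniformly as \<open>s\<close> tends to \<open>0\<close>, which yields
  the continuous representative (\<open>continuous_representative\<close>). Positivity is \<open>strong_maximum_principle\<close>, decay
  is \<open>decay_of_integrable_subsolution\<close>. Finally, \<open>quadratic_contact_above\<close> lets the identity
  play the role of the second derivative test at a maximum.
\<close>

section \<open>Smooth functions with compact support\<close>

text \<open>The factors \<open>1/t\<^sup>k\<close> make the family stable under differentiation: \<open>flat 0\<close> alone is the
classical function that is flat at the origin.\<close>

definition flat :: "nat \<Rightarrow> real \<Rightarrow> real" where
  "flat k t = (if t > 0 then exp (- inverse t) * inverse t ^ k else 0)"

lemma flat_nonneg: "0 \<le> flat k t"
  by (simp add: flat_def)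

lemma flat_pos: "0 < t \<Longrightarrow> 0 < flat k t"
  by (simp add: flat_def)

lemma flat_eq_0: "t \<le> 0 \<Longrightarrow> flat k t = 0"
  by (simp add: flat_def)

lemma flat_tendsto_0: "(flat k \<longlongrightarrow> 0) (at 0)"
proof -
  have "((\<lambda>t::real. (inverse t) ^ k / exp (inverse t)) \<longlongrightarrow> 0) (at_right 0)"
    by (rule filterlim_compose[OF tendsto_power_div_exp_0 filterlim_inverse_at_top_right])
  moreover have "eventually (\<lambda>t. inverse t ^ k / exp (inverse t) = flat k t) (at_right (0::real))"
    using eventually_at_right_less[of 0]
    by eventually_elim (simp add: flat_def exp_minus divide_inverse)
  ultimately have R: "(flat k \<longlongrightarrow> 0) (at_right 0)"
    by (rule Lim_transform_eventually)
  have "eventually (\<lambda>t. flat k t = 0) (at_left 0)"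
    by (auto simp: eventually_at_filter flat_def)
  then have L: "(flat k \<longlongrightarrow> 0) (at_left 0)"
    by (rule tendsto_eventually)
  show ?thesis using L R by (simp add: filterlim_split_at)
qed

lemma flat_has_derivative:
  "(flat k has_real_derivative (flat (k + 2) t - real k * flat (k + 1) t)) (at t)"
proof -
  consider "t > 0" | "t < 0" | "t = 0" by linarith
  then show ?thesis
  proof cases
    case 1
    have "((\<lambda>t. exp (- inverse t) * inverse t ^ k) has_real_derivative
        exp (- inverse t) * (inverse t * inverse t) * inverse t ^ k
        + exp (- inverse t) * (real k * inverse t ^ (k - 1) * - (inverse t * inverse t))) (at t)"
      using 1 by (auto intro!: derivative_eq_intros)
    also have "exp (- inverse t) * (inverse t * inverse t) * inverse t ^ k
        + exp (- inverse t) * (real k * inverse t ^ (k - 1) * - (inverse t * inverse t))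
        = flat (k + 2) t - real k * flat (k + 1) t"
      using 1 by (cases k) (simp_all add: flat_def algebra_simps)
    finally have "((\<lambda>t. exp (- inverse t) * inverse t ^ k) has_real_derivative
        (flat (k + 2) t - real k * flat (k + 1) t)) (at t)" .
    moreover have "eventually (\<lambda>s. s > 0) (nhds t)"
      using 1 by (simp add: eventually_nhds_in_open[of "{0<..}", simplified])
    then have "eventually (\<lambda>s. flat k s = exp (- inverse s) * inverse s ^ k) (nhds t)"
      by eventually_elim (simp add: flat_def)
    ultimately show ?thesis by (simp add: DERIV_cong_ev)
  next
    case 2
    have "eventually (\<lambda>s. s < 0) (nhds t)"
      using 2 by (simp add: eventually_nhds_in_open[of "{..<0}", simplified])
    then have "eventually (\<lambda>s. flat k s = 0) (nhds t)"
      by eventually_elim (simp add: flat_def)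
    then show ?thesis using 2 by (subst DERIV_cong_ev[of t t _ "\<lambda>_. 0"]) (auto simp: flat_def)
  next
    case 3
    have "flat (k + 1) y = (flat k y - flat k 0) / (y - 0)" for y
      by (simp add: flat_def divide_inverse)
    then have "((\<lambda>y. (flat k y - flat k 0) / (y - 0)) \<longlongrightarrow> 0) (at 0)"
      using flat_tendsto_0[of "k + 1"] by presburger
    then show ?thesis using 3 by (simp add: has_field_derivative_iff flat_def)
  qed
qed

lemma continuous_on_flat [continuous_intros]:
  "continuous_on S f \<Longrightarrow> continuous_on S (\<lambda>x. flat k (f x))"
  by (rule continuous_on_compose2[of UNIV "flat k"])
     (auto intro!: DERIV_isCont flat_has_derivative continuous_at_imp_continuous_on)

lemma borel_measurable_flat [measurable]: "flat k \<in> borel_measurable borel"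
  by (intro borel_measurable_continuous_onI continuous_intros)

lemma flat_bounded: obtains B where "B > 0" "\<And>t. t \<le> 1 \<Longrightarrow> flat k t \<le> B"
proof -
  have "compact (flat k ` {0..1})"
    by (intro compact_continuous_image continuous_intros) auto
  then obtain B where B: "\<And>t. t \<in> {0..1} \<Longrightarrow> norm (flat k t) \<le> B"
    by (meson bounded_iff compact_imp_bounded imageI)
  have "flat k t \<le> max B 1" if "t \<le> 1" for t
    using B[of t] that by (cases "t \<le> 0") (auto simp: flat_eq_0)
  then show ?thesis by (intro that[of "max B 1"]) auto
qed

text \<open>A class of functions that is closed under directional derivatives consists of smooth functions.
This one is such a class because the derivative of \<^term>\<open>flat k\<close> is a combination of
\<^term>\<open>flat (k + 1)\<close> and \<^term>\<open>flat (k + 2)\<close>; it contains the bump functions needed below.\<close>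

inductive flat_polynomial :: "('a::real_inner \<Rightarrow> real) \<Rightarrow> bool" where
  const: "flat_polynomial (\<lambda>_. c)"
| linear: "flat_polynomial (\<lambda>x. x \<bullet> a)"
| square: "flat_polynomial (\<lambda>x. x \<bullet> x)"
| add: "flat_polynomial f \<Longrightarrow> flat_polynomial g \<Longrightarrow> flat_polynomial (\<lambda>x. f x + g x)"
| mult: "flat_polynomial f \<Longrightarrow> flat_polynomial g \<Longrightarrow> flat_polynomial (\<lambda>x. f x * g x)"
| flat: "flat_polynomial f \<Longrightarrow> flat_polynomial (\<lambda>x. flat k (f x))"

lemma flat_polynomial_derivative:
  "flat_polynomial f \<Longrightarrow>
     \<exists>f'. (\<forall>x. (f has_derivative f' x) (at x)) \<and> (\<forall>h. flat_polynomial (\<lambda>x. f' x h))"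
proof (induction rule: flat_polynomial.induct)
  case (const c)
  show ?case by (intro exI[of _ "\<lambda>_ _. 0"]) (auto intro: flat_polynomial.intros)
next
  case (linear a)
  show ?case
    by (intro exI[of _ "\<lambda>x h. h \<bullet> a"])
       (auto intro!: derivative_eq_intros flat_polynomial.intros)
next
  case square
  have "flat_polynomial (\<lambda>x. 2 * (x \<bullet> h))" for h :: 'a
    by (intro flat_polynomial.intros)
  then show ?case
    by (intro exI[of _ "\<lambda>x h. 2 * (x \<bullet> h)"])
       (auto intro!: derivative_eq_intros simp: inner_commute)
next
  case (add f g)
  then obtain f' g' where "\<forall>x. (f has_derivative f' x) (at x)" "\<forall>h. flat_polynomial (\<lambda>x. f' x h)"
     "\<forall>x. (g has_derivative g' x) (at x)" "\<forall>h. flat_polynomial (\<lambda>x. g' x h)" by blast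
  then show ?case
    by (intro exI[of _ "\<lambda>x h. f' x h + g' x h"])
       (auto intro!: derivative_eq_intros flat_polynomial.intros)
next
  case (mult f g)
  then obtain f' g' where *: "\<forall>x. (f has_derivative f' x) (at x)" "\<forall>h. flat_polynomial (\<lambda>x. f' x h)"
     "\<forall>x. (g has_derivative g' x) (at x)" "\<forall>h. flat_polynomial (\<lambda>x. g' x h)" by blast
  show ?case
    by (intro exI[of _ "\<lambda>x h. f x * g' x h + f' x h * g x"] conjI allI flat_polynomial.intros
          has_derivative_mult) (use * mult in auto)
next
  case (flat f k)
  then obtain f' where *: "\<forall>x. (f has_derivative f' x) (at x)" "\<forall>h. flat_polynomial (\<lambda>x. f' x h)"
    by blast
  have "((\<lambda>x. flat k (f x)) has_derivative
      (\<lambda>h. (flat (k + 2) (f x) + (- real k) * flat (k + 1) (f x)) * f' x h)) (at x)" for x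
    using has_derivative_compose[OF *(1)[rule_format]
        flat_has_derivative[of k "f x", unfolded has_field_derivative_def]] by simp
  then show ?case using * flat
    by (intro exI[of _ "\<lambda>x h. (flat (k + 2) (f x) + (- real k) * flat (k + 1) (f x)) * f' x h"]
         conjI allI flat_polynomial.intros) auto
qed

lemma flat_polynomial_smooth:
  assumes "flat_polynomial f" shows "smooth f"
proof -
  have "flat_polynomial f \<Longrightarrow> continuously_differentiable k f" for k
  proof (induction k arbitrary: f)
    case 0
    then show ?case using flat_polynomial_derivative[of f]
      by (auto intro!: continuous_at_imp_continuous_on dest: has_derivative_continuous)
  next
    case (Suc k)
    then obtain f' where f': "\<forall>x. (f has_derivative f' x) (at x)" "\<forall>h. flat_polynomial (\<lambda>x. f' x h)"
      using flat_polynomial_derivative by blast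
    then have "frechet_derivative f (at x) = f' x" for x
      by (simp add: frechet_derivative_at[symmetric])
    with f' Suc show ?case by (auto simp: differentiable_def)
  qed
  with assms show ?thesis by (simp add: smooth_def)
qed

lemma flat_polynomial_bump:
  fixes x :: "'a::real_inner"
  shows "flat_polynomial (\<lambda>y. flat k (1 - c * ((y - x) \<bullet> (y - x))))"
proof -
  have "flat_polynomial (\<lambda>y. flat k (1 + (- c) * (y \<bullet> y + ((- 2) * (y \<bullet> x) + x \<bullet> x))))"
    by (intro flat_polynomial.intros)
  moreover have "1 - c * ((y - x) \<bullet> (y - x)) = 1 + (- c) * (y \<bullet> y + ((- 2) * (y \<bullet> x) + x \<bullet> x))" for y
    by (simp add: inner_diff_left inner_diff_right inner_commute[of x y])
  ultimately show ?thesis by presburger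
qed

section \<open>The two kernels and their derivatives\<close>

text \<open>The cutoff \<open>\<zeta>\<close> and the bump \<open>\<eta>\<close> satisfy \<open>\<nabla>\<zeta>(z) = - \<eta>(z) z\<close>. Because of this relation, a change of the
scale of the mollifier \<open>\<eta>\<close> is the Laplacian of a scaled copy of \<open>\<zeta>\<close>.\<close>

definition cutoff :: "'a::real_inner \<Rightarrow> real" where
  "cutoff z = flat 0 (1 - z \<bullet> z)"
definition bump :: "'a::real_inner \<Rightarrow> real" where
  "bump z = 2 * flat 2 (1 - z \<bullet> z)"

lemma cutoff_scaled: "cutoff ((y - x) /\<^sub>R s) = flat 0 (1 - (inverse s)\<^sup>2 * ((y - x) \<bullet> (y - x)))"
  by (simp add: cutoff_def power2_eq_square mult.assoc)

lemma bump_scaled: "bump ((y - x) /\<^sub>R s) = 2 * flat 2 (1 - (inverse s)\<^sup>2 * ((y - x) \<bullet> (y - x)))"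
  by (simp add: bump_def power2_eq_square mult.assoc)

lemma cutoff_outside: "norm z \<ge> 1 \<Longrightarrow> cutoff z = 0"
  and bump_outside: "norm z \<ge> 1 \<Longrightarrow> bump z = 0"
  using one_le_power[of "norm z" 2] by (auto simp: cutoff_def bump_def power2_norm_eq_inner flat_eq_0)

lemma test_function_cutoff:
  assumes "s > 0"
  shows "test_function (\<lambda>y. cutoff ((y - x) /\<^sub>R s))"
  unfolding test_function_def
proof
  show "smooth (\<lambda>y. cutoff ((y - x) /\<^sub>R s))"
    unfolding cutoff_scaled by (intro flat_polynomial_smooth flat_polynomial_bump)
  have "{y. cutoff ((y - x) /\<^sub>R s) \<noteq> 0} \<subseteq> cball x s"
  proof
    fix y assume "y \<in> {y. cutoff ((y - x) /\<^sub>R s) \<noteq> 0}"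
    then have "norm ((y - x) /\<^sub>R s) < 1"
      using cutoff_outside[of "(y - x) /\<^sub>R s"] by force
    then show "y \<in> cball x s"
      using assms by (simp add: dist_norm norm_minus_commute inverse_eq_divide pos_divide_less_eq)
  qed
  then have "closure {y. cutoff ((y - x) /\<^sub>R s) \<noteq> 0} \<subseteq> cball x s"
    by (simp add: closure_minimal)
  then show "compact (closure {y. cutoff ((y - x) /\<^sub>R s) \<noteq> 0})"
    using bounded_subset[OF bounded_cball] by (auto simp: compact_eq_bounded_closed)
qed

lemma flat_bump_has_derivative:
  fixes x :: "'a::real_inner"
  shows "((\<lambda>y. flat k (1 - c * ((y - x) \<bullet> (y - x)))) has_derivative
    (\<lambda>h. (flat (k + 2) (1 - c * ((y - x) \<bullet> (y - x))) - real k * flat (k + 1) (1 - c * ((y - x) \<bullet> (y - x))))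
       * (- 2 * c * ((y - x) \<bullet> h)))) (at y)"
proof -
  have "((\<lambda>y. 1 - c * ((y - x) \<bullet> (y - x))) has_derivative (\<lambda>h. - 2 * c * ((y - x) \<bullet> h))) (at y)"
    by (auto intro!: derivative_eq_intros simp: inner_commute fun_eq_iff)
  from has_derivative_compose[OF this flat_has_derivative[unfolded has_field_derivative_def]]
  show ?thesis by simp
qed

lemma grad_eq:
  assumes "(f has_derivative f') (at y)"
  shows "grad f y $ i = f' (axis i 1)"
  using frechet_derivative_at[OF assms] by (simp add: grad_def)

lemma laplacian_cutoff:
  fixes x y :: "real^'n" and s :: real
  defines "c \<equiv> (inverse s)\<^sup>2"
  defines "t \<equiv> 1 - c * ((y - x) \<bullet> (y - x))"
  shows "(\<Sum>i\<in>UNIV. grad (\<lambda>y. grad (\<lambda>y. cutoff ((y - x) /\<^sub>R s)) y $ i) y $ i)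
    = 4 * c\<^sup>2 * ((y - x) \<bullet> (y - x)) * (flat 4 t - 2 * flat 3 t) - 2 * real CARD('n) * c * flat 2 t"
proof -
  have 1: "grad (\<lambda>y. cutoff ((y - x) /\<^sub>R s)) y $ i
      = flat 2 (1 - c * ((y - x) \<bullet> (y - x))) * (- 2 * c * ((y - x) $ i))" for i :: 'n and y
    unfolding cutoff_scaled c_def[symmetric]
    by (subst grad_eq[OF flat_bump_has_derivative]) (simp add: inner_axis numeral_2_eq_2)
  have 2: "((\<lambda>y. flat 2 (1 - c * ((y - x) \<bullet> (y - x))) * (- 2 * c * ((y - x) $ i))) has_derivative
     (\<lambda>h. flat 2 t * (- 2 * c * (h $ i)) +
       (flat 4 t - 2 * flat 3 t) * (- 2 * c * ((y - x) \<bullet> h)) * (- 2 * c * ((y - x) $ i)))) (at y)" for i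
  proof -
    have "((\<lambda>y. - 2 * c * ((y - x) $ i)) has_derivative (\<lambda>h. - 2 * c * (h $ i))) (at y)"
      by (auto intro!: derivative_eq_intros bounded_linear.has_derivative[OF bounded_linear_vec_nth])
    from has_derivative_mult[OF flat_bump_has_derivative[of 2 c x y] this]
    show ?thesis by (simp add: t_def)
  qed
  have "grad (\<lambda>y. grad (\<lambda>y. cutoff ((y - x) /\<^sub>R s)) y $ i) y $ i =
     flat 2 t * (- 2 * c) + 4 * c\<^sup>2 * (flat 4 t - 2 * flat 3 t) * ((y - x) $ i * (y - x) $ i)" for i
    unfolding 1 grad_eq[OF 2] by (simp add: inner_axis power2_eq_square)
  then have "(\<Sum>i\<in>UNIV. grad (\<lambda>y. grad (\<lambda>y. cutoff ((y - x) /\<^sub>R s)) y $ i) y $ i) =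
     (\<Sum>i\<in>(UNIV::'n set). flat 2 t * (- 2 * c)) +
     4 * c\<^sup>2 * (flat 4 t - 2 * flat 3 t) * (\<Sum>i\<in>UNIV. (y - x) $ i * (y - x) $ i)"
    by (simp only: sum.distrib sum_distrib_left)
  then show ?thesis by (simp add: inner_vec_def)
qed

section \<open>Testing weak gradients with second derivatives\<close>

lemma locally_integrable_times_continuous:
  fixes u :: "real^'n \<Rightarrow> real"
  assumes u: "locally_integrable u" and c: "continuous_on UNIV \<psi>"
    and k: "compact K" and z: "\<And>x. x \<notin> K \<Longrightarrow> \<psi> x = (0::real)"
  shows "integrable lebesgue (\<lambda>x. u x * \<psi> x)"
proof -
  have i: "integrable lebesgue (\<lambda>x. indicator K x *\<^sub>R u x)"
    using u k by (auto simp: locally_integrable_def set_integrable_def)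
  have m: "\<psi> \<in> borel_measurable lebesgue"
    using c by (intro measurable_completion) (simp add: borel_measurable_continuous_onI)
  have "compact (\<psi> ` K)" by (intro compact_continuous_image continuous_on_subset[OF c] k) auto
  then obtain B where B: "\<And>x. x \<in> K \<Longrightarrow> norm (\<psi> x) \<le> B"
    by (meson bounded_iff compact_imp_bounded imageI)
  have eq: "u x * \<psi> x = (indicator K x *\<^sub>R u x) * \<psi> x" for x
    by (cases "x \<in> K") (simp_all add: z)
  have b: "norm (u x * \<psi> x) \<le> norm ((indicator K x *\<^sub>R u x) * max B 0)" for x
  proof (cases "x \<in> K")
    case True
    then show ?thesis using B[OF True] by (simp add: abs_mult mult_left_mono)
  qed (simp add: z)
  show ?thesis
  proof (rule Bochner_Integration.integrable_bound[OF integrable_mult_left[OF i, of "max B 0"]])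
    show "(\<lambda>x. u x * \<psi> x) \<in> borel_measurable lebesgue"
      unfolding eq using borel_measurable_integrable[OF i] m by (rule borel_measurable_times)
  qed (use b in simp)
qed

lemma test_function_grad:
  assumes "test_function \<phi>" shows "test_function (\<lambda>y. grad \<phi> y $ i)"
proof -
  define K where "K = closure {x. \<phi> x \<noteq> 0}"
  from assms have s: "smooth \<phi>" and k: "compact K" by (auto simp: test_function_def K_def)
  have z: "\<phi> y = 0" if "y \<in> - K" for y
    using that closure_subset[of "{x. \<phi> x \<noteq> 0}"] unfolding K_def by blast
  have "smooth (\<lambda>y. grad \<phi> y $ i)"
    unfolding smooth_def
  proof
    fix k show "continuously_differentiable k (\<lambda>y. grad \<phi> y $ i)"
      using s[unfolded smooth_def, rule_format, of "Suc k"] by (simp add: grad_def)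
  qed
  moreover have "grad \<phi> y $ i = 0" if "y \<notin> K" for y
  proof -
    have "(\<phi> has_derivative (\<lambda>_. 0)) (at y)"
      by (rule has_derivative_transform_within_open[of "\<lambda>_. 0" _ _ _ "- K"])
         (use k that z in \<open>auto simp: compact_imp_closed open_Compl\<close>)
    from grad_eq[OF this] show ?thesis .
  qed
  then have "{x. grad \<phi> x $ i \<noteq> 0} \<subseteq> K" by auto
  then have "closure {x. grad \<phi> x $ i \<noteq> 0} \<subseteq> K"
    using k by (simp add: closure_minimal compact_imp_closed)
  then have "compact (closure {x. grad \<phi> x $ i \<noteq> 0})"
    using k compact_eq_bounded_closed bounded_subset by (metis closed_closure)
  ultimately show ?thesis by (simp add: test_function_def)
qed

lemma smooth_continuous: "smooth \<phi> \<Longrightarrow> continuous_on UNIV \<phi>"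
  unfolding smooth_def by (drule spec[of _ 0]) simp

text \<open>A partial derivative of a test function is again a test function, so the definition of the weak
gradient can be applied to it; this moves the second derivative from the solution to the test
function.\<close>

lemma weak_laplacian:
  assumes w: "weak_gradient w g" and \<phi>: "test_function \<phi>"
  shows "(LINT x|lebesgue. g x \<bullet> grad \<phi> x)
    = - (LINT x|lebesgue. w x * (\<Sum>i\<in>UNIV. grad (\<lambda>y. grad \<phi> y $ i) x $ i))"
proof -
  note t = test_function_grad[OF \<phi>]
  have c: "continuous_on UNIV \<psi>" "compact (closure {x. \<psi> x \<noteq> 0})"
     "x \<notin> closure {x. \<psi> x \<noteq> 0} \<Longrightarrow> \<psi> x = 0"
     if "test_function \<psi>" for \<psi> :: "real^'n \<Rightarrow> real" and x
    using that closure_subset[of "{x. \<psi> x \<noteq> 0}"]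
    by (auto simp: test_function_def intro: smooth_continuous)
  have gi: "locally_integrable (\<lambda>x. g x $ i)" for i
    using w absolutely_integrable_linear[OF _ bounded_linear_vec_nth[of i], where f = g]
    unfolding weak_gradient_def locally_integrable_def by (simp add: o_def)
  have 1: "integrable lebesgue (\<lambda>x. g x $ i * grad \<phi> x $ i)" for i
    by (rule locally_integrable_times_continuous[OF gi c[OF t]])
  have 2: "integrable lebesgue (\<lambda>x. w x * grad (\<lambda>y. grad \<phi> y $ i) x $ i)" for i
    by (rule locally_integrable_times_continuous[OF _ c[OF test_function_grad[OF t]]])
       (use w in \<open>simp add: weak_gradient_def\<close>)
  have "(LINT x|lebesgue. g x \<bullet> grad \<phi> x) = (\<Sum>i\<in>UNIV. LINT x|lebesgue. g x $ i * grad \<phi> x $ i)"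
    unfolding inner_vec_def using 1 by (simp add: Bochner_Integration.integral_sum)
  also have "\<dots> = (\<Sum>i\<in>UNIV. - (LINT x|lebesgue. w x * grad (\<lambda>y. grad \<phi> y $ i) x $ i))"
    using w t by (intro sum.cong) (auto simp: weak_gradient_def)
  also have "\<dots> = - (LINT x|lebesgue. w x * (\<Sum>i\<in>UNIV. grad (\<lambda>y. grad \<phi> y $ i) x $ i))"
    using 2 by (simp add: Bochner_Integration.integral_sum sum_distrib_left sum_negf)
  finally show ?thesis .
qed

section \<open>Integrals of the kernels\<close>

text \<open>Solutions that are not yet known to be bounded are handled with extended nonnegative integrals, for which
the order of integration can be changed without integrability conditions.\<close>

abbreviation lborel_nn_integral :: "('a::euclidean_space \<Rightarrow> ennreal) \<Rightarrow> ennreal" (binder \<open>LBNN \<close> 60)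
  where "lborel_nn_integral f \<equiv> nn_integral lborel f"

lemma bump_nonneg: "0 \<le> bump z" and cutoff_nonneg: "0 \<le> cutoff z"
  by (simp_all add: bump_def cutoff_def flat_nonneg)

lemma bump_minus: "bump (- z) = bump z" and cutoff_minus: "cutoff (- z) = cutoff z"
  by (simp_all add: bump_def cutoff_def)

lemma continuous_on_bump: "continuous_on S bump"
  and continuous_on_cutoff: "continuous_on S cutoff"
  unfolding bump_def[abs_def] cutoff_def[abs_def] by (intro continuous_intros)+

lemma borel_measurable_bump [measurable]: "bump \<in> borel_measurable borel"
  and borel_measurable_cutoff [measurable]: "cutoff \<in> borel_measurable borel"
  by (simp_all add: borel_measurable_continuous_onI continuous_on_bump continuous_on_cutoff)

lemma bump_bounded: obtains B where "B > 0" "\<And>z::'a::real_inner. bump z \<le> B"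
proof -
  obtain B where "B > 0" "\<And>t. t \<le> 1 \<Longrightarrow> flat 2 t \<le> B" using flat_bounded by blast
  then show ?thesis by (intro that[of "2 * B"]) (auto simp: bump_def)
qed

lemma cutoff_le_1: "cutoff z \<le> 1"
  by (simp add: cutoff_def flat_def)

text \<open>This comparison bounds an integral against \<open>\<zeta>\<close> of a nonnegative function by its mollification; the
strong maximum principle rests on it.\<close>

lemma cutoff_le_bump: "cutoff z \<le> bump z / 2"
proof (cases "z \<bullet> z < 1")
  case True
  then have "1 \<le> inverse (1 - z \<bullet> z)" by (intro one_le_inverse) auto
  then have "1 \<le> inverse (1 - z \<bullet> z) ^ 2" by (rule one_le_power)
  then show ?thesis using True by (simp add: cutoff_def bump_def flat_def)
qed (simp add: cutoff_def bump_def flat_eq_0)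

lemma compact_support_integrable:
  fixes f :: "'a::euclidean_space \<Rightarrow> real"
  assumes c: "continuous_on UNIV f" and z: "\<And>x. norm x > R \<Longrightarrow> f x = 0"
  shows "integrable lborel f"
proof -
  have "integrable lborel (\<lambda>x. indicator (cball 0 R) x *\<^sub>R f x)"
    using borel_integrable_compact[of "cball 0 R" f] continuous_on_subset[OF c]
    by (simp add: if_distrib indicator_def of_bool_def if_distribR cong: if_cong)
  also have "(\<lambda>x. indicator (cball 0 R) x *\<^sub>R f x) = f"
    using z by (force simp: indicator_def fun_eq_iff)
  finally show ?thesis .
qed

lemma integrable_bump: "integrable lborel bump" and integrable_cutoff: "integrable lborel cutoff"
  by (rule compact_support_integrable[of _ 1]; simp add: continuous_on_bump continuous_on_cutoff
       bump_outside cutoff_outside)+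

definition bump_mass :: "'a::euclidean_space itself \<Rightarrow> real" where
  "bump_mass _ = (LBINT h. bump (h::'a))"
definition cutoff_mass :: "'a::euclidean_space itself \<Rightarrow> real" where
  "cutoff_mass _ = (LBINT h. cutoff (h::'a))"

lemma cutoff_mass_pos: "0 < cutoff_mass TYPE('a::euclidean_space)"
proof -
  have "cutoff_mass TYPE('a) \<noteq> 0"
  proof
    assume "cutoff_mass TYPE('a) = 0"
    then have "AE h in lborel. cutoff (h::'a) = 0"
      unfolding cutoff_mass_def
      by (subst (asm) integral_nonneg_eq_0_iff_AE) (auto simp: integrable_cutoff cutoff_nonneg)
    then have "AE h in lborel. (h::'a) \<notin> ball 0 1"
    proof eventually_elim
      case (elim h)
      then have "\<not> 0 < 1 - h \<bullet> h"
        using flat_pos[of "1 - h \<bullet> h" 0] by (auto simp: cutoff_def)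
      then show ?case by (simp add: norm_lt_square)
    qed
    then have "emeasure lborel (ball (0::'a) 1) = 0"
      by (subst (asm) AE_iff_measurable[OF _ refl]) (auto simp: ball_def)
    then show False using unit_ball_vol_pos[of "DIM('a)"] by (simp add: emeasure_ball)
  qed
  moreover have "cutoff_mass TYPE('a) \<ge> 0"
    unfolding cutoff_mass_def by (simp add: cutoff_nonneg)
  ultimately show ?thesis by simp
qed

lemma bump_mass_pos: "0 < bump_mass TYPE('a::euclidean_space)"
proof -
  have "cutoff_mass TYPE('a) \<le> (LBINT h. bump (h::'a) / 2)"
    unfolding cutoff_mass_def
    by (intro integral_mono integrable_cutoff) (use cutoff_le_bump in \<open>auto simp: integrable_bump\<close>)
  then show ?thesis using cutoff_mass_pos[where 'a='a] by (simp add: bump_mass_def)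
qed

lemma nn_integral_affine:
  fixes f :: "'a::euclidean_space \<Rightarrow> ennreal"
  assumes [measurable]: "f \<in> borel_measurable borel" and "c \<noteq> 0"
  shows "(LBNN x. f x) = ennreal (\<bar>c\<bar> ^ DIM('a)) * (LBNN x. f (t + c *\<^sub>R x))"
  by (subst lborel_affine[OF \<open>c \<noteq> 0\<close>, of t])
     (simp add: nn_integral_density nn_integral_distr nn_integral_cmult)

lemma lborel_integral_affine:
  fixes f :: "'a::euclidean_space \<Rightarrow> real"
  assumes [measurable]: "f \<in> borel_measurable borel" and "c \<noteq> 0"
  shows "(LBINT x. f x) = \<bar>c\<bar> ^ DIM('a) * (LBINT x. f (t + c *\<^sub>R x))"
  by (subst lborel_affine[OF \<open>c \<noteq> 0\<close>, of t])
     (simp add: integral_density integral_distr)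

lemma lborel_integrable_affine:
  fixes f :: "'a::euclidean_space \<Rightarrow> real"
  assumes f: "integrable lborel f" and "c \<noteq> 0"
  shows "integrable lborel (\<lambda>x. f (t + c *\<^sub>R x))"
proof -
  note [measurable] = borel_measurable_integrable[OF f]
  have "integrable (density (distr lborel borel (\<lambda>x. t + c *\<^sub>R x)) (\<lambda>_. ennreal (\<bar>c\<bar> ^ DIM('a)))) f"
    using f lborel_affine[OF \<open>c \<noteq> 0\<close>, of t] by simp
  then show ?thesis using \<open>c \<noteq> 0\<close> by (simp add: integrable_density integrable_distr_eq)
qed

section \<open>The mean value formula\<close>

definition bump_mean :: "('a::euclidean_space \<Rightarrow> real) \<Rightarrow> 'a \<Rightarrow> real \<Rightarrow> real" where
  "bump_mean u x s = (LBINT h. bump h * u (x + s *\<^sub>R h))"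
definition cutoff_mean :: "('a::euclidean_space \<Rightarrow> real) \<Rightarrow> 'a \<Rightarrow> real \<Rightarrow> real" where
  "cutoff_mean u x s = (LBINT h. cutoff h * u (x + s *\<^sub>R h))"

text \<open>The Laplacian of \<open>y \<mapsto> \<zeta>(y/s)\<close> at \<open>z\<close>, in closed form.\<close>

definition lap_cutoff :: "real \<Rightarrow> 'a::euclidean_space \<Rightarrow> real" where
  "lap_cutoff s z = (let c = (inverse s)\<^sup>2; t = 1 - c * (z \<bullet> z) in
     4 * c\<^sup>2 * (z \<bullet> z) * (flat 4 t - 2 * flat 3 t) - 2 * real DIM('a) * c * flat 2 t)"

text \<open>The identity \<open>\<partial>\<^sub>s (s\<^sup>-\<^sup>n \<eta>(z/s)) = s\<^sup>1\<^sup>-\<^sup>n \<Delta>(\<zeta>(\<cdot>/s))(z)\<close>, where \<open>n\<close> is the dimension. It plays the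
part that the fundamental solution has in representation formulas: applied to all scales up to \<open>r\<close>, it recovers a
function from its Laplacian and one mollification.\<close>

lemma scaled_bump_derivative:
  fixes z :: "'a::euclidean_space"
  assumes "s > 0"
  shows "((\<lambda>s. inverse s ^ DIM('a) * bump (z /\<^sub>R s)) has_real_derivative
     (s * inverse s ^ DIM('a) * lap_cutoff s z)) (at s)"
proof -
  obtain k where k: "DIM('a) = Suc k" using DIM_positive[where 'a='a] gr0_conv_Suc by blast
  define t where "t = 1 - (inverse s)\<^sup>2 * (z \<bullet> z)"
  have i: "(inverse has_real_derivative - (inverse s * inverse s)) (at s)"
    using assms by (auto intro!: derivative_eq_intros)
  have "((\<lambda>s. 1 - (inverse s)\<^sup>2 * (z \<bullet> z)) has_real_derivative
     2 * inverse s * (inverse s * inverse s) * (z \<bullet> z)) (at s)"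
    by (rule derivative_eq_intros i refl)+ simp
  from DERIV_chain2[OF flat_has_derivative[of 2] this]
  have 1: "((\<lambda>s. flat 2 (1 - (inverse s)\<^sup>2 * (z \<bullet> z))) has_real_derivative
     (flat 4 t - 2 * flat 3 t) * (2 * inverse s * (inverse s * inverse s) * (z \<bullet> z))) (at s)"
    by (simp add: t_def)
  have 2: "((\<lambda>s. inverse s ^ DIM('a)) has_real_derivative
     real DIM('a) * (- (inverse s * inverse s)) * inverse s ^ k) (at s)"
    using DERIV_power[OF i, of "DIM('a)"] by (simp add: k mult_ac)
  have "((\<lambda>s. 2 * (inverse s ^ DIM('a) * flat 2 (1 - (inverse s)\<^sup>2 * (z \<bullet> z)))) has_real_derivative
     2 * (real DIM('a) * (- (inverse s * inverse s)) * inverse s ^ k * flat 2 t +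
      (flat 4 t - 2 * flat 3 t) * (2 * inverse s * (inverse s * inverse s) * (z \<bullet> z)) * inverse s ^ DIM('a))) (at s)"
    using DERIV_cmult[OF DERIV_mult[OF 2 1], of 2] by (simp only: t_def)
  moreover have "2 * (real DIM('a) * (- (inverse s * inverse s)) * inverse s ^ k * flat 2 t +
      (flat 4 t - 2 * flat 3 t) * (2 * inverse s * (inverse s * inverse s) * (z \<bullet> z)) * inverse s ^ DIM('a))
     = s * inverse s ^ DIM('a) * lap_cutoff s z"
  proof -
    have "s * inverse s ^ DIM('a) = inverse s ^ k"
      using assms by (simp add: k)
    then have "s * inverse s ^ DIM('a) * lap_cutoff s z = inverse s ^ k * lap_cutoff s z"
      by (simp only:)
    moreover have "inverse s ^ DIM('a) = inverse s * inverse s ^ k" by (simp add: k)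
    ultimately show ?thesis
      unfolding lap_cutoff_def Let_def t_def[symmetric]
      by (simp only:) (simp add: algebra_simps power2_eq_square)
  qed
  ultimately have "((\<lambda>s. 2 * (inverse s ^ DIM('a) * flat 2 (1 - (inverse s)\<^sup>2 * (z \<bullet> z)))) has_real_derivative
     s * inverse s ^ DIM('a) * lap_cutoff s z) (at s)" by simp
  moreover have "2 * (inverse s ^ DIM('a) * flat 2 (1 - (inverse s)\<^sup>2 * (z \<bullet> z)))
     = inverse s ^ DIM('a) * bump (z /\<^sub>R s)" for s :: real
    using bump_scaled[where y = z and x = 0 and s = s] by simp
  ultimately show ?thesis by simp
qed

lemma lap_cutoff_outside:
  assumes "0 < s" "s \<le> norm z" shows "lap_cutoff s z = 0"
proof -
  have "s\<^sup>2 \<le> z \<bullet> z" using assms by (simp add: power_mono flip: power2_norm_eq_inner)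
  then have "1 - (inverse s)\<^sup>2 * (z \<bullet> z) \<le> 0"
    using assms by (simp add: power_inverse field_simps)
  then show ?thesis by (simp add: lap_cutoff_def Let_def flat_eq_0)
qed

lemma borel_measurable_lap_cutoff [measurable]:
  assumes [measurable]: "f \<in> borel_measurable M" "g \<in> borel_measurable M"
  shows "(\<lambda>x. lap_cutoff (f x) (g x :: 'a::euclidean_space)) \<in> borel_measurable M"
  unfolding lap_cutoff_def Let_def by measurable

text \<open>The previous identity, integrated over the scale and tested against a function \<open>w\<close> with
\<open>-\<Delta>w = f\<close>, expresses the difference of two mollifications of \<open>w\<close> by averages of \<open>f\<close>. Fubini's
theorem applies because the derivative kernel is bounded and vanishes outside \<open>cball x b\<close> as long as
\<open>s\<close> ranges over \<open>[a, b]\<close> with \<open>a > 0\<close>.\<close>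

theorem mean_value_formula:
  fixes w f :: "'a::euclidean_space \<Rightarrow> real"
  assumes [measurable]: "w \<in> borel_measurable borel" "f \<in> borel_measurable borel"
    and w: "integrable lborel (\<lambda>y. indicator (cball x b) y * w y)"
    and weak: "\<And>s. s > 0 \<Longrightarrow>
      (LBINT y. w y * lap_cutoff s (y - x)) = - (LBINT y. f y * cutoff ((y - x) /\<^sub>R s))"
    and ab: "0 < a" "a \<le> b"
  shows "integrable lborel (\<lambda>s. indicator {a..b} s * (s * cutoff_mean f x s))"
    and "bump_mean w x b - bump_mean w x a
      = - (LBINT s. indicator {a..b} s * (s * cutoff_mean f x s))"
proof -
  let ?u = "\<lambda>y. indicator (cball x b) y * w y"
  define D where "D s y = s * inverse s ^ DIM('a) * lap_cutoff s (y - x)" for s y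
  define F where "F s y = indicator {a..b} s * (D s y * w y)" for s y
  have [measurable]: "case_prod F \<in> borel_measurable (lborel \<Otimes>\<^sub>M lborel)"
    unfolding F_def D_def by measurable
  have "compact ((\<lambda>(s, y). D s y) ` ({a..b} \<times> cball x b))"
    unfolding D_def lap_cutoff_def Let_def case_prod_unfold using ab
    by (intro compact_continuous_image continuous_intros compact_Times) auto
  then obtain C where C: "\<And>s y. s \<in> {a..b} \<Longrightarrow> y \<in> cball x b \<Longrightarrow> \<bar>D s y\<bar> \<le> C"
    by (force dest!: compact_imp_bounded simp: bounded_iff)
  have C0: "C \<ge> 0" using C[of b x] ab by auto
  have D0: "D s y = 0" if "s \<in> {a..b}" "y \<notin> cball x b" for s y
    using that ab unfolding D_def
    by (subst lap_cutoff_outside) (auto simp: dist_norm norm_minus_commute)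
  have bound: "norm (F s y) \<le> indicator {a..b} s * (C * \<bar>?u y\<bar>)" for s y
    using C[of s y] D0[of s y]
    by (auto simp: F_def indicator_def abs_mult intro!: mult_right_mono)
  have "integrable (lborel \<Otimes>\<^sub>M lborel) (case_prod F)"
  proof (rule lborel_pair.Fubini_integrable)
    have iy: "integrable lborel (\<lambda>y. norm (F s y))" for s
    proof (rule Bochner_Integration.integrable_bound)
      show "integrable lborel (\<lambda>y. indicator {a..b} s * (C * \<bar>?u y\<bar>))"
        using w by (intro integrable_mult_right integrable_abs)
      show "AE y in lborel. norm (norm (F s y)) \<le>
          norm (indicator {a..b} s * (C * \<bar>?u y\<bar>))"
        using bound[of s] C0 by (auto intro!: AE_I2 simp: abs_mult)
    qed measurable
    then show "AE s in lborel. integrable lborel (\<lambda>y. case_prod F (s, y))"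
      by (auto intro!: AE_I2 integrable_norm_cancel[OF iy])
    show "integrable lborel (\<lambda>s. LBINT y. norm (case_prod F (s, y)))"
    proof (rule Bochner_Integration.integrable_bound)
      let ?I = "LBINT y. C * \<bar>?u y\<bar>"
      show "integrable lborel (\<lambda>s. indicator {a..b} s * ?I)"
        by (intro integrable_mult_left integrable_real_indicator) (auto simp: emeasure_lborel_Icc_eq)
      have "(LBINT y. norm (F s y)) \<le> (LBINT y. indicator {a..b} s * (C * \<bar>?u y\<bar>))" for s
        using w by (intro integral_mono iy bound integrable_mult_right integrable_abs)
      then show "AE s in lborel. norm (LBINT y. norm (case_prod F (s, y))) \<le> norm (indicator {a..b} s * ?I)"
        by (intro AE_I2) (fastforce intro: order_trans[OF _ abs_ge_self])
    qed measurable
  qed measurable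
  note fub = lborel_pair.integrable_fst[OF this] lborel_pair.Fubini_integral[OF this]
  have scale: "(LBINT h. k h * u (x + s *\<^sub>R h)) = inverse s ^ DIM('a) * (LBINT y. k ((y - x) /\<^sub>R s) * u y)"
    if "s > 0" "k \<in> borel_measurable borel" "u \<in> borel_measurable borel" for s and k u :: "'a \<Rightarrow> real"
  proof -
    note [measurable] = that(2,3)
    show ?thesis using \<open>s > 0\<close>
      by (subst lborel_integral_affine[where c = s and t = x and f = "\<lambda>y. k ((y - x) /\<^sub>R s) * u y"])
         (simp_all add: power_inverse)
  qed
  have Wint: "integrable lborel (\<lambda>y. inverse s ^ DIM('a) * bump ((y - x) /\<^sub>R s) * w y)"
    if s: "s \<in> {a..b}" for s
  proof -
    obtain B where B: "\<And>z::'a. bump z \<le> B" using bump_bounded by blast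
    show ?thesis
  proof (rule Bochner_Integration.integrable_bound)
    show "integrable lborel (\<lambda>y. inverse s ^ DIM('a) * B * (?u y))"
      using w by simp
    have "bump ((y - x) /\<^sub>R s) = 0" if "y \<notin> cball x b" for y
      using that s ab by (intro bump_outside) (auto simp: dist_norm norm_minus_commute inverse_eq_divide pos_le_divide_eq)
    then show "AE y in lborel. norm (inverse s ^ DIM('a) * bump ((y - x) /\<^sub>R s) * w y) \<le>
        norm (inverse s ^ DIM('a) * B * (?u y))"
      using B by (auto intro!: AE_I2 mult_mono mult_left_mono mult_right_mono order_trans[OF B abs_ge_self]
            simp: abs_mult indicator_def bump_nonneg)
  qed measurable
  qed
  have inner: "(LBINT y. F s y) = - (indicator {a..b} s * (s * cutoff_mean f x s))" for s
  proof (cases "s \<in> {a..b}")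
    case True
    then have "s > 0" using ab by auto
    then have "(LBINT y. F s y) = s * (inverse s ^ DIM('a) * (LBINT y. w y * lap_cutoff s (y - x)))"
      using True by (simp add: F_def D_def mult_ac flip: integral_mult_right_zero)
    also have "\<dots> = - (s * (inverse s ^ DIM('a) * (LBINT y. cutoff ((y - x) /\<^sub>R s) * f y)))"
      by (simp add: weak[OF \<open>s > 0\<close>] mult.commute)
    finally show ?thesis using True by (simp add: cutoff_mean_def scale[OF \<open>s > 0\<close>])
  qed (simp add: F_def)
  show "integrable lborel (\<lambda>s. indicator {a..b} s * (s * cutoff_mean f x s))"
    using fub(1) unfolding inner by simp
  have "(LBINT s. F s y) = inverse b ^ DIM('a) * bump ((y - x) /\<^sub>R b) * w y
      - inverse a ^ DIM('a) * bump ((y - x) /\<^sub>R a) * w y" for y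
  proof -
    have "(LBINT s. indicator {a..b} s *\<^sub>R D s y) = inverse b ^ DIM('a) * bump ((y - x) /\<^sub>R b)
      - inverse a ^ DIM('a) * bump ((y - x) /\<^sub>R a)"
    proof (rule integral_FTC_atLeastAtMost)
      fix s assume "a \<le> s" "s \<le> b"
      then show "((\<lambda>s. inverse s ^ DIM('a) * bump ((y - x) /\<^sub>R s)) has_vector_derivative D s y)
          (at s within {a..b})"
        using scaled_bump_derivative[of s "y - x"] ab unfolding D_def
        by (simp add: has_real_derivative_iff_has_vector_derivative has_vector_derivative_at_within)
    next
      show "continuous_on {a..b} (\<lambda>s. D s y)"
        unfolding D_def lap_cutoff_def Let_def using ab by (intro continuous_intros) auto
    qed (use ab in auto)
    moreover have "(LBINT s. F s y) = (LBINT s. indicator {a..b} s *\<^sub>R D s y) * w y"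
      by (simp add: F_def mult.assoc flip: integral_mult_left_zero)
    ultimately show ?thesis by (simp add: left_diff_distrib)
  qed
  then have "(LBINT y. (LBINT s. F s y)) = bump_mean w x b - bump_mean w x a"
    using Wint[of a] Wint[of b] ab by (simp add: bump_mean_def scale mult.assoc)
  with fub(2) show "bump_mean w x b - bump_mean w x a
      = - (LBINT s. indicator {a..b} s * (s * cutoff_mean f x s))"
    unfolding inner by simp
qed

section \<open>From mollifications to bounds almost everywhere\<close>

text \<open>Outer regularity of the measure with density \<open>H\<close>, which is finite on balls, transfers the
inequality from open sets to the set where it is claimed to fail.\<close>

lemma ae_le_if_open_integrals_le:
  fixes w H :: "'a::euclidean_space \<Rightarrow> ennreal"
  assumes [measurable]: "w \<in> borel_measurable borel" "H \<in> borel_measurable borel"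
    and fin: "\<And>n::nat. (LBNN x. H x * indicator (ball 0 n) x) < \<infinity>"
    and le: "\<And>U. open U \<Longrightarrow> (LBNN x. w x * indicator U x) \<le> (LBNN x. H x * indicator U x)"
  shows "AE x in lborel. w x \<le> H x"
proof -
  let ?W = "\<lambda>B. LBNN x. w x * indicator B x"
  let ?H = "\<lambda>B. LBNN x. H x * indicator B x"
  let ?D = "\<lambda>B. LBNN x. (w x - H x) * indicator B x"
  have "AE x in lborel. x \<in> ball 0 (real n) \<longrightarrow> w x \<le> H x" for n
  proof -
    define \<mu> where "\<mu> = density lborel (\<lambda>x. H x * indicator (ball 0 n) x)"
    have sm: "sets \<mu> = sets borel" by (simp add: \<mu>_def)
    have em: "emeasure \<mu> A = (LBNN x. H x * indicator (ball 0 n) x * indicator A x)"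
      if "A \<in> sets borel" for A
      using that unfolding \<mu>_def by (subst emeasure_density) (measurable, simp_all)
    have "emeasure \<mu> (space \<mu>) \<noteq> \<infinity>"
      using fin[of n] em[of UNIV] by (simp add: \<mu>_def)
    note outer = outer_regular[OF sm this]
    define B where "B = {x \<in> ball 0 (real n). H x < w x}"
    have [measurable]: "B \<in> sets borel" unfolding B_def by measurable
    have "?W B \<le> emeasure \<mu> U" if "B \<subseteq> U" "open U" for U
    proof -
      have "?W B \<le> (LBNN x. w x * indicator (ball 0 n \<inter> U) x)"
        using that by (intro nn_integral_mono) (auto simp: indicator_def B_def)
      also have "\<dots> \<le> (LBNN x. H x * indicator (ball 0 n \<inter> U) x)"
        using that by (intro le) auto
      also have "\<dots> = emeasure \<mu> U"
        using that by (subst em) (auto simp: indicator_inter_arith mult.assoc)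
      finally show ?thesis .
    qed
    then have "?W B \<le> emeasure \<mu> B"
      by (subst outer) (auto intro!: INF_greatest)
    also have "emeasure \<mu> B = ?H B"
      by (subst em) (auto intro!: nn_integral_cong simp: indicator_def B_def)
    finally have wH: "?W B \<le> ?H B" .
    have finB: "?H B < \<infinity>"
      by (rule le_less_trans[OF nn_integral_mono fin[of n]]) (auto simp: indicator_def B_def)
    have "?W B =
        (LBNN x. H x * indicator B x + (w x - H x) * indicator B x)"
      by (intro nn_integral_cong) (auto simp: indicator_def B_def add_diff_inverse_ennreal less_imp_le)
    also have "\<dots> = ?H B + ?D B"
      by (rule nn_integral_add) measurable
    finally have "?D B = 0"
      using wH finB ennreal_add_left_cancel_le[of "LBNN x. H x * indicator B x" _ 0] by auto
    then have "AE x in lborel. (w x - H x) * indicator B x = 0"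
      by (subst (asm) nn_integral_0_iff_AE) auto
    then show ?thesis
      by eventually_elim
        (auto simp: indicator_def B_def not_less ennreal_minus_eq_0 split: if_splits)
  qed
  then have "AE x in lborel. \<forall>n::nat. x \<in> ball 0 (real n) \<longrightarrow> w x \<le> H x"
    unfolding AE_all_countable by blast
  then show ?thesis
    by eventually_elim (use reals_Archimedean2 in auto)
qed

lemma nn_integral_bump: "(LBNN h. ennreal (bump (h::'a::euclidean_space))) = ennreal (bump_mass TYPE('a))"
  and nn_integral_cutoff: "(LBNN h. ennreal (cutoff (h::'a::euclidean_space))) = ennreal (cutoff_mass TYPE('a))"
  unfolding bump_mass_def cutoff_mass_def
  by (intro nn_integral_eq_integral integrable_bump integrable_cutoff; simp add: bump_nonneg cutoff_nonneg)+

lemma nn_integral_translate: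
  fixes f :: "'a::euclidean_space \<Rightarrow> ennreal"
  assumes [measurable]: "f \<in> borel_measurable borel"
  shows "(LBNN x. f (x + t)) = (LBNN x. f x)"
  using nn_integral_affine[OF assms, of 1 t] by (simp add: add.commute)

text \<open>By Fatou's lemma the integral of \<open>w\<close> over an open set is at most the lower limit of the integrals of
its mollifications over that set, so the bound for the mollifications passes to integrals over open sets.\<close>

lemma ae_le_of_bump_mean_le:
  fixes w H :: "'a::euclidean_space \<Rightarrow> ennreal"
  assumes [measurable]: "w \<in> borel_measurable borel" "H \<in> borel_measurable borel"
    and fin: "\<And>n::nat. (LBNN x. H x * indicator (ball 0 n) x) < \<infinity>"
    and r: "r > 0"
    and le: "\<And>x a. 0 < a \<Longrightarrow> a < r \<Longrightarrow> (LBNN h. ennreal (bump h) * w (x + a *\<^sub>R h)) \<le> H x"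
  shows "AE x in lborel. ennreal (bump_mass TYPE('a)) * w x \<le> H x"
proof (rule ae_le_if_open_integrals_le)
  fix U :: "'a set" assume U: "open U"
  then have [measurable]: "U \<in> sets borel" by simp
  define a where "a n = r / (real n + 2)" for n
  have a: "0 < a n" "a n < r" for n using r by (auto simp: a_def field_simps add_pos_nonneg)
  have a0: "a \<longlonglongrightarrow> 0" unfolding a_def
    by (rule real_tendsto_divide_at_top[OF tendsto_const])
       (auto intro!: filterlim_tendsto_add_at_top[of "\<lambda>_. 2" 2, simplified add.commute] filterlim_real_sequentially simp: add.commute)
  have lim: "c * indicator U y \<le> liminf (\<lambda>n. c * indicator U (y - a n *\<^sub>R h))" for y h :: 'a and c :: ennreal
  proof (cases "y \<in> U")
    case True
    have "(\<lambda>n. y - a n *\<^sub>R h) \<longlonglongrightarrow> y - 0 *\<^sub>R h"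
      by (intro tendsto_intros a0)
    then have "eventually (\<lambda>n. y - a n *\<^sub>R h \<in> U) sequentially"
      using U True by (auto dest: topological_tendstoD)
    then show ?thesis
      by (intro Liminf_bounded) (auto elim!: eventually_mono simp: True)
  qed simp
  have "(LBNN x. ennreal (bump_mass TYPE('a)) * w x * indicator U x)
     = ennreal (bump_mass TYPE('a)) * (LBNN x. w x * indicator U x)"
    by (simp add: mult.assoc nn_integral_cmult)
  also have "\<dots> = (\<integral>\<^sup>+h. ennreal (bump h) * (LBNN y. w y * indicator U y) \<partial>(lborel::'a measure))"
    by (simp add: nn_integral_multc nn_integral_bump)
  also have "\<dots> = (\<integral>\<^sup>+h. (LBNN y. ennreal (bump h) * w y * indicator U y) \<partial>(lborel::'a measure))"
    by (simp add: nn_integral_cmult mult.assoc)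
  also have "\<dots> \<le> (LBNN h. (LBNN y. liminf (\<lambda>n. ennreal (bump h) * w y * indicator U (y - a n *\<^sub>R h))))"
    by (intro nn_integral_mono lim)
  also have "\<dots> \<le> (LBNN h. liminf (\<lambda>n. (LBNN y. ennreal (bump h) * w y * indicator U (y - a n *\<^sub>R h))))"
    by (intro nn_integral_mono nn_integral_liminf) measurable
  also have "\<dots> \<le> liminf (\<lambda>n. LBNN h. (LBNN y. ennreal (bump h) * w y * indicator U (y - a n *\<^sub>R h)))"
    by (intro nn_integral_liminf) measurable
  also have "\<dots> \<le> liminf (\<lambda>n. LBNN x. H x * indicator U x)"
  proof (intro Liminf_mono always_eventually allI)
    fix n
    have "(LBNN h. (LBNN y. ennreal (bump h) * w y * indicator U (y - a n *\<^sub>R h)))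
      = (LBNN h. (LBNN y. ennreal (bump h) * w (y + a n *\<^sub>R h) * indicator U y))"
    proof (rule nn_integral_cong)
      fix h
      show "(LBNN y. ennreal (bump h) * w y * indicator U (y - a n *\<^sub>R h))
        = (LBNN y. ennreal (bump h) * w (y + a n *\<^sub>R h) * indicator U y)"
        using nn_integral_translate[of "\<lambda>y. ennreal (bump h) * w y * indicator U (y - a n *\<^sub>R h)" "a n *\<^sub>R h"]
        by simp
    qed
    also have "\<dots> = (LBNN y. (LBNN h. ennreal (bump h) * w (y + a n *\<^sub>R h) * indicator U y))"
      by (rule lborel_pair.Fubini'[symmetric]) measurable
    also have "\<dots> \<le> (LBNN y. H y * indicator U y)"
      by (intro nn_integral_mono) (auto simp: indicator_def intro!: le a)
    finally show "(LBNN h. (LBNN y. ennreal (bump h) * w y * indicator U (y - a n *\<^sub>R h)))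
       \<le> (LBNN y. H y * indicator U y)" .
  qed
  finally show "(LBNN x. ennreal (bump_mass TYPE('a)) * w x * indicator U x) \<le> (LBNN x. H x * indicator U x)"
    by (simp add: Liminf_const)
qed (use fin in auto)

section \<open>Truncated Newtonian potentials\<close>

text \<open>Up to a constant factor a truncated Newtonian potential of \<open>g\<close>, written as a superposition of averages of \<open>g\<close> over
the scales up to \<open>r\<close>; it is what the mean value formula produces when the lower scale tends to \<open>0\<close>.\<close>

definition potential :: "real \<Rightarrow> ('a::euclidean_space \<Rightarrow> ennreal) \<Rightarrow> 'a \<Rightarrow> ennreal" where
  "potential r g x = (LBNN s. indicator {0<..r} s * (ennreal s * (LBNN h. ennreal (cutoff h) * g (x + s *\<^sub>R h))))"

lemma borel_measurable_potential [measurable]: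
  assumes [measurable]: "g \<in> borel_measurable borel"
  shows "potential r g \<in> borel_measurable borel"
  unfolding potential_def[abs_def] by measurable

lemma potential_mono:
  "(\<And>x. g x \<le> g' x) \<Longrightarrow> potential r g x \<le> potential r g' x"
  unfolding potential_def by (intro nn_integral_mono mult_left_mono) auto

lemma potential_add:
  assumes [measurable]: "g \<in> borel_measurable borel" "g' \<in> borel_measurable borel"
  shows "potential r (\<lambda>x. g x + g' x) x = potential r g x + potential r g' x"
  unfolding potential_def by (simp add: distrib_left nn_integral_add)

lemma potential_cmult:
  assumes [measurable]: "g \<in> borel_measurable borel"
  shows "potential r (\<lambda>x. c * g x) x = c * potential r g x"
proof -
  have "potential r (\<lambda>x. c * g x) x = (LBNN s. c * (indicator {0<..r} s * (ennreal s * (LBNN h. ennreal (cutoff h) * g (x + s *\<^sub>R h)))))"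
    unfolding potential_def
    by (subst nn_integral_cmult[symmetric] | simp add: mult.left_commute)+
  also have "\<dots> = c * potential r g x"
    unfolding potential_def by (rule nn_integral_cmult) measurable
  finally show ?thesis .
qed

lemma potential_le:
  assumes "\<And>s. 0 < s \<Longrightarrow> s \<le> r \<Longrightarrow> ennreal s * (LBNN h. ennreal (cutoff h) * g (x + s *\<^sub>R h)) \<le> C" "r > 0"
  shows "potential r g x \<le> C * r"
proof -
  have "potential r g x \<le> (LBNN s. C * indicator {0<..r} s)"
    unfolding potential_def using assms by (intro nn_integral_mono) (auto simp: indicator_def)
  also have "\<dots> = C * r" using assms by (simp add: nn_integral_cmult_indicator)
  finally show ?thesis .
qed

text \<open>The potential is a convolution with an even kernel, hence a symmetric operator.\<close>

lemma potential_symmetric: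
  fixes f g :: "'a::euclidean_space \<Rightarrow> ennreal"
  assumes [measurable]: "f \<in> borel_measurable borel" "g \<in> borel_measurable borel"
  shows "(LBNN x. f x * potential r g x) = (LBNN x. g x * potential r f x)"
proof -
  have expand: "(LBNN x. f x * potential r g x) =
    (LBNN s. indicator {0<..r} s * (ennreal s * (LBNN h. ennreal (cutoff h) * (LBNN x. f x * g (x + s *\<^sub>R h)))))"
    if [measurable]: "f \<in> borel_measurable borel" "g \<in> borel_measurable borel" for f g :: "'a \<Rightarrow> ennreal"
  proof -
    let ?k = "\<lambda>s h x. ennreal (cutoff h) * (f x * g (x + s *\<^sub>R h))"
    have "(LBNN x. f x * potential r g x) = (LBNN x. (LBNN s. indicator {0<..r} s * (ennreal s * (LBNN h. ?k s h x))))"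
    proof (intro nn_integral_cong)
      fix x
      have "(LBNN h. ?k s h x) = f x * (LBNN h. ennreal (cutoff h) * g (x + s *\<^sub>R h))" for s
        by (subst nn_integral_cmult[symmetric]) (auto simp: mult.left_commute)
      then show "f x * potential r g x = (LBNN s. indicator {0<..r} s * (ennreal s * (LBNN h. ?k s h x)))"
        unfolding potential_def by (subst nn_integral_cmult[symmetric]) (auto simp: mult.left_commute)
    qed
    also have "\<dots> = (LBNN s. (LBNN x. indicator {0<..r} s * (ennreal s * (LBNN h. ?k s h x))))"
      by (rule lborel_pair.Fubini') measurable
    also have "\<dots> = (LBNN s. indicator {0<..r} s * (ennreal s * (LBNN x. (LBNN h. ?k s h x))))"
      by (simp add: nn_integral_cmult)
    also have "\<dots> = (LBNN s. indicator {0<..r} s * (ennreal s * (LBNN h. (LBNN x. ?k s h x))))"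
    proof -
      have "(LBNN x. (LBNN h. ?k s h x)) =
        (LBNN h. (LBNN x. ?k s h x))" for s
        by (rule lborel_pair.Fubini'[symmetric]) measurable
      then show ?thesis by simp
    qed
    also have "\<dots> = (LBNN s. indicator {0<..r} s * (ennreal s * (LBNN h. ennreal (cutoff h) * (LBNN x. f x * g (x + s *\<^sub>R h)))))"
      by (simp add: nn_integral_cmult)
    finally show ?thesis .
  qed
  have "(LBNN h. ennreal (cutoff h) * (LBNN x. f x * g (x + s *\<^sub>R h)))
     = (LBNN h. ennreal (cutoff h) * (LBNN x. g x * f (x + s *\<^sub>R h)))" for s
  proof -
    have "(LBNN h. ennreal (cutoff h) * (LBNN x. f x * g (x + s *\<^sub>R h)))
       = (LBNN h. ennreal (cutoff (- h)) * (LBNN x. f x * g (x + s *\<^sub>R (- h))))"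
      using nn_integral_affine[of "\<lambda>h. ennreal (cutoff h) * (LBNN x. f x * g (x + s *\<^sub>R h))" "- 1" 0]
      by simp
    also have "\<dots> = (LBNN h. ennreal (cutoff h) * (LBNN x. g x * f (x + s *\<^sub>R h)))"
    proof (intro nn_integral_cong)
      fix h :: 'a
      show "ennreal (cutoff (- h)) * (LBNN x. f x * g (x + s *\<^sub>R (- h))) = ennreal (cutoff h) * (LBNN x. g x * f (x + s *\<^sub>R h))"
        by (subst nn_integral_translate[symmetric, of _ "s *\<^sub>R h"]) (measurable, simp add: cutoff_minus mult.commute)
    qed
    finally show ?thesis .
  qed
  then show ?thesis by (simp add: expand)
qed

section \<open>Boundedness of subsolutions\<close>

text \<open>The potential of \<open>w\<^sup>\<alpha>\<close> is small at small radii, uniformly in \<open>x\<close>, once \<open>w\<^sup>q\<close> is integrable with \<open>q\<close> at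
least the dimension times \<open>\<alpha>\<close>. At scale \<open>s\<close> one splits \<open>w\<^sup>\<alpha>\<close> at the height \<open>1/s\<close>: the lower part
contributes the mass of \<open>\<zeta>\<close>, the upper part is controlled by the integral of \<open>w\<^sup>q\<close>, so that every scale
contributes a bounded amount.\<close>

lemma potential_powr_le:
  fixes w :: "'a::euclidean_space \<Rightarrow> real"
  assumes [measurable]: "w \<in> borel_measurable borel" and w0: "\<And>x. 0 \<le> w x"
    and q: "\<alpha> > 0" "q \<ge> real DIM('a) * \<alpha>"
    and r: "0 < r" "r \<le> 1"
  shows "potential r (\<lambda>y. ennreal (w y powr \<alpha>)) x
     \<le> (cutoff_mass TYPE('a) + (LBNN y. ennreal (w y powr q))) * r"
proof (rule potential_le[OF _ \<open>0 < r\<close>])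
  fix s assume s: "0 < s" "s \<le> r"
  let ?I = "LBNN h. ennreal (w (x + s *\<^sub>R h) powr q)"
  let ?A = "LBNN h. ennreal (cutoff h) * ennreal (w (x + s *\<^sub>R h) powr \<alpha>)"
  let ?J = "LBNN y. ennreal (w y powr q)"
  define b where "b = q / \<alpha>"
  have b: "b \<ge> DIM('a)" using q by (simp add: b_def field_simps)
  have b1: "b \<ge> 1" using b DIM_positive[where 'a='a] by linarith
  have *: "w y powr \<alpha> \<le> 1 / s + s powr (b - 1) * w y powr q" for y
  proof (cases "w y powr \<alpha> \<le> 1 / s")
    case True
    then show ?thesis by (simp add: add_increasing2)
  next
    case False
    define V where "V = w y powr \<alpha>"
    have V: "V > 0" "V * s \<ge> 1" using False s by (auto simp: V_def field_simps not_le)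
    have "V * s \<le> (V * s) powr b" using V b1 powr_mono[of 1 b "V * s"] by simp
    also have "\<dots> = w y powr q * s powr b"
      using V s q by (simp add: powr_mult V_def powr_powr b_def)
    finally have "V * s \<le> w y powr q * s powr b" .
    moreover have "s powr b = s powr (b - 1) * s" using s by (simp add: powr_diff)
    ultimately have "V \<le> s powr (b - 1) * w y powr q" using s by (simp add: mult_ac)
    then show ?thesis using s by (simp add: V_def add_increasing)
  qed
  have "?A \<le>
     (LBNN h. ennreal (1 / s) * ennreal (cutoff h) + ennreal (s powr (b - 1)) * ennreal (w (x + s *\<^sub>R h) powr q))"
  proof (rule nn_integral_mono)
    fix h :: 'a
    have "cutoff h * w (x + s *\<^sub>R h) powr \<alpha> \<le> cutoff h * (1 / s + s powr (b - 1) * w (x + s *\<^sub>R h) powr q)"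
      by (intro mult_left_mono * cutoff_nonneg)
    also have "\<dots> \<le> 1 / s * cutoff h + s powr (b - 1) * w (x + s *\<^sub>R h) powr q"
      using mult_right_mono[OF cutoff_le_1[of h], of "s powr (b - 1) * w (x + s *\<^sub>R h) powr q"] s
      by (simp add: algebra_simps)
    finally show "ennreal (cutoff h) * ennreal (w (x + s *\<^sub>R h) powr \<alpha>)
       \<le> ennreal (1 / s) * ennreal (cutoff h) + ennreal (s powr (b - 1)) * ennreal (w (x + s *\<^sub>R h) powr q)"
      using s by (simp add: cutoff_nonneg flip: ennreal_mult ennreal_plus)
  qed
  also have "\<dots> = ennreal (1 / s) * cutoff_mass TYPE('a) + ennreal (s powr (b - 1)) * ?I"
    by (simp add: nn_integral_add nn_integral_cmult nn_integral_cutoff)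
  finally have "ennreal s * ?A \<le>
     ennreal s * (ennreal (1 / s) * cutoff_mass TYPE('a) + ennreal (s powr (b - 1)) * ?I)"
    by (rule mult_left_mono) simp
  also have "\<dots> = ennreal (cutoff_mass TYPE('a)) + ennreal (s powr b) * ?I"
  proof -
    have "ennreal s * ennreal (1 / s) = 1" "ennreal s * ennreal (s powr (b - 1)) = ennreal (s powr b)"
      using s by (simp_all add: powr_diff flip: ennreal_mult)
    then show ?thesis by (simp add: distrib_left flip: mult.assoc)
  qed
  also have "ennreal (s powr b) * ?I
      \<le> ennreal (s ^ DIM('a)) * ?I"
  proof (intro mult_right_mono ennreal_leI)
    have "s powr b \<le> s powr real DIM('a)" using s r b by (intro powr_mono') auto
    then show "s powr b \<le> s ^ DIM('a)" using s by (simp add: powr_realpow)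
  qed simp
  also have "\<dots> = ?J"
    using s nn_integral_affine[of "\<lambda>y. ennreal (w y powr q)" s x] by simp
  finally show "ennreal s * ?A
     \<le> cutoff_mass TYPE('a) + ?J" by simp
qed

text \<open>Put \<open>V = w\<^sup>p\<^sup>-\<^sup>2\<close> and let \<open>T\<close> be the potential operator, so that \<open>T V \<le> m/2\<close> at a small radius, where
\<open>m\<close> is the mass of \<open>\<eta>\<close>. The mean value inequality gives \<open>m w \<le> M' + T(V w)\<close>, and then the excess
\<open>u = (w - M)\<^sub>+\<close> over \<open>M = 2M'/m\<close> satisfies \<open>m u \<le> T(V u)\<close>. Integration against \<open>V\<close> and the symmetry of
\<open>T\<close> yield \<open>m \<integral>V u \<le> \<integral>V u T V \<le> (m/2) \<integral>V u\<close>. As \<open>V u \<le> w\<^sup>p/M\<close> is integrable, the excess vanishes.\<close>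

theorem bounded_of_subsolution:
  fixes w :: "'a::euclidean_space \<Rightarrow> real"
  assumes [measurable]: "w \<in> borel_measurable borel" and w0: "\<And>x. 0 \<le> w x"
    and p: "2 < p" "(LBNN x. ennreal (w x powr p)) < \<infinity>"
    and q: "real DIM('a) * (p - 2) \<le> q" "1 \<le> q" "(LBNN x. ennreal (w x powr q)) < \<infinity>"
    and sub: "\<And>x a r. 0 < a \<Longrightarrow> a < r \<Longrightarrow>
      (LBNN h. ennreal (bump h) * ennreal (w (x + a *\<^sub>R h))) \<le>
      (LBNN h. ennreal (bump h) * ennreal (w (x + r *\<^sub>R h)))
        + potential r (\<lambda>y. ennreal (w y powr (p - 1))) x"
  obtains M where "M > 0" "AE x in lborel. w x \<le> M"
proof -
  define m where "m = bump_mass TYPE('a)"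
  have m: "m > 0" using bump_mass_pos by (simp add: m_def)
  define V where "V y = ennreal (w y powr (p - 2))" for y
  have [measurable]: "V \<in> borel_measurable borel" unfolding V_def by measurable
  have Vw: "V y * ennreal (w y) = ennreal (w y powr (p - 1))" for y
    using w0[of y] powr_add[of "w y" "p - 2" 1] by (simp add: V_def flip: ennreal_mult)
  obtain J where J: "(LBNN x. ennreal (w x powr q)) = ennreal J" "J \<ge> 0"
    using q(3) by (cases "LBNN x. ennreal (w x powr q)" rule: ennreal_cases) auto
  define Z where "Z = cutoff_mass TYPE('a)"
  have Z: "Z > 0" using cutoff_mass_pos by (simp add: Z_def)
  \<comment> \<open>The radius is chosen such that the potential of \<open>V\<close> stays below half the mass of the bump.\<close>
  define r where "r = min 1 (m / 2 / (Z + J))"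
  have r: "0 < r" "r \<le> 1" "(Z + J) * r \<le> m / 2"
  proof -
    show "0 < r" "r \<le> 1" using m Z J by (auto simp: r_def)
    have "(Z + J) * r \<le> (Z + J) * (m / 2 / (Z + J))"
      using m Z J by (intro mult_left_mono) (auto simp: r_def)
    also have "\<dots> = m / 2"
      using Z J by (intro nonzero_mult_div_cancel_left[of "Z + J" "m / 2", simplified times_divide_eq_right[symmetric]]) auto
    finally show "(Z + J) * r \<le> m / 2" .
  qed
  have TV: "potential r V x \<le> ennreal (m / 2)" for x
  proof -
    have "potential r V x \<le> (ennreal Z + ennreal J) * ennreal r"
      unfolding V_def Z_def J(1)[symmetric]
      using p q r w0 by (intro potential_powr_le) (auto simp: mult.commute)
    also have "\<dots> = ennreal ((Z + J) * r)" using Z J r by (simp add: ennreal_mult ennreal_plus)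
    also have "\<dots> \<le> ennreal (m / 2)" using r by (intro ennreal_leI)
    finally show ?thesis .
  qed
  obtain B where B: "B > 0" "\<And>z::'a. bump z \<le> B" using bump_bounded by blast
  define M' where "M' = m + B * inverse (r ^ DIM('a)) * J"
  have M': "M' > 0" using m B J r by (simp add: M'_def add_pos_nonneg)
  have mean: "(LBNN h. ennreal (bump h) * ennreal (w (x + r *\<^sub>R h))) \<le> ennreal M'" for x
  proof -
    let ?I = "LBNN h. ennreal (w (x + r *\<^sub>R h) powr q)"
    have "(LBNN h. ennreal (bump h) * ennreal (w (x + r *\<^sub>R h))) \<le>
      (LBNN h. ennreal (bump h) + ennreal B * ennreal (w (x + r *\<^sub>R h) powr q))"
    proof (rule nn_integral_mono)
      fix h
      have "w (x + r *\<^sub>R h) \<le> 1 + w (x + r *\<^sub>R h) powr q"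
      proof (cases "w (x + r *\<^sub>R h) \<le> 1")
        case False
        then show ?thesis using q powr_mono[of 1 q "w (x + r *\<^sub>R h)"] by simp
      qed (simp add: add_increasing2)
      then have "bump h * w (x + r *\<^sub>R h) \<le> bump h * (1 + w (x + r *\<^sub>R h) powr q)"
        by (intro mult_left_mono bump_nonneg)
      also have "\<dots> \<le> bump h + B * w (x + r *\<^sub>R h) powr q"
        using mult_right_mono[OF B(2)[of h], of "w (x + r *\<^sub>R h) powr q"] by (simp add: algebra_simps)
      finally show "ennreal (bump h) * ennreal (w (x + r *\<^sub>R h)) \<le> ennreal (bump h) + ennreal B * ennreal (w (x + r *\<^sub>R h) powr q)"
        using B w0 by (simp add: bump_nonneg flip: ennreal_mult ennreal_plus)
    qed
    also have "\<dots> = ennreal m + ennreal B * ?I"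
      by (simp add: nn_integral_add nn_integral_cmult nn_integral_bump m_def)
    also have "?I
       = ennreal (inverse (r ^ DIM('a))) * (ennreal (r ^ DIM('a)) * ?I)"
      using r by (simp flip: mult.assoc ennreal_mult)
    also have "ennreal (r ^ DIM('a)) * ?I = ennreal J"
      using r nn_integral_affine[of "\<lambda>y. ennreal (w y powr q)" r x] J(1) by simp
    also have "ennreal m + ennreal B * (ennreal (inverse (r ^ DIM('a))) * ennreal J) = ennreal M'"
      using m B J r by (simp add: M'_def mult.assoc flip: ennreal_mult ennreal_plus)
    finally show ?thesis .
  qed
  define H where "H x = ennreal M' + potential r (\<lambda>y. V y * ennreal (w y)) x" for x
  have H_meas [measurable]: "H \<in> borel_measurable borel" unfolding H_def by measurable
  have T1: "potential r (\<lambda>_. 1) x \<le> ennreal Z" for x :: 'a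
  proof -
    have "potential r (\<lambda>_. 1) x \<le> ennreal Z * ennreal r"
    proof (rule potential_le[OF _ r(1)])
      fix s assume "0 < s" "s \<le> r"
      then show "ennreal s * (LBNN h. ennreal (cutoff (h::'a)) * 1) \<le> ennreal Z"
        using r Z by (simp add: nn_integral_cutoff flip: Z_def ennreal_mult)
    qed
    also have "\<dots> \<le> ennreal Z" using r Z by (simp flip: ennreal_mult)
    finally show ?thesis .
  qed
  have Hfin: "(LBNN x. H x * indicator (ball 0 (real n)) x) < \<infinity>" for n
  proof -
    let ?P = "potential r (\<lambda>y. ennreal (w y powr p))"
    have [measurable]: "ball (0::'a) (real n) \<in> sets borel" by simp
    have "V y * ennreal (w y) \<le> 1 + ennreal (w y powr p)" for y
    proof -
      have "w y powr (p - 1) \<le> 1 + w y powr p"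
      proof (cases "w y \<le> 1")
        case True
        then show ?thesis using p w0[of y] powr_mono2[of "p - 1" "w y" 1] by (simp add: add_increasing2)
      next
        case False
        then have "w y powr (p - 1) \<le> w y powr p" by (intro powr_mono) auto
        then show ?thesis by linarith
      qed
      then show ?thesis by (simp add: Vw ennreal_leI flip: ennreal_plus ennreal_1)
    qed
    then have "H x \<le> ennreal M' + ennreal Z + ?P x" for x
      using potential_mono[of "\<lambda>y. V y * ennreal (w y)" "\<lambda>y. 1 + ennreal (w y powr p)" r x] T1[of x]
      unfolding H_def by (subst (asm) potential_add) (auto simp: add.assoc intro!: add_left_mono intro: order_trans add_right_mono)
    then have "(LBNN x. H x * indicator (ball 0 (real n)) x) \<le>
       (LBNN x. (ennreal M' + ennreal Z) * indicator (ball 0 (real n)) x + 1 * ?P x)"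
      by (intro nn_integral_mono) (auto simp: indicator_def)
    also have "\<dots> = (ennreal M' + ennreal Z) * emeasure lborel (ball (0::'a) (real n)) + (LBNN x. 1 * ?P x)"
    proof (subst nn_integral_add)
      show "(\<lambda>x::'a. (ennreal M' + ennreal Z) * indicator (ball 0 (real n)) x) \<in> borel_measurable lborel"
        by measurable
      show "(\<lambda>x. 1 * ?P x) \<in> borel_measurable lborel" by measurable
    qed (simp add: nn_integral_cmult_indicator)
    finally have le: "(LBNN x. H x * indicator (ball 0 (real n)) x)
       \<le> (ennreal M' + ennreal Z) * emeasure lborel (ball (0::'a) (real n)) + (LBNN x. 1 * ?P x)" .
    have "(LBNN x. 1 * ?P x) = (LBNN x. ennreal (w x powr p) * potential r (\<lambda>_. 1) x)"
      by (rule potential_symmetric) measurable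
    also have "\<dots> \<le> (LBNN x. ennreal (w x powr p) * ennreal Z)"
      by (intro nn_integral_mono mult_left_mono T1) simp
    also have "\<dots> = (LBNN x. ennreal (w x powr p)) * ennreal Z"
      by (rule nn_integral_multc) measurable
    also have "\<dots> < \<infinity>" using p(2) by (simp add: ennreal_mult_less_top)
    finally have "(LBNN x. 1 * ?P x) < \<infinity>" .
    then have "(ennreal M' + ennreal Z) * emeasure lborel (ball (0::'a) (real n)) + (LBNN x. 1 * ?P x) < \<infinity>"
      using emeasure_lborel_ball_finite[of "0::'a" "real n"] by (simp add: ennreal_mult_less_top)
    with le show ?thesis by (rule le_less_trans)
  qed
  have "AE x in lborel. ennreal m * ennreal (w x) \<le> H x"
    unfolding m_def
  proof (rule ae_le_of_bump_mean_le[OF _ _ _ r(1)])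
    fix x a assume "0 < a" "a < r"
    from sub[OF this, of x] mean[of x]
    show "(LBNN h. ennreal (bump h) * ennreal (w (x + a *\<^sub>R h))) \<le> H x"
      unfolding H_def Vw by (meson add_right_mono order_trans)
  qed (use Hfin H_meas in simp_all)
  note key = this
  \<comment> \<open>At this level the potential of \<open>M V\<close> is at most \<open>M'\<close>, so both constants add up to \<open>m M\<close>.\<close>
  define M where "M = 2 * M' / m"
  have M: "M > 0" using M' m by (simp add: M_def)
  define u where "u x = ennreal (w x - M)" for x
  have [measurable]: "u \<in> borel_measurable borel" unfolding u_def by measurable
  have mu: "AE x in lborel. ennreal m * u x \<le> potential r (\<lambda>y. V y * u y) x"
    using key
  proof eventually_elim
    case (elim x)
    have "ennreal (w y) \<le> u y + ennreal M" for y
      using M by (cases "w y \<ge> M") (auto simp: u_def ennreal_neg ennreal_leI simp flip: ennreal_plus)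
    then have "V y * ennreal (w y) \<le> V y * u y + ennreal M * V y" for y
      by (metis distrib_left mult.commute mult_left_mono zero_le)
    then have "potential r (\<lambda>y. V y * ennreal (w y)) x \<le> potential r (\<lambda>y. V y * u y + ennreal M * V y) x"
      by (rule potential_mono)
    also have "\<dots> = potential r (\<lambda>y. V y * u y) x + ennreal M * potential r V x"
      by (subst potential_add) (auto simp: potential_cmult)
    also have "ennreal M * potential r V x \<le> ennreal M * ennreal (m / 2)"
      by (intro mult_left_mono TV) simp
    also have "\<dots> = ennreal M'" using m M by (simp add: M_def flip: ennreal_mult)
    finally have "H x \<le> ennreal M' + (potential r (\<lambda>y. V y * u y) x + ennreal M')"
      unfolding H_def by (intro add_left_mono) auto
    also have "\<dots> = ennreal (m * M) + potential r (\<lambda>y. V y * u y) x"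
      using m M' by (simp add: M_def add_ac flip: ennreal_plus)
    finally have *: "ennreal m * ennreal (w x) \<le> ennreal (m * M) + potential r (\<lambda>y. V y * u y) x"
      using elim by auto
    show ?case
    proof (cases "w x \<ge> M")
      case True
      then have "ennreal m * ennreal (w x) = ennreal (m * M) + ennreal m * u x"
        using m M w0[of x] by (simp add: u_def algebra_simps flip: ennreal_mult ennreal_plus)
      with * show ?thesis by (simp add: ennreal_add_left_cancel_le)
    qed (simp add: u_def ennreal_neg)
  qed
  define I where "I = (LBNN x. V x * u x)"
  have Ifin: "I < \<infinity>"
  proof -
    have "V x * u x \<le> ennreal (1 / M) * ennreal (w x powr p)" for x
    proof (cases "w x \<ge> M")
      case True
      then have "w x > 0" using M by simp
      have "w x powr (p - 2) * (w x - M) \<le> w x powr (p - 2) * (w x * (w x / M))"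
      proof (rule mult_left_mono)
        have "w x * 1 \<le> w x * (w x / M)" using True M by (intro mult_left_mono) auto
        then show "w x - M \<le> w x * (w x / M)" using M by linarith
      qed simp
      also have "\<dots> = 1 / M * w x powr p"
        using \<open>w x > 0\<close> by (simp add: powr_diff power2_eq_square)
      finally show ?thesis using True M by (simp add: V_def u_def flip: ennreal_mult)
    qed (simp add: u_def ennreal_neg)
    then have "I \<le> (LBNN x. ennreal (1 / M) * ennreal (w x powr p))"
      unfolding I_def by (rule nn_integral_mono)
    also have "\<dots> = ennreal (1 / M) * (LBNN x. ennreal (w x powr p))"
      by (rule nn_integral_cmult) measurable
    also have "\<dots> < \<infinity>" using p(2) by (simp add: ennreal_mult_less_top)
    finally show ?thesis .
  qed
  have "ennreal m * I = (LBNN x. V x * (ennreal m * u x))"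
    unfolding I_def by (subst nn_integral_cmult[symmetric]) (auto simp: mult.left_commute)
  also have "\<dots> \<le> (LBNN x. V x * potential r (\<lambda>y. V y * u y) x)"
    using mu by (intro nn_integral_mono_AE) (auto elim!: eventually_mono intro: mult_left_mono)
  also have "\<dots> = (LBNN x. (V x * u x) * potential r V x)"
    by (rule potential_symmetric) measurable
  also have "\<dots> \<le> (LBNN x. (V x * u x) * ennreal (m / 2))"
    by (intro nn_integral_mono mult_left_mono TV) simp
  also have "\<dots> = I * ennreal (m / 2)"
    unfolding I_def by (rule nn_integral_multc) measurable
  finally have le: "ennreal m * I \<le> I * ennreal (m / 2)" .
  obtain i where i: "I = ennreal i" "i \<ge> 0" using Ifin by (cases I) auto
  have "m * i \<le> i * (m / 2)" using le m i by (simp flip: ennreal_mult)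
  then have "i = 0" using m i by (simp add: mult_le_0_iff)
  with i have "(LBNN x. V x * u x) = 0" by (simp add: I_def)
  then have "AE x in lborel. V x * u x = 0"
    by (subst (asm) nn_integral_0_iff_AE) auto
  then have "AE x in lborel. w x \<le> M"
  proof eventually_elim
    case (elim x)
    show ?case
    proof (rule ccontr)
      assume "\<not> w x \<le> M"
      then have "w x powr (p - 2) > 0" "w x - M > 0" using M by auto
      with elim show False by (simp add: V_def u_def flip: ennreal_mult)
    qed
  qed
  with M that show ?thesis by blast
qed

section \<open>Continuous representatives\<close>

text \<open>The identity of the mean value formula at all centres and scales: an integrated form of
\<open>-\<Delta>w = f\<close> that makes sense for functions without derivatives.\<close>

definition mean_value_identity :: "('a::euclidean_space \<Rightarrow> real) \<Rightarrow> ('a \<Rightarrow> real) \<Rightarrow> bool" where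
  "mean_value_identity w f \<longleftrightarrow> (\<forall>x a b. 0 < a \<longrightarrow> a \<le> b \<longrightarrow>
     integrable lborel (\<lambda>s. indicator {a..b} s * (s * cutoff_mean f x s)) \<and>
     bump_mean w x b - bump_mean w x a
       = - (LBINT s. indicator {a..b} s * (s * cutoff_mean f x s)))"

lemma integrable_kernel_times:
  fixes k w :: "'a::euclidean_space \<Rightarrow> real"
  assumes k: "integrable lborel k" and w [measurable]: "w \<in> borel_measurable borel"
    and b: "\<And>x. \<bar>w x\<bar> \<le> M"
  shows "integrable lborel (\<lambda>h. k h * w (x + s *\<^sub>R h))"
proof (rule Bochner_Integration.integrable_bound)
  have M: "\<bar>w y\<bar> \<le> \<bar>M\<bar>" for y using b[of y] by linarith
  show "integrable lborel (\<lambda>h. k h * M)" using k by simp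
  show "AE h in lborel. norm (k h * w (x + s *\<^sub>R h)) \<le> norm (k h * M)"
    by (simp add: abs_mult mult_left_mono M)
  note [measurable] = borel_measurable_integrable[OF k]
  show "(\<lambda>h. k h * w (x + s *\<^sub>R h)) \<in> borel_measurable lborel" by measurable
qed

lemmas integrable_bump_times =
  integrable_kernel_times[OF integrable_bump] integrable_kernel_times[OF integrable_cutoff]

lemma kernel_mean_le:
  fixes k w :: "'a::euclidean_space \<Rightarrow> real"
  assumes k: "integrable lborel k" "\<And>h. 0 \<le> k h" "\<And>h. norm h \<ge> 1 \<Longrightarrow> k h = 0"
    and w: "w \<in> borel_measurable borel" "\<And>x. \<bar>w x\<bar> \<le> M"
    and le: "\<And>h. norm h < 1 \<Longrightarrow> w (x + s *\<^sub>R h) \<le> c"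
  shows "(LBINT h. k h * w (x + s *\<^sub>R h)) \<le> (LBINT h. k h) * c"
proof -
  have "(LBINT h. k h * w (x + s *\<^sub>R h)) \<le> (LBINT h. k h * c)"
  proof (rule integral_mono[OF integrable_kernel_times[OF k(1) w]])
    fix h :: 'a
    show "k h * w (x + s *\<^sub>R h) \<le> k h * c"
      using le[of h] k(2,3)[of h] by (cases "norm h < 1") (auto intro: mult_left_mono)
  qed (use k in simp)
  then show ?thesis by simp
qed

lemma bump_mean_le:
  fixes w :: "'a::euclidean_space \<Rightarrow> real"
  assumes "w \<in> borel_measurable borel" "\<And>x. \<bar>w x\<bar> \<le> M"
    and "\<And>h. norm h < 1 \<Longrightarrow> w (x + s *\<^sub>R h) \<le> c"
  shows "bump_mean w x s \<le> bump_mass TYPE('a) * c"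
  unfolding bump_mean_def bump_mass_def
  by (rule kernel_mean_le[OF integrable_bump bump_nonneg _ assms]) (rule bump_outside)

lemma cutoff_mean_le:
  fixes w :: "'a::euclidean_space \<Rightarrow> real"
  assumes "w \<in> borel_measurable borel" "\<And>x. \<bar>w x\<bar> \<le> M"
    and "\<And>h. norm h < 1 \<Longrightarrow> w (x + s *\<^sub>R h) \<le> c"
  shows "cutoff_mean w x s \<le> cutoff_mass TYPE('a) * c"
  unfolding cutoff_mean_def cutoff_mass_def
  by (rule kernel_mean_le[OF integrable_cutoff cutoff_nonneg _ assms]) (rule cutoff_outside)

lemma bump_mean_minus: "bump_mean (\<lambda>x. - w x) x s = - bump_mean w x s"
  and cutoff_mean_minus: "cutoff_mean (\<lambda>x. - w x) x s = - cutoff_mean w x s"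
  by (simp_all add: bump_mean_def cutoff_mean_def)

lemma mean_value_identity_minus:
  assumes "mean_value_identity w f"
  shows "mean_value_identity (\<lambda>x. - w x) (\<lambda>x. - f x)"
  unfolding mean_value_identity_def
proof (intro allI impI)
  fix x and a b :: real assume "0 < a" "a \<le> b"
  with assms have "integrable lborel (\<lambda>s. indicator {a..b} s * (s * cutoff_mean f x s))"
    and "bump_mean w x b - bump_mean w x a = - (LBINT s. indicator {a..b} s * (s * cutoff_mean f x s))"
    by (simp_all add: mean_value_identity_def)
  then show "integrable lborel (\<lambda>s. indicator {a..b} s * (s * cutoff_mean (\<lambda>x. - f x) x s)) \<and>
     bump_mean (\<lambda>x. - w x) x b - bump_mean (\<lambda>x. - w x) x a
       = - (LBINT s. indicator {a..b} s * (s * cutoff_mean (\<lambda>x. - f x) x s))"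
    by (simp add: bump_mean_minus cutoff_mean_minus)
qed

lemma integral_id_Icc:
  fixes a b :: real
  assumes "a \<le> b"
  shows "integrable lborel (\<lambda>s. indicator {a..b} s * (s * c))"
    and "(LBINT s. indicator {a..b} s * (s * c)) = c * (b\<^sup>2 - a\<^sup>2) / 2"
proof -
  have "continuous_on {a..b} (\<lambda>s. s * c)" by (intro continuous_intros)
  from borel_integrable_atLeastAtMost'[OF this]
  show "integrable lborel (\<lambda>s. indicator {a..b} s * (s * c))" by (simp add: set_integrable_def)
  have "((\<lambda>s. c * s\<^sup>2 / 2) has_vector_derivative s * c) (at s within {a..b})" for s
    unfolding has_real_derivative_iff_has_vector_derivative[symmetric]
    by (auto intro!: derivative_eq_intros)
  then have "(LBINT s. indicator {a..b} s *\<^sub>R (s * c)) = c * b\<^sup>2 / 2 - c * a\<^sup>2 / 2"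
    using assms by (intro integral_FTC_atLeastAtMost continuous_intros) auto
  then show "(LBINT s. indicator {a..b} s * (s * c)) = c * (b\<^sup>2 - a\<^sup>2) / 2"
    by (simp add: algebra_simps diff_divide_distrib)
qed

lemma mean_value_difference_le:
  assumes I: "mean_value_identity w f" and ab: "0 < a" "a \<le> b"
    and c: "\<And>s. a \<le> s \<Longrightarrow> s \<le> b \<Longrightarrow> c \<le> cutoff_mean f x s"
  shows "bump_mean w x b - bump_mean w x a \<le> - (c * (b\<^sup>2 - a\<^sup>2) / 2)"
proof -
  have "(LBINT s. indicator {a..b} s * (s * c))
      \<le> (LBINT s. indicator {a..b} s * (s * cutoff_mean f x s))"
    using I ab c unfolding mean_value_identity_def
    by (intro integral_mono integral_id_Icc) (auto simp: indicator_def intro!: mult_left_mono)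
  then show ?thesis
    using I ab unfolding mean_value_identity_def by (simp add: integral_id_Icc)
qed

lemma mean_value_difference_ge:
  assumes I: "mean_value_identity w f" and ab: "0 < a" "a \<le> b"
    and c: "\<And>s. a \<le> s \<Longrightarrow> s \<le> b \<Longrightarrow> cutoff_mean f x s \<le> c"
  shows "bump_mean w x b - bump_mean w x a \<ge> - (c * (b\<^sup>2 - a\<^sup>2) / 2)"
  using mean_value_difference_le[OF mean_value_identity_minus[OF I] ab, of "- c" x] c
  by (simp add: bump_mean_minus cutoff_mean_minus)

lemma bump_mean_tendsto:
  fixes v :: "'a::euclidean_space \<Rightarrow> real"
  assumes v: "continuous_on UNIV v" and b: "\<And>x. \<bar>v x\<bar> \<le> M" and a: "a \<longlonglongrightarrow> 0"
  shows "(\<lambda>n. bump_mean v x (a n)) \<longlonglongrightarrow> bump_mass TYPE('a) * v x"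
proof -
  have [measurable]: "v \<in> borel_measurable borel" using v by (rule borel_measurable_continuous_onI)
  have "(\<lambda>n. LBINT h. bump h * v (x + a n *\<^sub>R h)) \<longlonglongrightarrow> (LBINT h. bump (h::'a) * v x)"
  proof (rule integral_dominated_convergence)
    show "integrable lborel (\<lambda>h::'a. bump h * M)" by (simp add: integrable_bump)
    show "AE h in lborel. norm (bump h * v (x + a n *\<^sub>R h)) \<le> bump h * M" for n
      by (auto simp: abs_mult bump_nonneg intro!: AE_I2 mult_left_mono b)
    have "(\<lambda>n. v (x + a n *\<^sub>R h)) \<longlonglongrightarrow> v (x + 0 *\<^sub>R h)" for h
    proof (rule continuous_on_tendsto_compose[OF v])
      show "(\<lambda>n. x + a n *\<^sub>R h) \<longlonglongrightarrow> x + 0 *\<^sub>R h" by (intro tendsto_intros a)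
    qed auto
    then show "AE h in lborel. (\<lambda>n. bump h * v (x + a n *\<^sub>R h)) \<longlonglongrightarrow> bump h * v x"
      by (intro AE_I2 tendsto_intros) simp
  qed measurable
  then show ?thesis by (simp add: bump_mean_def bump_mass_def)
qed

text \<open>The lower scale has been sent to \<open>0\<close>, where the mollification of a continuous function
converges to its value at the centre.\<close>

lemma mean_value_le:
  fixes v :: "'a::euclidean_space \<Rightarrow> real"
  assumes I: "mean_value_identity v f" and v: "continuous_on UNIV v" and b: "\<And>x. \<bar>v x\<bar> \<le> M"
    and r: "0 < r" and c: "\<And>s. 0 < s \<Longrightarrow> s \<le> r \<Longrightarrow> c \<le> cutoff_mean f x s"
  shows "bump_mean v x r \<le> bump_mass TYPE('a) * v x - c * r\<^sup>2 / 2"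
proof -
  define a where "a n = r / real (Suc n)" for n
  have a0: "a \<longlonglongrightarrow> 0" unfolding a_def
    by (rule real_tendsto_divide_at_top[OF tendsto_const filterlim_compose[OF filterlim_real_sequentially filterlim_Suc]])
  have a: "0 < a n" "a n \<le> r" for n using r by (auto simp: a_def divide_le_eq mult_left_le_one_le field_simps)
  have "bump_mean v x r - bump_mean v x (a n) \<le> - (c * (r\<^sup>2 - (a n)\<^sup>2) / 2)" for n
    using a[of n] by (intro mean_value_difference_le[OF I] c) auto
  moreover have "(\<lambda>n. bump_mean v x r - bump_mean v x (a n)) \<longlonglongrightarrow> bump_mean v x r - bump_mass TYPE('a) * v x"
    by (intro tendsto_intros bump_mean_tendsto[OF v b a0])
  moreover have "(\<lambda>n. - (c * (r\<^sup>2 - (a n)\<^sup>2) / 2)) \<longlonglongrightarrow> - (c * (r\<^sup>2 - 0\<^sup>2) / 2)"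
    by (intro tendsto_intros a0) simp
  ultimately have "bump_mean v x r - bump_mass TYPE('a) * v x \<le> - (c * (r\<^sup>2 - 0\<^sup>2) / 2)"
    by (meson LIMSEQ_le)
  then show ?thesis by simp
qed

lemma mean_value_ge:
  fixes v :: "'a::euclidean_space \<Rightarrow> real"
  assumes I: "mean_value_identity v f" and v: "continuous_on UNIV v" and b: "\<And>x. \<bar>v x\<bar> \<le> M"
    and r: "0 < r" and c: "\<And>s. 0 < s \<Longrightarrow> s \<le> r \<Longrightarrow> cutoff_mean f x s \<le> c"
  shows "bump_mean v x r \<ge> bump_mass TYPE('a) * v x - c * r\<^sup>2 / 2"
  using mean_value_le[OF mean_value_identity_minus[OF I], of M r "- c" x] v b r c
  by (simp add: bump_mean_minus cutoff_mean_minus continuous_on_minus)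

lemma continuous_on_bump_mean:
  fixes w :: "'a::euclidean_space \<Rightarrow> real"
  assumes [measurable]: "w \<in> borel_measurable borel" and b: "\<And>x. \<bar>w x\<bar> \<le> M" and s: "s > 0"
  shows "continuous_on UNIV (\<lambda>x. bump_mean w x s)"
proof -
  obtain B where B: "B > 0" "\<And>z::'a. bump z \<le> B" using bump_bounded by blast
  have eq: "bump_mean w x s = inverse s ^ DIM('a) * (LBINT y. bump ((y - x) /\<^sub>R s) * w y)" for x
    unfolding bump_mean_def using s
    by (subst lborel_integral_affine[where c = s and t = x and f = "\<lambda>y. bump ((y - x) /\<^sub>R s) * w y"])
       (simp_all add: power_inverse)
  have "continuous_on (ball x0 1) (\<lambda>x. LBINT y. bump ((y - x) /\<^sub>R s) * w y)" for x0 :: 'a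
  proof (rule continuous_on_sequentiallyI)
    fix u a assume u: "\<forall>n. u n \<in> ball x0 1" "a \<in> ball x0 1" "u \<longlonglongrightarrow> a"
    show "(\<lambda>n. LBINT y. bump ((y - u n) /\<^sub>R s) * w y) \<longlonglongrightarrow> (LBINT y. bump ((y - a) /\<^sub>R s) * w y)"
    proof (rule integral_dominated_convergence)
      show "integrable lborel (\<lambda>y. indicator (cball x0 (1 + s)) y * (B * M))"
        by (rule integrable_mult_left, rule integrable_real_indicator[OF _ emeasure_lborel_cball_finite]) simp
      have "(\<lambda>n. bump ((y - u n) /\<^sub>R s)) \<longlonglongrightarrow> bump ((y - a) /\<^sub>R s)" for y
        by (rule continuous_on_tendsto_compose[OF continuous_on_bump[of UNIV]])
           (auto intro!: tendsto_intros u)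
      then show "AE y in lborel. (\<lambda>n. bump ((y - u n) /\<^sub>R s) * w y) \<longlonglongrightarrow> bump ((y - a) /\<^sub>R s) * w y"
        by (auto intro!: AE_I2 tendsto_intros)
      show "AE y in lborel. norm (bump ((y - u n) /\<^sub>R s) * w y) \<le> indicator (cball x0 (1 + s)) y * (B * M)" for n
      proof (intro AE_I2)
        fix y
        show "norm (bump ((y - u n) /\<^sub>R s) * w y) \<le> indicator (cball x0 (1 + s)) y * (B * M)"
        proof (cases "y \<in> cball x0 (1 + s)")
          case True
          then show ?thesis using B(1) B(2)[of "(y - u n) /\<^sub>R s"] b[of y]
            by (simp add: abs_mult bump_nonneg mult_mono)
        next
          case False
          then have "1 + s < dist x0 y" by simp
          also have "dist x0 y \<le> dist x0 (u n) + dist (u n) y" by (rule dist_triangle)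
          finally have "s < norm (y - u n)" using u(1) by (simp add: dist_norm norm_minus_commute) (smt (verit))
          then have "bump ((y - u n) /\<^sub>R s) = 0"
            using s by (intro bump_outside) (simp add: inverse_eq_divide pos_le_divide_eq)
          then show ?thesis using False by simp
        qed
      qed
    qed measurable
  qed
  then have "continuous_on (ball x0 1) (\<lambda>x. bump_mean w x s)" for x0
    unfolding eq by (intro continuous_intros)
  then have "isCont (\<lambda>x. bump_mean w x s) x0" for x0
    using continuous_on_eq_continuous_at[OF open_ball, of x0 1] by (metis centre_in_ball zero_less_one)
  then show ?thesis by (simp add: continuous_at_imp_continuous_on)
qed

text \<open>With \<open>f\<close> bounded, the mollifications form a uniform Cauchy family as the scale tends to \<open>0\<close>, with
continuous limit. The limit dominates \<open>w\<close>, and the same argument applied to \<open>M - w\<close> gives the reverse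
inequality.\<close>

theorem continuous_representative:
  fixes w f :: "'a::euclidean_space \<Rightarrow> real"
  assumes w [measurable]: "w \<in> borel_measurable borel" and f: "f \<in> borel_measurable borel"
    and wb: "\<And>x. 0 \<le> w x" "\<And>x. w x \<le> M" and fb: "\<And>x. \<bar>f x\<bar> \<le> F"
    and I: "mean_value_identity w f"
  obtains v where "continuous_on UNIV v" "\<And>x. 0 \<le> v x" "\<And>x. v x \<le> M" "AE x in lborel. v x = w x"
proof -
  let ?m = "bump_mass TYPE('a)"
  have m: "?m > 0" by (rule bump_mass_pos)
  have wM: "\<bar>w x\<bar> \<le> M" for x using wb[of x] by simp
  define C where "C = cutoff_mass TYPE('a) * F"
  have cm: "cutoff_mean f x s \<le> C" "- C \<le> cutoff_mean f x s" for x s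
    using cutoff_mean_le[OF f fb, of x s F] cutoff_mean_le[of "\<lambda>x. - f x" F x s F] f fb
    by (simp_all add: C_def cutoff_mean_minus abs_le_iff)
  have C: "C \<ge> 0" using cm[of 0 0] by linarith
  have diff: "\<bar>bump_mean w x b - bump_mean w x a\<bar> \<le> C * b\<^sup>2" if "0 < a" "a \<le> b" for x a b
  proof -
    have "bump_mean w x b - bump_mean w x a \<le> - ((- C) * (b\<^sup>2 - a\<^sup>2) / 2)"
      by (rule mean_value_difference_le[OF I that]) (rule cm)
    moreover have "bump_mean w x b - bump_mean w x a \<ge> - (C * (b\<^sup>2 - a\<^sup>2) / 2)"
      by (rule mean_value_difference_ge[OF I that]) (rule cm)
    moreover have "C * (b\<^sup>2 - a\<^sup>2) \<le> C * b\<^sup>2" by (rule mult_left_mono) (auto simp: C)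
    moreover have "0 \<le> C * b\<^sup>2" using C by simp
    ultimately show ?thesis by (simp add: abs_le_iff)
  qed
  define a where "a n = 1 / real (Suc n)" for n
  have a0: "a \<longlonglongrightarrow> 0" unfolding a_def
    by (rule LIMSEQ_inverse_real_of_nat[unfolded inverse_eq_divide])
  have a: "0 < a n" "a n \<le> 1" for n by (auto simp: a_def)
  have adec: "a n \<le> a k" if "k \<le> n" for n k using that by (simp add: a_def frac_le)
  define W where "W n x = bump_mean w x (a n)" for n x
  have "uniformly_Cauchy_on UNIV W"
  proof (rule uniformly_Cauchy_onI)
    fix e :: real assume e: "e > 0"
    have "(\<lambda>n. C * (a n)\<^sup>2) \<longlonglongrightarrow> C * 0\<^sup>2" by (intro tendsto_intros a0)
    then have "eventually (\<lambda>n. C * (a n)\<^sup>2 < e) sequentially"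
      using e by (auto dest: order_tendstoD)
    then obtain K where K: "C * (a n)\<^sup>2 < e" if "n \<ge> K" for n
      by (auto simp: eventually_sequentially)
    have "dist (W k x) (W n x) < e" if "k \<ge> K" "n \<ge> K" for k n x
    proof (cases "k \<le> n")
      case True
      then show ?thesis using diff[OF a(1) adec[OF True], of x] K[OF that(1)]
        by (simp add: W_def dist_real_def)
    next
      case False
      then have "n \<le> k" by simp
      then show ?thesis using diff[OF a(1) adec[OF \<open>n \<le> k\<close>], of x] K[OF that(2)]
        by (simp add: W_def dist_real_def)
    qed
    then show "\<exists>K. \<forall>x\<in>UNIV. \<forall>k\<ge>K. \<forall>n\<ge>K. dist (W k x) (W n x) < e" by blast
  qed
  then obtain V where V: "uniform_limit UNIV W V sequentially"
    using Cauchy_uniformly_convergent uniformly_convergent_on_def by blast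
  have cV: "continuous_on UNIV V"
  proof (rule uniform_limit_theorem[OF _ V])
    show "\<forall>\<^sub>F n in sequentially. continuous_on UNIV (W n)"
      unfolding W_def by (intro always_eventually allI continuous_on_bump_mean[OF w wM] a)
  qed simp
  have Vlim: "(\<lambda>n. W n x) \<longlonglongrightarrow> V x" for x
    by (rule tendsto_uniform_limitI[OF V]) simp
  have VW: "\<bar>bump_mean w x b - V x\<bar> \<le> C * b\<^sup>2" if "0 < b" for x b
  proof (rule tendsto_upperbound)
    show "(\<lambda>n. \<bar>bump_mean w x b - W n x\<bar>) \<longlonglongrightarrow> \<bar>bump_mean w x b - V x\<bar>"
      by (intro tendsto_intros Vlim)
    have "eventually (\<lambda>n. a n < b) sequentially" using a0 that by (auto dest: order_tendstoD)
    then show "eventually (\<lambda>n. \<bar>bump_mean w x b - W n x\<bar> \<le> C * b\<^sup>2) sequentially"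
      by eventually_elim (simp add: W_def diff a less_imp_le)
  qed simp
  define v where "v x = V x / ?m" for x
  have Vv: "V x = ?m * v x" for x using m by (simp add: v_def)
  have cv: "continuous_on UNIV v" unfolding v_def using m by (intro continuous_intros cV) auto
  have [measurable]: "v \<in> borel_measurable borel" using cv by (rule borel_measurable_continuous_onI)
  have Wb: "0 \<le> bump_mean w x s" "bump_mean w x s \<le> ?m * M" for x s
    using bump_mean_le[OF w wM, of x s M] wb by (auto simp: bump_mean_def bump_nonneg)
  have vb: "0 \<le> v x" "v x \<le> M" for x
  proof -
    have "0 \<le> V x" "V x \<le> ?m * M"
      using Wb by (auto simp: W_def intro: tendsto_lowerbound[OF Vlim] tendsto_upperbound[OF Vlim])
    then show "0 \<le> v x" "v x \<le> M" using m by (simp_all add: v_def field_simps)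
  qed
  have upper: "AE x in lborel. u x \<le> z x"
    if u [measurable]: "u \<in> borel_measurable borel" and z [measurable]: "z \<in> borel_measurable borel"
      and ub: "\<And>x. 0 \<le> u x" "\<And>x. u x \<le> M" and zb: "\<And>x. 0 \<le> z x" "\<And>x. z x \<le> M"
      and le: "\<And>x s. 0 < s \<Longrightarrow> bump_mean u x s \<le> ?m * z x + C * s\<^sup>2" for u z :: "'a \<Rightarrow> real"
  proof -
    have "AE x in lborel. u x \<le> z x + C / ?m * (a n)\<^sup>2" for n
    proof -
      have "AE x in lborel. ennreal ?m * ennreal (u x) \<le> ennreal (?m * z x + C * (a n)\<^sup>2)"
      proof (rule ae_le_of_bump_mean_le[OF _ _ _ a(1)[of n]])
        fix k :: nat
        have "(LBNN x. ennreal (?m * z x + C * (a n)\<^sup>2) * indicator (ball 0 (real k)) x)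
          \<le> (LBNN x. ennreal (?m * M + C * (a n)\<^sup>2) * indicator (ball (0::'a) (real k)) x)"
          using m zb by (intro nn_integral_mono mult_right_mono ennreal_leI) auto
        also have "\<dots> < \<infinity>" using emeasure_lborel_ball_finite[of "0::'a" "real k"]
          by (simp add: nn_integral_cmult_indicator ennreal_mult_less_top)
        finally show "(LBNN x. ennreal (?m * z x + C * (a n)\<^sup>2) * indicator (ball 0 (real k)) x) < \<infinity>" .
      next
        fix x s assume s: "0 < s" "s < a n"
        have i: "integrable lborel (\<lambda>h. bump h * u (x + s *\<^sub>R h))"
          using ub by (intro integrable_bump_times(1)[OF u, of M]) (simp add: abs_le_iff order_trans[OF _ ub(1)])
        have "(LBNN h. ennreal (bump h) * ennreal (u (x + s *\<^sub>R h)))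
           = (LBNN h. ennreal (bump h * u (x + s *\<^sub>R h)))"
          using ub by (simp add: ennreal_mult bump_nonneg)
        also have "\<dots> = ennreal (bump_mean u x s)"
          unfolding bump_mean_def using ub by (intro nn_integral_eq_integral i) (simp add: bump_nonneg)
        also have "\<dots> \<le> ennreal (?m * z x + C * (a n)\<^sup>2)"
          using le[OF s(1), of x] mult_left_mono[OF power_mono[of s "a n" 2] C] s
          by (intro ennreal_leI) auto
        finally show "(LBNN h. ennreal (bump h) * ennreal (u (x + s *\<^sub>R h)))
          \<le> ennreal (?m * z x + C * (a n)\<^sup>2)" .
      qed measurable
      then show ?thesis
      proof eventually_elim
        case (elim x)
        have "ennreal (?m * u x) = ennreal ?m * ennreal (u x)"
          using m ub by (intro ennreal_mult) auto
        moreover have "0 \<le> ?m * z x + C * (a n)\<^sup>2" using m zb C by simp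
        ultimately have "?m * u x \<le> ?m * z x + C * (a n)\<^sup>2"
          using elim by (metis ennreal_le_iff)
        then show ?case using m by (simp add: field_simps)
      qed
    qed
    then have "AE x in lborel. \<forall>n. u x \<le> z x + C / ?m * (a n)\<^sup>2"
      unfolding AE_all_countable by blast
    then show ?thesis
    proof eventually_elim
      case (elim x)
      have "(\<lambda>n. z x + C / ?m * (a n)\<^sup>2) \<longlonglongrightarrow> z x + C / ?m * 0\<^sup>2" by (intro tendsto_intros a0)
      then show ?case using elim by (auto intro: tendsto_lowerbound)
    qed
  qed
  have "AE x in lborel. w x \<le> v x"
  proof (intro upper)
    fix x s assume "0 < (s::real)"
    then show "bump_mean w x s \<le> ?m * v x + C * s\<^sup>2"
      using VW[OF \<open>0 < s\<close>, of x] by (simp add: Vv abs_le_iff)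
  qed (auto simp: wb vb)
  moreover have "AE x in lborel. M - w x \<le> M - v x"
  proof (intro upper)
    fix x s assume "0 < (s::real)"
    have "bump_mean (\<lambda>x. M - w x) x s = ?m * M - bump_mean w x s"
      using integrable_bump_times(1)[OF w wM, of x s]
      by (simp add: bump_mean_def right_diff_distrib integrable_bump bump_mass_def)
    then show "bump_mean (\<lambda>x. M - w x) x s \<le> ?m * (M - v x) + C * s\<^sup>2"
      using VW[OF \<open>0 < s\<close>, of x] by (simp add: Vv algebra_simps abs_le_iff)
  qed (auto simp: wb vb)
  ultimately have "AE x in lborel. v x = w x" by eventually_elim simp
  with cv vb that show ?thesis by blast
qed

section \<open>Positivity and decay\<close>

lemma continuous_nonneg_integral_eq_0:
  fixes g :: "'a::euclidean_space \<Rightarrow> real"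
  assumes g: "continuous_on UNIV g" "\<And>x. 0 \<le> g x" "integrable lborel g" and 0: "(LBINT x. g x) = 0"
  shows "g x = 0"
proof (rule ccontr)
  assume "g x \<noteq> 0"
  have "AE x in lborel. g x = 0"
    using 0 g by (subst (asm) integral_nonneg_eq_0_iff_AE) auto
  moreover have o: "open {x. g x \<noteq> 0}"
    using g(1) by (intro open_Collect_neq continuous_on_const)
  ultimately have "{x. g x \<noteq> 0} \<in> null_sets lborel"
    by (subst AE_iff_null_sets) auto
  then have "negligible {x. g x \<noteq> 0}"
    by (simp add: negligible_iff_null_sets null_sets_completionI)
  with open_not_negligible[OF o] \<open>g x \<noteq> 0\<close> show False by auto
qed

text \<open>At a zero \<open>x\<^sub>0\<close> of \<open>v\<close> the mollifications \<open>W(s)\<close> of \<open>v\<close> satisfy \<open>W(s) \<le> (L s\<^sup>2/4) sup W\<close>. At radii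
\<open>r\<close> with \<open>L r\<^sup>2 = 1\<close> this forces \<open>W = 0\<close>, so \<open>v\<close> vanishes on a ball whose radius does not depend on
\<open>x\<^sub>0\<close>. The zero set is therefore open as well as closed.\<close>

theorem strong_maximum_principle:
  fixes v f :: "'a::euclidean_space \<Rightarrow> real"
  assumes I: "mean_value_identity v f" and v: "continuous_on UNIV v"
    and vb: "\<And>x. 0 \<le> v x" "\<And>x. v x \<le> M"
    and f: "f \<in> borel_measurable borel" and fb: "\<And>x. \<bar>f x\<bar> \<le> F"
    and lower: "\<And>x. - (L * v x) \<le> f x" and L: "L > 0"
    and ex: "v x1 > 0"
  shows "v x > 0"
proof -
  let ?m = "bump_mass TYPE('a)"
  have vm: "v \<in> borel_measurable borel" using v by (rule borel_measurable_continuous_onI)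
  have vM: "\<bar>v x\<bar> \<le> M" for x using vb[of x] by simp
  define r where "r = 1 / sqrt L"
  have r: "r > 0" "L * r\<^sup>2 = 1" using L by (auto simp: r_def power_divide)
  have ball0: "v y = 0" if v0: "v x0 = 0" and y: "y \<in> ball x0 r" for x0 y
  proof -
    define W where "W s = bump_mean v x0 s" for s
    have W0: "0 \<le> W s" and WM: "W s \<le> ?m * M" for s
      using bump_mean_le[OF vm vM, of x0 s M] vb by (auto simp: W_def bump_mean_def bump_nonneg)
    define S where "S = (SUP s\<in>{0<..r}. W s)"
    have bdd: "bdd_above (W ` {0<..r})" using WM by (auto intro!: bdd_aboveI[of _ "?m * M"])
    have WS: "W s \<le> S" if "0 < s" "s \<le> r" for s
      unfolding S_def by (rule cSUP_upper[OF _ bdd]) (use that in auto)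
    have S0: "S \<ge> 0" using WS[of r] W0[of r] r by linarith
    have c: "- (L / 2 * S) \<le> cutoff_mean f x0 s" if "0 < s" "s \<le> r" for s
    proof -
      have "- (L / 2) * W s = (LBINT h. - (L / 2) * (bump h * v (x0 + s *\<^sub>R h)))"
        by (simp add: W_def bump_mean_def)
      also have "\<dots> \<le> cutoff_mean f x0 s"
        unfolding cutoff_mean_def
      proof (rule integral_mono)
        fix h
        have "cutoff h * (L * v (x0 + s *\<^sub>R h)) \<le> (bump h / 2) * (L * v (x0 + s *\<^sub>R h))"
          using cutoff_le_bump[of h] vb L by (intro mult_right_mono) auto
        moreover have "cutoff h * - (L * v (x0 + s *\<^sub>R h)) \<le> cutoff h * f (x0 + s *\<^sub>R h)"
          using lower by (intro mult_left_mono cutoff_nonneg) auto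
        ultimately show "- (L / 2) * (bump h * v (x0 + s *\<^sub>R h)) \<le> cutoff h * f (x0 + s *\<^sub>R h)"
          by (simp add: algebra_simps)
      qed (use integrable_bump_times(1)[OF vm vM] integrable_bump_times(2)[OF f fb] in simp_all)
      finally have "- (L / 2) * W s \<le> cutoff_mean f x0 s" .
      moreover have "L / 2 * W s \<le> L / 2 * S" using WS[OF that] L by (intro mult_left_mono) auto
      ultimately show ?thesis by linarith
    qed
    have "W s \<le> S / 2" if s: "0 < s" "s \<le> r" for s
    proof -
      have "W s \<le> ?m * v x0 - (- (L / 2 * S)) * s\<^sup>2 / 2"
        unfolding W_def by (rule mean_value_le[OF I v vM s(1)]) (use c s in auto)
      also have "\<dots> = L * s\<^sup>2 * (S / 4)" using v0 by simp
      also have "\<dots> \<le> L * r\<^sup>2 * (S / 4)"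
        using s L S0 by (intro mult_right_mono mult_left_mono power_mono) auto
      also have "\<dots> \<le> S / 2" using r S0 by simp
      finally show ?thesis .
    qed
    then have "S \<le> S / 2" unfolding S_def using r by (intro cSUP_least) auto
    then have "W r = 0" using S0 WS[of r] W0[of r] r by simp
    define g where "g h = bump h * v (x0 + r *\<^sub>R h)" for h
    have "g h = 0" for h
    proof (rule continuous_nonneg_integral_eq_0[where g = g])
      show "continuous_on UNIV g" unfolding g_def[abs_def]
        by (intro continuous_intros continuous_on_bump continuous_on_compose2[OF v]) auto
      show "integrable lborel g" unfolding g_def[abs_def] by (rule integrable_bump_times[OF vm vM])
      show "(LBINT x. g x) = 0" using \<open>W r = 0\<close> by (simp add: W_def bump_mean_def g_def)
    qed (simp add: g_def bump_nonneg vb)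
    then have "g ((y - x0) /\<^sub>R r) = 0" .
    moreover have "bump ((y - x0) /\<^sub>R r) > 0"
    proof -
      have "norm ((y - x0) /\<^sub>R r) < 1"
        using y r by (simp add: dist_norm norm_minus_commute inverse_eq_divide pos_divide_less_eq)
      then have "((y - x0) /\<^sub>R r) \<bullet> ((y - x0) /\<^sub>R r) < 1" by (simp only: norm_lt_square) simp
      then show ?thesis by (simp add: bump_def flat_pos del: inner_scaleR_left inner_scaleR_right)
    qed
    ultimately show "v y = 0" using r by (simp add: g_def)
  qed
  have "open {x. v x = 0}"
    unfolding open_contains_ball using ball0 r(1) by blast
  moreover have "closed {x. v x = 0}" using v by (intro closed_Collect_eq continuous_on_const)
  ultimately have "{x. v x = 0} = {} \<or> {x. v x = 0} = UNIV"
    by (intro clopen[THEN iffD1] conjI)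
  moreover have "x1 \<notin> {x. v x = 0}" using ex by simp
  ultimately have "x \<notin> {x. v x = 0}" by auto
  then have "v x \<noteq> 0" by simp
  then show ?thesis using vb(1)[of x] by simp
qed

text \<open>Outside a ball \<open>v\<close> is subharmonic, so \<open>v(x)\<close> is at most an average of \<open>v\<close> over the unit ball around
\<open>x\<close>; that average is small because the tails of the integral of \<open>v\<^sup>q\<close> are.\<close>

theorem decay_of_integrable_subsolution:
  fixes v f :: "'a::euclidean_space \<Rightarrow> real"
  assumes I: "mean_value_identity v f" and v: "continuous_on UNIV v"
    and vb: "\<And>x. 0 \<le> v x" "\<And>x. v x \<le> M"
    and f: "f \<in> borel_measurable borel" and fb: "\<And>x. \<bar>f x\<bar> \<le> F"
    and neg: "\<And>x. norm x > R \<Longrightarrow> f x \<le> 0"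
    and q: "q \<ge> 1" "integrable lborel (\<lambda>x. v x powr q)" and e: "e > 0"
  obtains R' where "\<And>x. norm x \<ge> R' \<Longrightarrow> v x \<le> e"
proof -
  let ?t = "\<lambda>n y. indicator (- ball 0 (real n)) y * v y powr q"
  let ?m = "bump_mass TYPE('a)"
  have m: "?m > 0" by (rule bump_mass_pos)
  have vm [measurable]: "v \<in> borel_measurable borel" using v by (rule borel_measurable_continuous_onI)
  have vM: "\<bar>v x\<bar> \<le> M" for x using vb[of x] by simp
  obtain B where B: "B > 0" "\<And>z::'a. bump z \<le> B" using bump_bounded by blast
  define \<tau> where "\<tau> = e / 2"
  have \<tau>: "\<tau> > 0" using e by (simp add: \<tau>_def)
  define K where "K = B * \<tau> powr (1 - q)"
  have K: "K > 0" using B \<tau> by (simp add: K_def)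
  define T where "T n = (LBINT y. ?t n y)" for n
  have "T \<longlonglongrightarrow> (\<integral>y. 0 \<partial>(lborel :: 'a measure))"
    unfolding T_def
  proof (rule integral_dominated_convergence[OF _ _ q(2)])
    show "AE x in lborel. (\<lambda>n. ?t n x) \<longlonglongrightarrow> 0"
    proof (rule AE_I2)
      fix x :: 'a
      obtain k :: nat where k: "norm x < real k" using reals_Archimedean2 by blast
      have "eventually (\<lambda>n. ?t n x = 0) sequentially"
        using eventually_ge_at_top[of k] by eventually_elim (use k in \<open>auto simp: indicator_def\<close>)
      then show "(\<lambda>n. ?t n x) \<longlonglongrightarrow> 0"
        by (rule tendsto_eventually)
    qed
    show "AE x in lborel. norm (?t n x) \<le> v x powr q" for n
      by (auto simp: indicator_def)
    show "(\<lambda>x. ?t n x) \<in> borel_measurable lborel" for n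
      by (intro borel_measurable_times borel_measurable_indicator) auto
  qed simp
  then have "T \<longlonglongrightarrow> 0" by simp
  moreover have "?m * \<tau> / K > 0" using m \<tau> K by simp
  ultimately have "eventually (\<lambda>n. T n < ?m * \<tau> / K) sequentially" by (auto dest: order_tendstoD)
  then obtain n where n: "T n < ?m * \<tau> / K" by (auto simp: eventually_sequentially)
  have Tn: "integrable lborel (\<lambda>y. ?t n y)"
  proof (rule Bochner_Integration.integrable_bound[OF q(2)])
    show "(\<lambda>x. ?t n x) \<in> borel_measurable lborel"
      by (intro borel_measurable_times borel_measurable_indicator) auto
  qed (auto simp: indicator_def)
  have "v x \<le> e" if x: "norm x \<ge> max R (real n) + 2" for x
  proof -
    have "?m * v x - 0 * 1\<^sup>2 / 2 \<le> bump_mean v x 1"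
    proof (rule mean_value_ge[OF I v vM])
      fix s :: real assume s: "0 < s" "s \<le> 1"
      have "cutoff_mean f x s \<le> cutoff_mass TYPE('a) * 0"
      proof (rule cutoff_mean_le[OF f fb], rule neg)
        fix h :: 'a assume h: "norm h < 1"
        have "norm x \<le> norm (x + s *\<^sub>R h) + norm (s *\<^sub>R h)"
          using norm_triangle_ineq4[of "x + s *\<^sub>R h" "s *\<^sub>R h"] by simp
        moreover have "norm (s *\<^sub>R h) \<le> 1" using s h by (simp add: mult_le_one)
        ultimately show "R < norm (x + s *\<^sub>R h)" using x by linarith
      qed
      then show "cutoff_mean f x s \<le> 0" by simp
    qed simp
    then have "?m * v x \<le> bump_mean v x 1" by simp
    also have "\<dots> \<le> (LBINT h. bump h * \<tau> + K * (?t n (x + 1 *\<^sub>R h)))"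
      unfolding bump_mean_def
    proof (rule integral_mono[OF integrable_bump_times(1)[OF vm vM]])
      show "integrable lborel (\<lambda>h. bump h * \<tau> + K * (?t n (x + 1 *\<^sub>R h)))"
        by (intro Bochner_Integration.integrable_add integrable_mult_left integrable_mult_right integrable_bump
              lborel_integrable_affine[OF Tn]) auto
      fix h :: 'a
      show "bump h * v (x + 1 *\<^sub>R h) \<le> bump h * \<tau> + K * (?t n (x + 1 *\<^sub>R h))"
      proof (cases "norm h < 1")
        case False
        then show ?thesis using K by (simp add: bump_outside indicator_def)
      next
        case True
        define y where "y = x + 1 *\<^sub>R h"
        have "norm x \<le> norm y + norm h"
          using norm_triangle_ineq4[of y h] by (simp add: y_def)
        then have "y \<notin> ball 0 (real n)" using x True by simp
        moreover have "v y \<le> \<tau> + \<tau> powr (1 - q) * v y powr q"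
        proof (cases "v y \<le> \<tau>")
          case True
          then show ?thesis by (simp add: add_increasing2)
        next
          case False
          then have "v y / \<tau> \<le> (v y / \<tau>) powr q"
            using \<tau> q powr_mono[of 1 q "v y / \<tau>"] by simp
          then have "v y \<le> \<tau> * (v y / \<tau>) powr q" using \<tau> by (simp add: field_simps)
          also have "\<dots> = \<tau> powr (1 - q) * v y powr q"
            using \<tau> vb by (simp add: powr_divide powr_diff)
          finally show ?thesis using \<tau> by simp
        qed
        then have "bump h * v y \<le> bump h * (\<tau> + \<tau> powr (1 - q) * v y powr q)"
          by (intro mult_left_mono bump_nonneg)
        moreover have "bump h * (\<tau> powr (1 - q) * v y powr q) \<le> B * (\<tau> powr (1 - q) * v y powr q)"
          by (intro mult_right_mono B) auto
        ultimately show ?thesis unfolding y_def[symmetric] by (simp add: K_def algebra_simps)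
      qed
    qed
    also have "\<dots> = ?m * \<tau> + K * T n"
      using lborel_integrable_affine[OF Tn, of 1 x]
        lborel_integral_affine[of "\<lambda>y. ?t n y" 1 x] borel_measurable_integrable[OF Tn]
      by (simp add: integrable_bump bump_mass_def T_def)
    also have "\<dots> \<le> ?m * \<tau> + ?m * \<tau>"
      using n K by (simp add: field_simps)
    also have "\<dots> = ?m * e" by (simp add: \<tau>_def)
    finally show ?thesis using m by simp
  qed
  then show ?thesis using that by blast
qed

section \<open>Moments of the bump function\<close>

text \<open>The integral of \<open>F(x + t b)\<close> over all \<open>x\<close> does not depend on \<open>t\<close>; differentiate at \<open>t = 0\<close> under the integral.\<close>

lemma integral_directional_derivative_eq_0:
  fixes F :: "'a::euclidean_space \<Rightarrow> real"
  assumes F: "\<And>x. (F has_derivative F' x) (at x)" and c: "continuous_on UNIV (\<lambda>x. F' x b)"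
    and z: "\<And>x. norm x > R \<Longrightarrow> F x = 0"
  shows "(LBINT x. F' x b) = 0"
proof -
  have cF: "continuous_on UNIV F"
    using F by (intro continuous_at_imp_continuous_on) (auto dest: has_derivative_continuous)
  have [measurable]: "F \<in> borel_measurable borel" using cF by (rule borel_measurable_continuous_onI)
  have [measurable]: "(\<lambda>x. F' x b) \<in> borel_measurable borel" using c by (rule borel_measurable_continuous_onI)
  have iF: "integrable lborel F" by (rule compact_support_integrable[OF cF z])
  have line: "((\<lambda>t. F (x + t *\<^sub>R b)) has_real_derivative F' (x + t *\<^sub>R b) b) (at t)" for x t
  proof -
    have "((\<lambda>t. x + t *\<^sub>R b) has_derivative (\<lambda>t. t *\<^sub>R b)) (at t)"
      by (auto intro!: derivative_eq_intros)
    from has_derivative_compose[OF this F]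
    have "((\<lambda>t. F (x + t *\<^sub>R b)) has_derivative (\<lambda>u. F' (x + t *\<^sub>R b) (u *\<^sub>R b))) (at t)" .
    then show ?thesis
      by (simp add: has_field_derivative_def linear_cmul[OF has_derivative_linear[OF F]] mult_commute_abs)
  qed
  have z': "F' x b = 0" if "norm x > R" for x
  proof -
    have "(F has_derivative (\<lambda>_. 0)) (at x)"
    proof (rule has_derivative_transform_within_open[of "\<lambda>_. 0" _ _ _ "- cball 0 R"])
      show "0 = F y" if "y \<in> - cball 0 R" for y using z[of y] that by simp
    qed (use that in auto)
    then have "F' x = (\<lambda>_. 0)" using F has_derivative_unique by blast
    then show ?thesis by simp
  qed
  obtain K where K: "\<And>x. \<bar>F' x b\<bar> \<le> K"
  proof -
    have "compact ((\<lambda>x. F' x b) ` cball 0 R)"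
      by (intro compact_continuous_image continuous_on_subset[OF c]) auto
    then obtain K where "\<forall>x\<in>cball 0 R. \<bar>F' x b\<bar> \<le> K"
      by (force dest!: compact_imp_bounded simp: bounded_iff)
    then have "\<bar>F' x b\<bar> \<le> max K 0" for x
      using z'[of x] by (cases "norm x \<le> R") (auto simp: le_max_iff_disj)
    then show ?thesis using that by blast
  qed
  \<comment> \<open>The difference quotients have integral \<open>0\<close> and are dominated by the mean value theorem.\<close>
  define D where "D n x = real (Suc n) * (F (x + (1 / real (Suc n)) *\<^sub>R b) - F x)" for n x
  have D0: "(LBINT x. D n x) = 0" for n
  proof -
    have "integrable lborel (\<lambda>x. F ((1 / real (Suc n)) *\<^sub>R b + 1 *\<^sub>R x))"
      by (rule lborel_integrable_affine[OF iF]) simp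
    moreover have "(LBINT x. F ((1 / real (Suc n)) *\<^sub>R b + 1 *\<^sub>R x)) = (LBINT x. F x)"
      by (subst lborel_integral_affine[of F 1 "(1 / real (Suc n)) *\<^sub>R b"]) auto
    ultimately show ?thesis
      unfolding D_def using iF by (simp add: add.commute)
  qed
  have "(\<lambda>n. LBINT x. D n x) \<longlonglongrightarrow> (LBINT x. F' x b)"
  proof (rule integral_dominated_convergence)
    show "integrable lborel (\<lambda>x. indicator (cball 0 (R + norm b)) x * K)"
      by (rule integrable_mult_left, rule integrable_real_indicator[OF _ emeasure_lborel_cball_finite]) simp
    show "AE x in lborel. norm (D n x) \<le> indicator (cball 0 (R + norm b)) x * K" for n
    proof (rule AE_I2)
      fix x
      define t where "t = 1 / real (Suc n)"
      have t: "0 < t" "t \<le> 1" by (auto simp: t_def)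
      show "norm (D n x) \<le> indicator (cball 0 (R + norm b)) x * K"
      proof (cases "norm x \<le> R + norm b")
        case True
        obtain s where "F (x + t *\<^sub>R b) - F (x + 0 *\<^sub>R b) = (t - 0) * F' (x + s *\<^sub>R b) b"
          using MVT2[OF t(1), of "\<lambda>t. F (x + t *\<^sub>R b)" "\<lambda>s. F' (x + s *\<^sub>R b) b"] line by blast
        then have "D n x = F' (x + s *\<^sub>R b) b" unfolding D_def t_def by simp
        then show ?thesis using K True by simp
      next
        case False
        have "norm x \<le> norm (x + t *\<^sub>R b) + norm (t *\<^sub>R b)"
          using norm_triangle_ineq4[of "x + t *\<^sub>R b" "t *\<^sub>R b"] by simp
        moreover have "norm (t *\<^sub>R b) \<le> norm b" using t by (simp add: mult_left_le_one_le)
        ultimately have "norm (x + t *\<^sub>R b) > R" using False by linarith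
        moreover have "norm x > R" using False norm_ge_zero[of b] by linarith
        ultimately have "D n x = 0" using z by (simp add: D_def t_def)
        then show ?thesis using False by simp
      qed
    qed
    show "AE x in lborel. (\<lambda>n. D n x) \<longlonglongrightarrow> F' x b"
    proof (rule AE_I2)
      fix x
      have "((\<lambda>h. (F (x + (0 + h) *\<^sub>R b) - F (x + 0 *\<^sub>R b)) / h) \<longlongrightarrow> F' (x + 0 *\<^sub>R b) b) (at 0)"
        using line[of x 0] by (simp add: DERIV_def)
      moreover have "filterlim (\<lambda>n. 1 / real (Suc n)) (at 0) sequentially"
        unfolding filterlim_at
        using LIMSEQ_inverse_real_of_nat[unfolded inverse_eq_divide] by (auto simp del: of_nat_Suc)
      ultimately have "(\<lambda>n. (F (x + (0 + 1 / real (Suc n)) *\<^sub>R b) - F (x + 0 *\<^sub>R b)) / (1 / real (Suc n)))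
         \<longlonglongrightarrow> F' (x + 0 *\<^sub>R b) b"
        by (rule filterlim_compose)
      then show "(\<lambda>n. D n x) \<longlonglongrightarrow> F' x b" by (simp add: D_def mult.commute)
    qed
    show "D n \<in> borel_measurable lborel" for n unfolding D_def by measurable
  qed measurable
  then show ?thesis using D0 by (simp add: LIMSEQ_const_iff)
qed

lemma cutoff_has_derivative: "(cutoff has_derivative (\<lambda>h. - (bump z * (z \<bullet> h)))) (at z)"
  using flat_bump_has_derivative[of 0 1 0 z]
  by (simp add: cutoff_def[abs_def] bump_def mult_ac numeral_2_eq_2)

lemma integrable_bump_times_continuous:
  fixes g :: "'a::euclidean_space \<Rightarrow> real"
  assumes "continuous_on UNIV g"
  shows "integrable lborel (\<lambda>h. bump h * g h)"
  by (rule compact_support_integrable[of _ 1])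
     (auto intro!: continuous_intros continuous_on_bump assms simp: bump_outside)

text \<open>Integrate the derivative of \<open>(x \<bullet> b) \<zeta>(x)\<close> in direction \<open>b\<close>, using \<open>\<nabla>\<zeta>(x) = - \<eta>(x) x\<close>. The constant is the
one in front of \<open>f\<close> in the mean value formula, which is why both sides match in the contact lemma below.\<close>

lemma bump_second_moment:
  fixes b :: "'a::euclidean_space"
  shows "(LBINT h. bump h * (h \<bullet> b)\<^sup>2) = (b \<bullet> b) * cutoff_mass TYPE('a)"
proof -
  let ?F' = "\<lambda>x h. (x \<bullet> b) * - (bump x * (x \<bullet> h)) + (h \<bullet> b) * cutoff x"
  have "(LBINT x. ?F' x b) = 0"
  proof (rule integral_directional_derivative_eq_0[where F = "\<lambda>x. (x \<bullet> b) * cutoff x" and F' = ?F' and R = 1])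
    show "((\<lambda>x. (x \<bullet> b) * cutoff x) has_derivative ?F' x) (at x)" for x
      by (rule has_derivative_mult[OF _ cutoff_has_derivative]) (auto intro!: derivative_eq_intros)
    show "continuous_on UNIV (\<lambda>x. ?F' x b)"
      by (intro continuous_intros continuous_on_bump continuous_on_cutoff)
  qed (simp add: cutoff_outside)
  then have "(LBINT x. (b \<bullet> b) * cutoff x - bump x * (x \<bullet> b)\<^sup>2) = 0"
    by (simp add: power2_eq_square mult.left_commute)
  moreover have "integrable lborel (\<lambda>x. bump x * (x \<bullet> b)\<^sup>2)"
    by (intro integrable_bump_times_continuous continuous_intros)
  ultimately show ?thesis by (simp add: integrable_cutoff cutoff_mass_def)
qed

lemma bump_norm_moment:
  "(LBINT h. bump h * (norm (h::'a::euclidean_space))\<^sup>2) = real DIM('a) * cutoff_mass TYPE('a)"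
proof -
  have "bump h * (norm h)\<^sup>2 = (\<Sum>b\<in>Basis. bump h * (h \<bullet> b)\<^sup>2)" for h :: 'a
    unfolding sum_distrib_left[symmetric] power2_norm_eq_inner euclidean_inner[of h h]
    by (simp add: power2_eq_square)
  moreover have "integrable lborel (\<lambda>h. bump h * (h \<bullet> b)\<^sup>2)" for b :: 'a
    by (intro integrable_bump_times_continuous continuous_intros)
  ultimately show ?thesis by (simp add: bump_second_moment)
qed

lemma bump_first_moment:
  fixes b :: "'a::euclidean_space"
  shows "(LBINT h. bump h * (h \<bullet> b)) = 0"
proof -
  have "(LBINT h. bump h * (h \<bullet> b)) = - (LBINT h. bump h * (h \<bullet> b))"
    by (subst lborel_integral_affine[where c = "- 1" and t = 0]) (simp_all add: bump_minus)
  then show ?thesis by simp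
qed

section \<open>Contact with smooth functions\<close>

text \<open>A viscosity-type statement: a quadratic polynomial that touches \<open>v\<close> from above at \<open>x\<close> has there a
Laplacian of at least \<open>-f(x)\<close>. The mollification of the polynomial at scale \<open>r\<close> is known exactly from the
moments of \<open>\<eta>\<close>, and the mean value formula bounds that of \<open>v\<close> from below up to \<open>o(r\<^sup>2)\<close>.\<close>

theorem quadratic_contact_above:
  fixes v f :: "'a::euclidean_space \<Rightarrow> real"
  assumes I: "mean_value_identity v f" and v: "continuous_on UNIV v" and vM: "\<And>x. \<bar>v x\<bar> \<le> M"
    and f: "f \<in> borel_measurable borel" and fb: "\<And>x. \<bar>f x\<bar> \<le> F" and fc: "isCont f x"
    and r0: "r0 > 0"
    and contact: "\<And>h. norm h < r0 \<Longrightarrow>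
      v (x + h) \<le> v x + b \<bullet> h + A * (norm h)\<^sup>2 + G * (x \<bullet> h)\<^sup>2"
  shows "- f x \<le> 2 * (real DIM('a) * A + G * (x \<bullet> x))"
proof (rule field_le_epsilon)
  fix \<delta> :: real assume "\<delta> > 0"
  let ?m = "bump_mass TYPE('a)" and ?Z = "cutoff_mass TYPE('a)"
  have vm: "v \<in> borel_measurable borel" using v by (rule borel_measurable_continuous_onI)
  obtain r1 where r1: "r1 > 0" "\<And>y. dist y x < r1 \<Longrightarrow> dist (f y) (f x) < \<delta>"
    using fc \<open>\<delta> > 0\<close> unfolding continuous_at_eps_delta by (metis dist_commute)
  define r where "r = min r0 r1 / 2"
  have r: "0 < r" "r < r0" "r < r1" using r0 r1 by (auto simp: r_def)
  have nh: "norm (s *\<^sub>R h) < r'" if "0 < s" "s \<le> r" "norm h < 1" "r < r'" for s r' and h :: 'a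
  proof -
    have "norm (s *\<^sub>R h) \<le> s * 1" using that by (simp add: mult_left_mono)
    then show ?thesis using that by linarith
  qed
  have "?m * v x - ?Z * (f x + \<delta>) * r\<^sup>2 / 2 \<le> bump_mean v x r"
  proof (rule mean_value_ge[OF I v vM r(1)], rule cutoff_mean_le[OF f fb])
    fix s and h :: 'a assume "0 < s" "s \<le> r" "norm h < 1"
    then have "dist (x + s *\<^sub>R h) x < r1" using nh[of s h r1] r by (simp add: dist_norm)
    then show "f (x + s *\<^sub>R h) \<le> f x + \<delta>" using r1(2) by (fastforce simp: dist_real_def)
  qed
  also have "bump_mean v x r \<le> (LBINT h. v x * bump h + (r * (bump h * (h \<bullet> b))
        + (A * r\<^sup>2 * (bump h * (norm h)\<^sup>2) + G * r\<^sup>2 * (bump h * (h \<bullet> x)\<^sup>2))))"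
    unfolding bump_mean_def
  proof (rule integral_mono[OF integrable_bump_times(1)[OF vm vM]])
    show "integrable lborel (\<lambda>h. v x * bump h + (r * (bump h * (h \<bullet> b))
        + (A * r\<^sup>2 * (bump h * (norm h)\<^sup>2) + G * r\<^sup>2 * (bump h * (h \<bullet> x)\<^sup>2))))"
      by (intro Bochner_Integration.integrable_add integrable_mult_right integrable_bump
            integrable_bump_times_continuous continuous_intros)
    fix h :: 'a
    show "bump h * v (x + r *\<^sub>R h) \<le> v x * bump h + (r * (bump h * (h \<bullet> b))
        + (A * r\<^sup>2 * (bump h * (norm h)\<^sup>2) + G * r\<^sup>2 * (bump h * (h \<bullet> x)\<^sup>2)))"
    proof (cases "norm h < 1")
      case True
      have "v (x + r *\<^sub>R h) \<le> v x + b \<bullet> (r *\<^sub>R h) + A * (norm (r *\<^sub>R h))\<^sup>2 + G * (x \<bullet> (r *\<^sub>R h))\<^sup>2"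
        using True r by (intro contact nh[of r]) auto
      from mult_left_mono[OF this bump_nonneg[of h]] show ?thesis
        by (simp add: algebra_simps power_mult_distrib inner_commute)
    qed (simp add: bump_outside)
  qed
  also have "\<dots> = ?m * v x + ?Z * r\<^sup>2 * (real DIM('a) * A + G * (x \<bullet> x))"
  proof -
    have i: "integrable lborel (\<lambda>h. bump h * (h \<bullet> b))" "integrable lborel (\<lambda>h::'a. bump h * (norm h)\<^sup>2)"
       "integrable lborel (\<lambda>h. bump h * (h \<bullet> x)\<^sup>2)"
      by (intro integrable_bump_times_continuous continuous_intros)+
    show ?thesis
      by (simp add: i integrable_bump bump_first_moment bump_second_moment bump_norm_moment)
         (simp add: bump_mass_def algebra_simps)
  qed
  finally have "- (?Z * (f x + \<delta>) * r\<^sup>2) / 2 \<le> ?Z * r\<^sup>2 * (real DIM('a) * A + G * (x \<bullet> x))"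
    by linarith
  then have "- (?Z * (f x + \<delta>) * r\<^sup>2) \<le> 2 * (?Z * r\<^sup>2 * (real DIM('a) * A + G * (x \<bullet> x)))"
    by linarith
  then have "?Z * r\<^sup>2 * (- f x) \<le> ?Z * r\<^sup>2 * (2 * (real DIM('a) * A + G * (x \<bullet> x)) + \<delta>)"
    by (simp add: algebra_simps)
  moreover have "?Z * r\<^sup>2 > 0" using r cutoff_mass_pos[where 'a='a] by simp
  ultimately show "- f x \<le> 2 * (real DIM('a) * A + G * (x \<bullet> x)) + \<delta>"
    by (simp only: mult_le_cancel_left_pos)
qed

lemma second_order_upper_bound:
  fixes \<Phi> \<Phi>1 :: "real \<Rightarrow> real"
  assumes d: "d > 0" and \<Phi>: "\<And>t. \<bar>t - a\<bar> < d \<Longrightarrow> (\<Phi> has_real_derivative \<Phi>1 t) (at t)"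
    and \<Phi>1: "(\<Phi>1 has_real_derivative \<Phi>2) (at a)" and e: "e > 0"
  obtains d' where "d' > 0" "\<And>t. \<bar>t\<bar> < d' \<Longrightarrow> \<Phi> (a + t) \<le> \<Phi> a + \<Phi>1 a * t + (\<Phi>2 + e) / 2 * t\<^sup>2"
proof -
  have "((\<lambda>h. (\<Phi>1 (a + h) - \<Phi>1 a) / h) \<longlongrightarrow> \<Phi>2) (at 0)" using \<Phi>1 by (simp add: DERIV_def)
  then have "eventually (\<lambda>h. dist ((\<Phi>1 (a + h) - \<Phi>1 a) / h) \<Phi>2 < e) (at 0)"
    using e by (rule tendstoD)
  then obtain d1 where d1: "d1 > 0" "\<And>h. h \<noteq> 0 \<Longrightarrow> \<bar>h\<bar> < d1 \<Longrightarrow> \<bar>(\<Phi>1 (a + h) - \<Phi>1 a) / h - \<Phi>2\<bar> < e"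
    unfolding eventually_at by (auto simp: dist_real_def)
  define d' where "d' = min d d1"
  define G where "G t = \<Phi> (a + t) - \<Phi> a - \<Phi>1 a * t - (\<Phi>2 + e) / 2 * t\<^sup>2" for t
  define g where "g t = \<Phi>1 (a + t) - \<Phi>1 a - (\<Phi>2 + e) * t" for t
  have G: "(G has_real_derivative g t) (at t)" if "\<bar>t\<bar> < d'" for t
  proof -
    have "((\<lambda>t. \<Phi> (a + t)) has_real_derivative \<Phi>1 (a + t)) (at t)"
      using DERIV_shift[of \<Phi> "\<Phi>1 (a + t)" t a] \<Phi>[of "a + t"] that by (simp add: d'_def add.commute)
    then show ?thesis unfolding G_def[abs_def] g_def
      by (auto intro!: derivative_eq_intros simp: algebra_simps)
  qed
  have "G t \<le> 0" if t: "\<bar>t\<bar> < d'" for t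
  proof -
    consider "t = 0" | "t > 0" | "t < 0" by linarith
    then show ?thesis
    proof cases
      case 1 then show ?thesis by (simp add: G_def)
    next
      case 2
      obtain s where s: "0 < s" "s < t" "G t - G 0 = (t - 0) * g s"
        using MVT2[OF 2, of G g] G t by auto
      have "(\<Phi>1 (a + s) - \<Phi>1 a) / s < \<Phi>2 + e" using d1(2)[of s] s t by (auto simp: d'_def abs_less_iff)
      then have "g s \<le> 0" using s by (simp add: g_def field_simps)
      then have "G t - G 0 \<le> 0" using s 2 by (simp add: mult_nonneg_nonpos)
      then show ?thesis by (simp add: G_def)
    next
      case 3
      obtain s where s: "t < s" "s < 0" "G 0 - G t = (0 - t) * g s"
        using MVT2[OF 3, of G g] G t by auto
      have "(\<Phi>1 (a + s) - \<Phi>1 a) / s < \<Phi>2 + e" using d1(2)[of s] s t by (auto simp: d'_def abs_less_iff)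
      then have "g s \<ge> 0" using s by (simp add: g_def field_simps)
      then have "G 0 - G t \<ge> 0" using s 3 by (simp add: mult_nonpos_nonneg)
      then show ?thesis by (simp add: G_def)
    qed
  qed
  then have "\<Phi> (a + t) \<le> \<Phi> a + \<Phi>1 a * t + (\<Phi>2 + e) / 2 * t\<^sup>2" if "\<bar>t\<bar> < d'" for t
    using that unfolding G_def by force
  moreover have "d' > 0" using d d1 by (simp add: d'_def)
  ultimately show ?thesis using that by blast
qed

text \<open>A radial function that touches from above is replaced by its second order Taylor polynomial, with
an arbitrarily small error in the quadratic terms. The right-hand side is the Laplacian of \<open>y \<mapsto> \<Phi>(|y|\<^sup>2)\<close> at
\<open>x\<close>.\<close>

theorem radial_contact_above:
  fixes v f :: "'a::euclidean_space \<Rightarrow> real"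
  assumes I: "mean_value_identity v f" and v: "continuous_on UNIV v" and vM: "\<And>x. \<bar>v x\<bar> \<le> M"
    and f: "f \<in> borel_measurable borel" and fb: "\<And>x. \<bar>f x\<bar> \<le> F" and fc: "isCont f x"
    and d: "d > 0" and \<Phi>: "\<And>t. \<bar>t - x \<bullet> x\<bar> < d \<Longrightarrow> (\<Phi> has_real_derivative \<Phi>1 t) (at t)"
    and \<Phi>1: "(\<Phi>1 has_real_derivative \<Phi>2) (at (x \<bullet> x))"
    and r0: "r0 > 0"
    and contact: "\<And>y. dist y x < r0 \<Longrightarrow> v y - \<Phi> (y \<bullet> y) \<le> v x - \<Phi> (x \<bullet> x)"
  shows "- f x \<le> 2 * real DIM('a) * \<Phi>1 (x \<bullet> x) + 4 * \<Phi>2 * (x \<bullet> x)"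
proof (rule field_le_epsilon)
  fix \<epsilon> :: real assume \<epsilon>: "\<epsilon> > 0"
  define a where "a = x \<bullet> x"
  define e where "e = \<epsilon> / (2 * real DIM('a) + 4 * a)"
  have a0: "a \<ge> 0" by (simp add: a_def)
  have dim: "real DIM('a) > 0" using DIM_positive[where 'a='a] by simp
  have e: "e > 0" using \<epsilon> a0 dim by (simp add: e_def add_pos_nonneg)
  obtain d' where d': "d' > 0" "\<And>t. \<bar>t\<bar> < d' \<Longrightarrow> \<Phi> (a + t) \<le> \<Phi> a + \<Phi>1 a * t + (\<Phi>2 + e) / 2 * t\<^sup>2"
    using second_order_upper_bound[OF d \<Phi> \<Phi>1 e] unfolding a_def by blast
  define K where "K = \<bar>\<Phi>2 + e\<bar> / 2"
  have "((\<lambda>s. 2 * norm x * s + s\<^sup>2) \<longlongrightarrow> 2 * norm x * 0 + 0\<^sup>2) (at_right 0)"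
    by (intro tendsto_intros)
  then have "eventually (\<lambda>s. 2 * norm x * s + s\<^sup>2 < d') (at_right 0)"
    using d' by (auto dest: order_tendstoD)
  moreover have "((\<lambda>s. K * (4 * norm x * s + s\<^sup>2)) \<longlongrightarrow> K * (4 * norm x * 0 + 0\<^sup>2)) (at_right 0)"
    by (intro tendsto_intros)
  then have "eventually (\<lambda>s. K * (4 * norm x * s + s\<^sup>2) < e) (at_right 0)"
    using e by (auto dest: order_tendstoD)
  ultimately have "eventually (\<lambda>s. 2 * norm x * s + s\<^sup>2 < d' \<and> K * (4 * norm x * s + s\<^sup>2) < e) (at_right 0)"
    by (rule eventually_conj)
  then obtain \<rho> where \<rho>: "\<rho> > 0" "\<And>s. 0 < s \<Longrightarrow> s < \<rho> \<Longrightarrow> 2 * norm x * s + s\<^sup>2 < d' \<and> K * (4 * norm x * s + s\<^sup>2) < e"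
    by (auto simp: eventually_at_right_field)
  have "- f x \<le> 2 * (real DIM('a) * (\<Phi>1 a + e) + 2 * (\<Phi>2 + e) * (x \<bullet> x))"
  proof (rule quadratic_contact_above[OF I v vM f fb fc])
    show "min \<rho> r0 > 0" using \<rho> r0 by simp
    fix h :: 'a assume h: "norm h < min \<rho> r0"
    define t where "t = 2 * (x \<bullet> h) + (norm h)\<^sup>2"
    have yt: "(x + h) \<bullet> (x + h) = a + t"
      by (simp add: t_def a_def inner_add inner_commute power2_norm_eq_inner)
    have "v (x + h) \<le> v x + \<Phi> (a + t) - \<Phi> a"
      using contact[of "x + h"] h yt by (simp add: dist_norm a_def)
    also have "\<dots> \<le> v x + ((2 * \<Phi>1 a) *\<^sub>R x) \<bullet> h + (\<Phi>1 a + e) * (norm h)\<^sup>2 + 2 * (\<Phi>2 + e) * (x \<bullet> h)\<^sup>2"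
    proof (cases "h = 0")
      case True then show ?thesis by (simp add: t_def)
    next
      case False
      define s where "s = norm h"
      have s: "0 < s" "s < \<rho>" using False h by (auto simp: s_def)
      have xh: "\<bar>x \<bullet> h\<bar> \<le> norm x * s" unfolding s_def by (rule Cauchy_Schwarz_ineq2)
      have "\<bar>t\<bar> \<le> 2 * (norm x * s) + s\<^sup>2"
        unfolding t_def s_def[symmetric] using xh by (intro order_trans[OF abs_triangle_ineq]) simp
      then have "\<Phi> (a + t) \<le> \<Phi> a + \<Phi>1 a * t + (\<Phi>2 + e) / 2 * t\<^sup>2"
        using \<rho>(2)[OF s] by (intro d') (simp add: mult.assoc)
      moreover have "(\<Phi>2 + e) / 2 * t\<^sup>2 = 2 * (\<Phi>2 + e) * (x \<bullet> h)\<^sup>2 + (\<Phi>2 + e) / 2 * ((4 * (x \<bullet> h) + s\<^sup>2) * s\<^sup>2)"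
        by (simp add: t_def s_def power2_eq_square algebra_simps)
      moreover have "(\<Phi>2 + e) / 2 * ((4 * (x \<bullet> h) + s\<^sup>2) * s\<^sup>2) \<le> e * s\<^sup>2"
      proof -
        have "(\<Phi>2 + e) / 2 * (4 * (x \<bullet> h) + s\<^sup>2) \<le> \<bar>(\<Phi>2 + e) / 2 * (4 * (x \<bullet> h) + s\<^sup>2)\<bar>" by simp
        also have "\<dots> = K * \<bar>4 * (x \<bullet> h) + s\<^sup>2\<bar>" by (simp add: K_def abs_mult)
        also have "\<dots> \<le> K * (4 * norm x * s + s\<^sup>2)"
          using xh by (intro mult_left_mono order_trans[OF abs_triangle_ineq]) (auto simp: K_def)
        also have "\<dots> \<le> e" using \<rho>(2)[OF s] by simp
        finally have "(\<Phi>2 + e) / 2 * (4 * (x \<bullet> h) + s\<^sup>2) * s\<^sup>2 \<le> e * s\<^sup>2"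
          by (rule mult_right_mono) simp
        then show ?thesis by (simp only: mult.assoc)
      qed
      moreover have "\<Phi>1 a * t = ((2 * \<Phi>1 a) *\<^sub>R x) \<bullet> h + \<Phi>1 a * s\<^sup>2"
        by (simp add: t_def s_def algebra_simps)
      ultimately have "\<Phi> (a + t) \<le> \<Phi> a + (((2 * \<Phi>1 a) *\<^sub>R x) \<bullet> h + \<Phi>1 a * s\<^sup>2) + (2 * (\<Phi>2 + e) * (x \<bullet> h)\<^sup>2 + e * s\<^sup>2)"
        by linarith
      then show ?thesis unfolding s_def[symmetric] by (simp add: algebra_simps)
    qed
    finally show "v (x + h) \<le> v x + ((2 * \<Phi>1 a) *\<^sub>R x) \<bullet> h + (\<Phi>1 a + e) * (norm h)\<^sup>2 + 2 * (\<Phi>2 + e) * (x \<bullet> h)\<^sup>2"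
      by simp
  qed
  also have "\<dots> = 2 * real DIM('a) * \<Phi>1 a + 4 * \<Phi>2 * a + e * (2 * real DIM('a) + 4 * a)"
    by (simp add: a_def algebra_simps)
  also have "e * (2 * real DIM('a) + 4 * a) = \<epsilon>"
  proof -
    have "2 * real DIM('a) + 4 * a \<noteq> 0" using a0 dim by linarith
    then show ?thesis by (simp add: e_def)
  qed
  finally show "- f x \<le> 2 * real DIM('a) * \<Phi>1 (x \<bullet> x) + 4 * \<Phi>2 * (x \<bullet> x) + \<epsilon>" by (simp add: a_def)
qed

section \<open>Comparison with radial barriers\<close>

text \<open>The bound at infinity confines the maximum to a compact shell, and the sign on the sphere keeps it
off the inner boundary.\<close>

lemma exterior_maximum:
  fixes z :: "'a::euclidean_space \<Rightarrow> real"
  assumes c: "continuous_on {x. R \<le> norm x} z" and b: "\<And>x. norm x = R \<Longrightarrow> z x \<le> 0"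
    and x1: "R \<le> norm x1" "z x1 > 0"
    and lim: "\<And>e. e > 0 \<Longrightarrow> \<exists>R'. \<forall>x. norm x \<ge> R' \<longrightarrow> z x \<le> e"
  obtains x where "R < norm x" "z x > 0" "\<And>y. R \<le> norm y \<Longrightarrow> z y \<le> z x"
proof -
  obtain R' where R': "\<And>x. norm x \<ge> R' \<Longrightarrow> z x \<le> z x1" using lim[OF x1(2)] by blast
  define K where "K = cball (0::'a) (max R' (norm x1)) \<inter> {x. R \<le> norm x}"
  have "closed {x::'a. R \<le> norm x}" by (intro closed_Collect_le continuous_intros)
  then have "compact K" unfolding K_def by (intro compact_Int_closed compact_cball)
  moreover have "x1 \<in> K" using x1 by (simp add: K_def)
  moreover have "continuous_on K z" by (rule continuous_on_subset[OF c]) (auto simp: K_def)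
  ultimately obtain x where x: "x \<in> K" "\<And>y. y \<in> K \<Longrightarrow> z y \<le> z x"
    using continuous_attains_sup[of K z] by blast
  have max: "z y \<le> z x" if "R \<le> norm y" for y
  proof (cases "y \<in> K")
    case False
    then have "norm y \<ge> R'" using that by (auto simp: K_def)
    then have "z y \<le> z x1" by (rule R')
    also have "\<dots> \<le> z x" using x \<open>x1 \<in> K\<close> by blast
    finally show ?thesis .
  qed (use x in blast)
  have zx: "z x > 0" using x(2)[OF \<open>x1 \<in> K\<close>] x1 by simp
  then have "norm x \<noteq> R" using b[of x] by auto
  then have "R < norm x" using x(1) by (simp add: K_def)
  with zx max that show ?thesis by blast
qed

text \<open>The function \<open>U(x) = \<Phi>(|x|\<^sup>2)\<close> satisfies \<open>k\<^sub>1 U\<^sup>\<gamma> \<le> \<Delta>U \<le> k\<^sub>2 U\<^sup>\<gamma>\<close>, so a large multiple of it is a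
supersolution and a small one a subsolution of \<open>\<Delta>v = v\<^sup>\<gamma>\<close>. If \<open>v\<close> exceeded a large multiple \<open>cU\<close> somewhere,
\<open>v - cU\<close> would attain a positive maximum, because it is nonpositive on the sphere and decays; there \<open>cU\<close>
touches \<open>v\<close> from above up to a constant, whence \<open>v\<^sup>\<gamma> \<le> \<Delta>(cU) \<le> (cU)\<^sup>\<gamma> < v\<^sup>\<gamma>\<close>. The lower bound is symmetric.
The contradiction is strict because the nonlinearity is strictly increasing.\<close>

theorem two_sided_barrier_bound:
  fixes v f :: "'a::euclidean_space \<Rightarrow> real" and \<Phi> \<Phi>1 \<Phi>2 :: "real \<Rightarrow> real"
  assumes I: "mean_value_identity v f" and v: "continuous_on UNIV v"
    and v0: "\<And>x. 0 < v x" and vM: "\<And>x. v x \<le> M"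
    and f: "f \<in> borel_measurable borel" and fb: "\<And>x. \<bar>f x\<bar> \<le> F"
    and feq: "\<And>x. norm x > R \<Longrightarrow> f x = - (v x powr \<gamma>)" and \<gamma>: "\<gamma> > 1" and R: "R > 0"
    and decay: "\<And>e. e > 0 \<Longrightarrow> \<exists>R'. \<forall>x. norm x \<ge> R' \<longrightarrow> v x \<le> e"
    and \<rho>: "\<rho> < R\<^sup>2"
    and \<Phi>0: "\<And>t. t > \<rho> \<Longrightarrow> \<Phi> t > 0"
    and d\<Phi>: "\<And>t. t > \<rho> \<Longrightarrow> (\<Phi> has_real_derivative \<Phi>1 t) (at t)"
    and d\<Phi>1: "\<And>t. t > \<rho> \<Longrightarrow> (\<Phi>1 has_real_derivative \<Phi>2 t) (at t)"
    and \<Phi>lim: "(\<Phi> \<longlongrightarrow> 0) at_top"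
    and k1: "k1 > 0" "\<And>t. t \<ge> R\<^sup>2 \<Longrightarrow> k1 * \<Phi> t powr \<gamma> \<le> 2 * real DIM('a) * \<Phi>1 t + 4 * t * \<Phi>2 t"
    and k2: "k2 > 0" "\<And>t. t \<ge> R\<^sup>2 \<Longrightarrow> 2 * real DIM('a) * \<Phi>1 t + 4 * t * \<Phi>2 t \<le> k2 * \<Phi> t powr \<gamma>"
  obtains C where "C > 1" "\<And>x. norm x \<ge> R \<Longrightarrow> inverse C * \<Phi> (x \<bullet> x) \<le> v x"
     "\<And>x. norm x \<ge> R \<Longrightarrow> v x \<le> C * \<Phi> (x \<bullet> x)"
proof -
  have vMa: "\<bar>v x\<bar> \<le> M" for x using v0[of x] vM[of x] by simp
  have sq: "x \<bullet> x \<ge> R\<^sup>2" if "norm x \<ge> R" for x :: 'a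
    using that R by (simp add: power_mono flip: power2_norm_eq_inner)
  then have sq\<rho>: "x \<bullet> x > \<rho>" if "norm x \<ge> R" for x :: 'a using that \<rho> by fastforce
  have c\<Phi>: "continuous_on {x::'a. R \<le> norm x} (\<lambda>x. \<Phi> (x \<bullet> x))"
  proof (rule continuous_on_compose2[of "{\<rho><..}" \<Phi>])
    show "continuous_on {\<rho><..} \<Phi>"
      using d\<Phi> by (auto intro!: continuous_at_imp_continuous_on DERIV_isCont)
    show "continuous_on {x::'a. R \<le> norm x} (\<lambda>x. x \<bullet> x)" by (intro continuous_intros)
    show "(\<lambda>x::'a. x \<bullet> x) ` {x. R \<le> norm x} \<subseteq> {\<rho><..}" using sq\<rho> by auto
  qed
  have fcont: "isCont f x" if x: "norm x > R" for x
  proof -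
    have "isCont (\<lambda>y. - (v y powr \<gamma>)) x"
      using v v0 by (intro continuous_intros) (auto simp: continuous_on_eq_continuous_at less_imp_neq[symmetric])
    moreover have "open {y::'a. norm y > R}" by (intro open_Collect_less continuous_intros)
    then have "eventually (\<lambda>y. norm y > R) (nhds x)"
      using x eventually_nhds_in_open[of "{y. norm y > R}" x] by simp
    then have "eventually (\<lambda>y. f y = - (v y powr \<gamma>)) (nhds x)"
      by eventually_elim (rule feq)
    ultimately show ?thesis by (simp add: isCont_cong)
  qed
  have near: "norm y \<ge> R" if "R < norm x" "dist y x < norm x - R" for x y :: 'a
    using that norm_triangle_ineq2[of x "x - y"] by (simp add: dist_norm norm_minus_commute)
  \<comment> \<open>The first entry makes \<open>c U\<close> a supersolution, the second puts it above \<open>v\<close> on the sphere.\<close>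
  define c where "c = max (k2 powr (1 / (\<gamma> - 1))) (M / \<Phi> (R\<^sup>2)) + 1"
  have kp: "(k powr (1 / (\<gamma> - 1))) powr (\<gamma> - 1) = k" if "k > 0" for k
    using that \<gamma> by (simp add: powr_powr)
  have c1: "c \<ge> 1" using powr_ge_zero[of k2 "1 / (\<gamma> - 1)"] unfolding c_def by linarith
  have upper: "v x1 \<le> c * \<Phi> (x1 \<bullet> x1)" if x1: "norm x1 \<ge> R" for x1
  proof (rule ccontr)
    assume neg: "\<not> ?thesis"
    obtain x where x: "R < norm x" "v x - c * \<Phi> (x \<bullet> x) > 0"
      and max: "\<And>y. R \<le> norm y \<Longrightarrow> v y - c * \<Phi> (y \<bullet> y) \<le> v x - c * \<Phi> (x \<bullet> x)"
    proof (rule exterior_maximum[of R "\<lambda>x. v x - c * \<Phi> (x \<bullet> x)" x1])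
      show "continuous_on {x. R \<le> norm x} (\<lambda>x. v x - c * \<Phi> (x \<bullet> x))"
        by (intro continuous_intros c\<Phi> continuous_on_subset[OF v]) auto
      fix x :: 'a assume "norm x = R"
      then have xx: "x \<bullet> x = R\<^sup>2" by (simp add: power2_norm_eq_inner[symmetric])
      have "M / \<Phi> (R\<^sup>2) \<le> c" by (simp add: c_def)
      then have "M \<le> c * \<Phi> (R\<^sup>2)" using \<Phi>0[OF \<rho>] by (simp add: field_simps)
      then show "v x - c * \<Phi> (x \<bullet> x) \<le> 0" using vM[of x] by (simp add: xx)
    next
      fix e :: real assume "e > 0"
      then obtain R' where R': "\<And>x. norm x \<ge> R' \<Longrightarrow> v x \<le> e" using decay by blast
      have "v x - c * \<Phi> (x \<bullet> x) \<le> e" if "norm x \<ge> max R R'" for x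
      proof -
        have "c * \<Phi> (x \<bullet> x) \<ge> 0" using c1 \<Phi>0[OF sq\<rho>, of x] that by simp
        then show ?thesis using R'[of x] that by simp
      qed
      then show "\<exists>R'. \<forall>x. norm x \<ge> R' \<longrightarrow> v x - c * \<Phi> (x \<bullet> x) \<le> e" by blast
    qed (use x1 neg in auto)
    let ?a = "x \<bullet> x"
    have a: "?a \<ge> R\<^sup>2" "?a > \<rho>" using sq[of x] sq\<rho>[of x] x by auto
    have "- f x \<le> 2 * real DIM('a) * (c * \<Phi>1 ?a) + 4 * (c * \<Phi>2 ?a) * ?a"
    proof (rule radial_contact_above[OF I v vMa f fb fcont[OF x(1)]])
      show "?a - \<rho> > 0" using a by simp
      show "((\<lambda>t. c * \<Phi> t) has_real_derivative c * \<Phi>1 t) (at t)" if "\<bar>t - ?a\<bar> < ?a - \<rho>" for t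
        using that by (intro DERIV_cmult d\<Phi>) auto
      show "((\<lambda>t. c * \<Phi>1 t) has_real_derivative c * \<Phi>2 ?a) (at ?a)"
        using a by (intro DERIV_cmult d\<Phi>1) auto
      show "norm x - R > 0" using x by simp
      show "v y - c * \<Phi> (y \<bullet> y) \<le> v x - c * \<Phi> ?a" if "dist y x < norm x - R" for y
        using near[OF x(1) that] by (rule max)
    qed
    also have "\<dots> = c * (2 * real DIM('a) * \<Phi>1 ?a + 4 * ?a * \<Phi>2 ?a)" by (simp add: algebra_simps)
    also have "\<dots> \<le> c * (k2 * \<Phi> ?a powr \<gamma>)" using c1 a by (intro mult_left_mono k2) auto
    also have "\<dots> \<le> c * (c powr (\<gamma> - 1) * \<Phi> ?a powr \<gamma>)"
    proof -
      have "k2 = (k2 powr (1 / (\<gamma> - 1))) powr (\<gamma> - 1)" using kp[OF k2(1)] by simp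
      also have "\<dots> \<le> c powr (\<gamma> - 1)" using \<gamma> by (intro powr_mono2) (auto simp: c_def)
      finally show ?thesis using c1 by (intro mult_left_mono mult_right_mono) auto
    qed
    also have "\<dots> = (c * \<Phi> ?a) powr \<gamma>"
      using c1 \<Phi>0[OF a(2)] by (simp add: powr_mult powr_diff)
    also have "\<dots> < v x powr \<gamma>"
      using x \<gamma> c1 \<Phi>0[OF a(2)] by (intro powr_less_mono2) auto
    finally show False using feq[OF x(1)] by simp
  qed
  obtain \<mu> where \<mu>: "\<mu> > 0" "\<And>x. norm x = R \<Longrightarrow> \<mu> \<le> v x"
  proof -
    have "sphere (0::'a) R \<noteq> {}" using R by simp
    moreover have "continuous_on (sphere 0 R) v" by (rule continuous_on_subset[OF v]) simp
    ultimately have "\<exists>x\<in>sphere 0 R. \<forall>y\<in>sphere 0 R. v x \<le> v y"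
      by (intro continuous_attains_inf compact_sphere)
    then obtain x where "x \<in> sphere 0 R" and x: "\<forall>y\<in>sphere 0 R. v x \<le> v y" ..
    from x show ?thesis by (intro that[of "v x"] v0) simp
  qed
  \<comment> \<open>The first entry makes \<open>l U\<close> a subsolution, the second puts it below \<open>v\<close> on the sphere.\<close>
  define l where "l = min (k1 powr (1 / (\<gamma> - 1))) (\<mu> / \<Phi> (R\<^sup>2))"
  have l0: "l > 0" using k1 \<mu> \<Phi>0[OF \<rho>] by (simp add: l_def)
  have lower: "l * \<Phi> (x1 \<bullet> x1) \<le> v x1" if x1: "norm x1 \<ge> R" for x1
  proof (rule ccontr)
    assume neg: "\<not> ?thesis"
    obtain x where x: "R < norm x" "l * \<Phi> (x \<bullet> x) - v x > 0"
      and max: "\<And>y. R \<le> norm y \<Longrightarrow> l * \<Phi> (y \<bullet> y) - v y \<le> l * \<Phi> (x \<bullet> x) - v x"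
    proof (rule exterior_maximum[of R "\<lambda>x. l * \<Phi> (x \<bullet> x) - v x" x1])
      show "continuous_on {x. R \<le> norm x} (\<lambda>x. l * \<Phi> (x \<bullet> x) - v x)"
        by (intro continuous_intros c\<Phi> continuous_on_subset[OF v]) auto
      fix x :: 'a assume nx: "norm x = R"
      then have xx: "x \<bullet> x = R\<^sup>2" by (simp add: power2_norm_eq_inner[symmetric])
      have "l \<le> \<mu> / \<Phi> (R\<^sup>2)" by (simp add: l_def)
      then have "l * \<Phi> (R\<^sup>2) \<le> \<mu>" using \<Phi>0[OF \<rho>] by (simp add: field_simps)
      then show "l * \<Phi> (x \<bullet> x) - v x \<le> 0" using \<mu>(2)[OF nx] by (simp add: xx)
    next
      fix e :: real assume "e > 0"
      then have "eventually (\<lambda>t. \<Phi> t < e / l) at_top"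
        using l0 by (intro order_tendstoD(2)[OF \<Phi>lim]) simp
      then obtain T where T: "\<And>t. t \<ge> T \<Longrightarrow> \<Phi> t < e / l" by (auto simp: eventually_at_top_linorder)
      have "l * \<Phi> (x \<bullet> x) - v x \<le> e" if nx: "norm x \<ge> max 1 T" for x
      proof -
        have "T \<le> norm x * 1" using nx by simp
        also have "\<dots> \<le> norm x * norm x" using nx by (intro mult_left_mono) auto
        finally have "\<Phi> (x \<bullet> x) < e / l"
          by (intro T) (simp add: power2_norm_eq_inner[symmetric] power2_eq_square)
        then show ?thesis using l0 v0[of x] by (simp add: field_simps)
      qed
      then show "\<exists>R'. \<forall>x. norm x \<ge> R' \<longrightarrow> l * \<Phi> (x \<bullet> x) - v x \<le> e" by blast
    qed (use x1 neg in auto)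
    let ?a = "x \<bullet> x"
    have a: "?a \<ge> R\<^sup>2" "?a > \<rho>" using sq[of x] sq\<rho>[of x] x by auto
    have "- (- f x) \<le> 2 * real DIM('a) * (- l * \<Phi>1 ?a) + 4 * (- l * \<Phi>2 ?a) * ?a"
    proof (rule radial_contact_above[OF mean_value_identity_minus[OF I]])
      show "continuous_on UNIV (\<lambda>x. - v x)" using v by (intro continuous_intros)
      show "(\<lambda>x. - f x) \<in> borel_measurable borel" using f by simp
      show "isCont (\<lambda>x. - f x) x" using fcont[OF x(1)] by (intro continuous_intros)
      show "?a - \<rho> > 0" using a by simp
      show "((\<lambda>t. - l * \<Phi> t) has_real_derivative - l * \<Phi>1 t) (at t)" if "\<bar>t - ?a\<bar> < ?a - \<rho>" for t
        using that by (intro DERIV_cmult d\<Phi>) auto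
      show "((\<lambda>t. - l * \<Phi>1 t) has_real_derivative - l * \<Phi>2 ?a) (at ?a)"
        using a by (intro DERIV_cmult d\<Phi>1) auto
      show "norm x - R > 0" using x by simp
      show "- v y - - l * \<Phi> (y \<bullet> y) \<le> - v x - - l * \<Phi> ?a" if "dist y x < norm x - R" for y
        using max[OF near[OF x(1) that]] by simp
    qed (use vMa fb in simp_all)
    then have le: "l * (2 * real DIM('a) * \<Phi>1 ?a + 4 * ?a * \<Phi>2 ?a) \<le> v x powr \<gamma>"
      using feq[OF x(1)] by (simp add: algebra_simps)
    have "v x powr \<gamma> < (l * \<Phi> ?a) powr \<gamma>"
      using x \<gamma> v0[of x] by (intro powr_less_mono2) auto
    also have "\<dots> = l * (l powr (\<gamma> - 1) * \<Phi> ?a powr \<gamma>)"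
      using l0 \<Phi>0[OF a(2)] by (simp add: powr_mult powr_diff)
    also have "\<dots> \<le> l * (k1 * \<Phi> ?a powr \<gamma>)"
    proof -
      have "l powr (\<gamma> - 1) \<le> (k1 powr (1 / (\<gamma> - 1))) powr (\<gamma> - 1)"
        using \<gamma> l0 by (intro powr_mono2) (auto simp: l_def)
      also have "\<dots> = k1" by (rule kp[OF k1(1)])
      finally show ?thesis using l0 by (intro mult_left_mono mult_right_mono) auto
    qed
    also have "\<dots> \<le> l * (2 * real DIM('a) * \<Phi>1 ?a + 4 * ?a * \<Phi>2 ?a)"
      using l0 a by (intro mult_left_mono k1) auto
    finally show False using le by simp
  qed
  define C where "C = max c (1 / l) + 1"
  have C: "C > 1" "c \<le> C" "1 / l \<le> C"
    using c1 max.cobounded1[of c "1 / l"] max.cobounded2[of "1 / l" c] unfolding C_def by linarith+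
  have "inverse C \<le> l" using C(1,3) l0 by (simp add: field_simps)
  show ?thesis
  proof (rule that[OF C(1)])
    fix x :: 'a assume x: "norm x \<ge> R"
    have \<Phi>x: "\<Phi> (x \<bullet> x) > 0" by (rule \<Phi>0[OF sq\<rho>[OF x]])
    show "inverse C * \<Phi> (x \<bullet> x) \<le> v x"
      using mult_right_mono[OF \<open>inverse C \<le> l\<close>, of "\<Phi> (x \<bullet> x)"] lower[OF x] \<Phi>x by linarith
    show "v x \<le> C * \<Phi> (x \<bullet> x)"
      using mult_right_mono[OF C(2), of "\<Phi> (x \<bullet> x)"] upper[OF x] \<Phi>x by linarith
  qed
qed

section \<open>The two radial profiles\<close>

text \<open>In the variable \<open>t = |x|\<^sup>2\<close> the profile \<open>t\<^sup>-\<^sup>\<beta>\<close> is \<open>|x|\<^sup>-\<^sup>2\<^sup>\<beta>\<close>; the third claim computes its Laplacian in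
dimension \<open>n\<close>.\<close>

lemma power_profile:
  fixes n \<beta> :: real
  assumes \<beta>: "\<beta> > 0" and t: "t > 0"
  shows "((\<lambda>t. t powr (- \<beta>)) has_real_derivative (- \<beta> * t powr (- \<beta> - 1))) (at t)"
    and "((\<lambda>t. - \<beta> * t powr (- \<beta> - 1)) has_real_derivative (\<beta> * (\<beta> + 1) * t powr (- \<beta> - 2))) (at t)"
    and "2 * n * (- \<beta> * t powr (- \<beta> - 1)) + 4 * t * (\<beta> * (\<beta> + 1) * t powr (- \<beta> - 2))
       = \<beta> * (4 * \<beta> + 4 - 2 * n) * t powr (- \<beta> - 1)"
proof -
  show "((\<lambda>t. t powr (- \<beta>)) has_real_derivative (- \<beta> * t powr (- \<beta> - 1))) (at t)"
    using t has_real_derivative_powr[of t "- \<beta>"] by simp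
  have "((\<lambda>t. t powr (- \<beta> - 1)) has_real_derivative ((- \<beta> - 1) * t powr (- \<beta> - 1 - 1))) (at t)"
    using t by (rule has_real_derivative_powr)
  from DERIV_cmult[OF this, of "- \<beta>"]
  show "((\<lambda>t. - \<beta> * t powr (- \<beta> - 1)) has_real_derivative (\<beta> * (\<beta> + 1) * t powr (- \<beta> - 2))) (at t)"
    by (simp add: algebra_simps)
  have "- \<beta> - 1 = 1 + (- \<beta> - 2)" by simp
  then have "t powr (- \<beta> - 1) = t * t powr (- \<beta> - 2)"
    using t by (simp only: powr_add) simp
  then show "2 * n * (- \<beta> * t powr (- \<beta> - 1)) + 4 * t * (\<beta> * (\<beta> + 1) * t powr (- \<beta> - 2))
       = \<beta> * (4 * \<beta> + 4 - 2 * n) * t powr (- \<beta> - 1)"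
    by (simp add: algebra_simps)
qed

text \<open>The profile is \<open>(|x| sqrt(ln |x|))\<^sup>2\<^sup>-\<^sup>n\<close> in the variable \<open>t = |x|\<^sup>2\<close>, for which \<open>ln |x| = (ln t)/2\<close>. The power
\<open>|x|\<^sup>2\<^sup>-\<^sup>n\<close> is harmonic, so only the logarithmic factor contributes to the Laplacian, and the result is comparable
with \<open>g\<^sup>-\<^sup>M\<^sup>-\<^sup>1\<close>, the power \<open>n/(n - 2)\<close> of the profile.\<close>

lemma logarithmic_profile:
  fixes n t :: real
  defines "M \<equiv> (n - 2) / 2"
  defines "L \<equiv> \<lambda>t. ln t / 2"
  defines "g \<equiv> \<lambda>t. t * L t"
  assumes n: "n > 2" and t: "t > 1"
  shows "((\<lambda>t. g t powr (- M)) has_real_derivative (- M * g t powr (- M - 1) * (L t + 1 / 2))) (at t)"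
    and "((\<lambda>t. - M * g t powr (- M - 1) * (L t + 1 / 2)) has_real_derivative
       (M * (M + 1) * g t powr (- M - 2) * (L t + 1 / 2)\<^sup>2 - M * g t powr (- M - 1) / (2 * t))) (at t)"
    and "2 * n * (- M * g t powr (- M - 1) * (L t + 1 / 2))
       + 4 * t * (M * (M + 1) * g t powr (- M - 2) * (L t + 1 / 2)\<^sup>2 - M * g t powr (- M - 1) / (2 * t))
       = M * (n - 2 + n / (2 * L t)) * g t powr (- M - 1)"
proof -
  have L: "L t > 0" using t by (simp add: L_def)
  have g: "g t > 0" using t L by (simp add: g_def)
  have dL: "(L has_real_derivative 1 / (2 * t)) (at t)"
    unfolding L_def using t by (auto intro!: derivative_eq_intros simp: field_simps)
  have dg: "(g has_real_derivative L t + 1 / 2) (at t)"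
    unfolding g_def using t by (auto intro!: derivative_eq_intros dL simp: field_simps)
  have dp: "((\<lambda>t. g t powr a) has_real_derivative a * g t powr (a - 1) * (L t + 1 / 2)) (at t)" for a
    using DERIV_chain2[OF has_real_derivative_powr[OF g, of a] dg] .
  show "((\<lambda>t. g t powr (- M)) has_real_derivative (- M * g t powr (- M - 1) * (L t + 1 / 2))) (at t)"
    by (rule dp)
  have "((\<lambda>t. L t + 1 / 2) has_real_derivative 1 / (2 * t)) (at t)"
    using dL by (auto intro!: derivative_eq_intros)
  from DERIV_mult[OF DERIV_cmult[OF dp[of "- M - 1"], of "- M"] this]
  show "((\<lambda>t. - M * g t powr (- M - 1) * (L t + 1 / 2)) has_real_derivative
       (M * (M + 1) * g t powr (- M - 2) * (L t + 1 / 2)\<^sup>2 - M * g t powr (- M - 1) / (2 * t))) (at t)"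
    by (rule DERIV_cong) (simp add: field_simps power2_eq_square)
  define P where "P = g t powr (- M - 2)"
  have "- M - 1 = 1 + (- M - 2)" by simp
  then have "g t powr (- M - 1) = g t * P"
    using g unfolding P_def by (simp only: powr_add) simp
  then have P: "g t powr (- M - 1) = t * L t * P" by (simp only: g_def)
  have n: "n = 2 * M + 2" by (simp add: M_def field_simps)
  show "2 * n * (- M * g t powr (- M - 1) * (L t + 1 / 2))
       + 4 * t * (M * (M + 1) * g t powr (- M - 2) * (L t + 1 / 2)\<^sup>2 - M * g t powr (- M - 1) / (2 * t))
       = M * (n - 2 + n / (2 * L t)) * g t powr (- M - 1)"
    unfolding P P_def[symmetric] n using L t by (simp add: field_simps power2_eq_square)
qed

section \<open>Weak solutions\<close>

lemma ennreal_integral_le_nn_integral: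
  fixes g :: "'a \<Rightarrow> real"
  shows "ennreal (\<integral>x. g x \<partial>M) \<le> (\<integral>\<^sup>+x. ennreal (g x) \<partial>M)"
proof (cases "integrable M g")
  case True
  have i: "integrable M (\<lambda>x. max 0 (g x))" using True by (intro integrable_max) auto
  have "ennreal (\<integral>x. g x \<partial>M) \<le> ennreal (\<integral>x. max 0 (g x) \<partial>M)"
    by (intro ennreal_leI integral_mono True i) auto
  also have "\<dots> = (\<integral>\<^sup>+x. ennreal (max 0 (g x)) \<partial>M)"
    by (rule nn_integral_eq_integral[symmetric, OF i]) auto
  also have "(\<lambda>x. ennreal (max 0 (g x))) = (\<lambda>x. ennreal (g x))"
    by (auto simp: max_def ennreal_neg)
  finally show ?thesis .
qed (simp add: not_integrable_integral_eq)

text \<open>The bridge from the signed identity, in which integrals may cancel, to the extended nonnegative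
integrals used for unbounded solutions.\<close>

lemma subsolution_inequality:
  fixes w f :: "'a::euclidean_space \<Rightarrow> real"
  assumes I: "mean_value_identity w f"
    and [measurable]: "w \<in> borel_measurable borel" "f \<in> borel_measurable borel"
    and w0: "\<And>x. 0 \<le> w x"
    and wi: "\<And>x b. integrable lborel (\<lambda>y. indicator (cball x b) y * w y)"
    and fg: "\<And>x. f x \<le> g x" and ar: "0 < a" "a < r"
  shows "(LBNN h. ennreal (bump h) * ennreal (w (x + a *\<^sub>R h))) \<le>
      (LBNN h. ennreal (bump h) * ennreal (w (x + r *\<^sub>R h)))
        + potential r (\<lambda>y. ennreal (g y)) x"
proof -
  let ?G = "\<lambda>s. LBNN h. ennreal (cutoff h) * ennreal (g (x + s *\<^sub>R h))"
  let ?B = "\<lambda>s. LBNN h. ennreal (bump h) * ennreal (w (x + s *\<^sub>R h))"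
  obtain B where B: "\<And>z::'a. bump z \<le> B" using bump_bounded by blast
  have B0: "B \<ge> 0" using B[of 0] bump_nonneg[of "0::'a"] by linarith
  have "integrable lborel (\<lambda>y. bump ((y - x) /\<^sub>R a) * w y)"
  proof (rule Bochner_Integration.integrable_bound)
    show "integrable lborel (\<lambda>y. B * (indicator (cball x a) y * w y))" using wi by simp
    show "AE y in lborel. norm (bump ((y - x) /\<^sub>R a) * w y) \<le> norm (B * (indicator (cball x a) y * w y))"
    proof (rule AE_I2)
      fix y
      show "norm (bump ((y - x) /\<^sub>R a) * w y) \<le> norm (B * (indicator (cball x a) y * w y))"
      proof (cases "y \<in> cball x a")
        case True
        then show ?thesis using B w0 B0 by (simp add: abs_mult bump_nonneg mult_right_mono)
      next
        case False
        then have "bump ((y - x) /\<^sub>R a) = 0"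
          using ar by (intro bump_outside) (simp add: dist_norm norm_minus_commute inverse_eq_divide pos_le_divide_eq)
        then show ?thesis by simp
      qed
    qed
  qed measurable
  from lborel_integrable_affine[OF this, of a x]
  have ia: "integrable lborel (\<lambda>h. bump h * w (x + a *\<^sub>R h))" using ar by simp
  define Z where "Z s = cutoff_mean f x s" for s
  define D where "D = (LBINT s. indicator {a..r} s * (s * Z s))"
  have "bump_mean w x a = bump_mean w x r + D"
    using I[unfolded mean_value_identity_def, rule_format, OF ar(1) less_imp_le[OF ar(2)], of x]
    unfolding D_def Z_def by linarith
  have "?B a = (LBNN h. ennreal (bump h * w (x + a *\<^sub>R h)))"
    by (simp add: ennreal_mult bump_nonneg w0)
  also have "\<dots> = ennreal (bump_mean w x a)"
    unfolding bump_mean_def by (rule nn_integral_eq_integral[OF ia]) (simp add: bump_nonneg w0)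
  also have "\<dots> = ennreal (bump_mean w x r + D)" by (simp only: \<open>bump_mean w x a = _\<close>)
  also have "\<dots> \<le> ennreal (bump_mean w x r) + ennreal D"
  proof (cases "D \<ge> 0")
    case True
    then show ?thesis by (simp add: bump_mean_def bump_nonneg w0)
  next
    case False
    then show ?thesis by (simp add: ennreal_neg ennreal_leI)
  qed
  also have "\<dots> \<le> ?B r + potential r (\<lambda>y. ennreal (g y)) x"
  proof (rule add_mono)
    show "ennreal (bump_mean w x r) \<le> ?B r"
      unfolding bump_mean_def
      by (rule order_trans[OF ennreal_integral_le_nn_integral]) (simp add: ennreal_mult bump_nonneg w0)
    have Zle: "ennreal (Z s) \<le> ?G s" for s
    proof -
      have "ennreal (Z s) \<le> (LBNN h. ennreal (cutoff h * f (x + s *\<^sub>R h)))"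
        unfolding Z_def cutoff_mean_def by (rule ennreal_integral_le_nn_integral)
      also have "\<dots> \<le> ?G s"
      proof (rule nn_integral_mono)
        fix h
        have "ennreal (cutoff h * f (x + s *\<^sub>R h)) = ennreal (cutoff h) * ennreal (f (x + s *\<^sub>R h))"
          by (rule ennreal_mult'[OF cutoff_nonneg])
        also have "\<dots> \<le> ennreal (cutoff h) * ennreal (g (x + s *\<^sub>R h))"
          by (intro mult_left_mono ennreal_leI fg) simp
        finally show "ennreal (cutoff h * f (x + s *\<^sub>R h)) \<le> ennreal (cutoff h) * ennreal (g (x + s *\<^sub>R h))" .
      qed
      finally show ?thesis .
    qed
    have "ennreal D \<le> (LBNN s. ennreal (indicator {a..r} s * (s * Z s)))"
      unfolding D_def by (rule ennreal_integral_le_nn_integral)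
    also have "\<dots> \<le> potential r (\<lambda>y. ennreal (g y)) x"
      unfolding potential_def
    proof (rule nn_integral_mono)
      fix s :: real
      show "ennreal (indicator {a..r} s * (s * Z s)) \<le> indicator {0<..r} s * (ennreal s * ?G s)"
      proof (cases "s \<in> {a..r}")
        case True
        then have "s > 0" using ar by simp
        then have "ennreal (s * Z s) = ennreal s * ennreal (Z s)" by (intro ennreal_mult') simp
        also have "\<dots> \<le> ennreal s * ?G s"
          by (intro mult_left_mono Zle) simp
        finally show ?thesis using True \<open>s > 0\<close> by simp
      qed simp
    qed
    finally show "ennreal D \<le> potential r (\<lambda>y. ennreal (g y)) x" .
  qed
  finally show ?thesis .
qed

lemma borel_measurable_Q:
  assumes "open \<Omega>" shows "Q \<Omega> \<in> borel_measurable borel"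
proof -
  have [measurable]: "\<Omega> \<in> sets borel" using assms by simp
  show ?thesis unfolding Q_def[abs_def] by measurable
qed

lemma lap_cutoff_eq_laplacian:
  fixes x y :: "real^'n"
  shows "lap_cutoff s (y - x) = (\<Sum>i\<in>UNIV. grad (\<lambda>y. grad (\<lambda>y. cutoff ((y - x) /\<^sub>R s)) y $ i) y $ i)"
  unfolding laplacian_cutoff lap_cutoff_def Let_def by simp

text \<open>The equation is tested with the scaled cutoffs centred at \<open>x\<close>. Since all integrals ignore null sets,
the identity holds for every Borel representative of the solution; it is applied to three of them.\<close>

theorem weak_solution_mean_value_identity:
  fixes w u :: "real^'n \<Rightarrow> real"
  assumes w: "weak_gradient w g" and wm [measurable]: "w \<in> borel_measurable lebesgue"
    and eq: "\<And>\<phi>. test_function \<phi> \<Longrightarrow>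
         (LINT x|lebesgue. g x \<bullet> grad \<phi> x) = (LINT x|lebesgue. Q \<Omega> x * w x powr (p - 1) * \<phi> x)"
    and \<Omega>: "open \<Omega>" and u [measurable]: "u \<in> borel_measurable borel" and uw: "AE x in lebesgue. u x = w x"
    and ui: "\<And>x b. integrable lborel (\<lambda>y. indicator (cball x b) y * u y)"
  shows "mean_value_identity u (\<lambda>x. Q \<Omega> x * u x powr (p - 1))"
proof -
  note [measurable] = borel_measurable_Q[OF \<Omega>]
  have weak: "(LBINT y. u y * lap_cutoff s (y - x))
      = - (LBINT y. (Q \<Omega> y * u y powr (p - 1)) * cutoff ((y - x) /\<^sub>R s))" if s: "s > 0" for s x
  proof -
    let ?\<phi> = "\<lambda>y. cutoff ((y - x) /\<^sub>R s)"
    note \<phi> = test_function_cutoff[OF s, of x]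
    have lm: "h \<in> borel_measurable lebesgue" if "h \<in> borel_measurable borel" for h :: "real^'n \<Rightarrow> real"
      using that by (intro measurable_completion) simp
    have b: "(\<lambda>y. u y * lap_cutoff s (y - x)) \<in> borel_measurable borel"
      "(\<lambda>y. lap_cutoff s (y - x)) \<in> borel_measurable borel"
      "(\<lambda>y. Q \<Omega> y * u y powr (p - 1) * ?\<phi> y) \<in> borel_measurable borel"
      "?\<phi> \<in> borel_measurable borel"
      by measurable
    note m = b[THEN lm] borel_measurable_Q[OF \<Omega>, THEN lm]
    have wpm: "(\<lambda>y. w y powr (p - 1)) \<in> borel_measurable lebesgue" by measurable
    have "(LBINT y. u y * lap_cutoff s (y - x)) = (LINT y|lebesgue. u y * lap_cutoff s (y - x))"
      by (rule integral_completion[symmetric]) measurable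
    also have "\<dots> = (LINT y|lebesgue. w y * lap_cutoff s (y - x))"
      by (intro integral_cong_AE borel_measurable_times m wm) (use uw in \<open>auto elim!: eventually_mono\<close>)
    also have "\<dots> = - (LINT y|lebesgue. g y \<bullet> grad ?\<phi> y)"
      by (simp add: weak_laplacian[OF w \<phi>] lap_cutoff_eq_laplacian)
    also have "\<dots> = - (LINT y|lebesgue. Q \<Omega> y * w y powr (p - 1) * ?\<phi> y)"
      by (simp only: eq[OF \<phi>])
    also have "(LINT y|lebesgue. Q \<Omega> y * w y powr (p - 1) * ?\<phi> y) = (LINT y|lebesgue. Q \<Omega> y * u y powr (p - 1) * ?\<phi> y)"
      by (intro integral_cong_AE borel_measurable_times m wpm) (use uw in \<open>auto elim!: eventually_mono\<close>)
    also have "\<dots> = (LBINT y. Q \<Omega> y * u y powr (p - 1) * ?\<phi> y)"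
      by (rule integral_completion) measurable
    finally show ?thesis .
  qed
  show ?thesis
    unfolding mean_value_identity_def
  proof (intro allI impI conjI)
    fix x and a b :: real assume ab: "0 < a" "a \<le> b"
    have fm: "(\<lambda>x. Q \<Omega> x * u x powr (p - 1)) \<in> borel_measurable borel" by measurable
    note mv = mean_value_formula[OF u fm ui weak ab]
    show "integrable lborel (\<lambda>s. indicator {a..b} s * (s * cutoff_mean (\<lambda>x. Q \<Omega> x * u x powr (p - 1)) x s))"
      by (rule mv(1))
    show "bump_mean u x b - bump_mean u x a =
        - (LBINT s. indicator {a..b} s * (s * cutoff_mean (\<lambda>x. Q \<Omega> x * u x powr (p - 1)) x s))"
      by (rule mv(2))
  qed
qed

text \<open>The solution is first replaced by a nonnegative Borel function, then by its truncation at the bound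
that holds almost everywhere, and finally by the continuous representative, the identity being available at
every stage. The critical exponent \<open>2n/(n - 2)\<close>, with \<open>n\<close> the dimension, is at least \<open>n (p - 2)\<close>
exactly when \<open>p \<le> (2n - 2)/(n - 2)\<close>, which is what the boundedness theorem requires.\<close>

theorem solution_regularity:
  fixes \<Omega> :: "(real^'n) set" and w :: "real^'n \<Rightarrow> real" and p :: real
  assumes N: "CARD('n) \<ge> 3" and \<Omega>: "open \<Omega>"
    and p: "2 < p" "p \<le> (2 * real CARD('n) - 2) / (real CARD('n) - 2)"
    and w: "w \<in> X p" "positive_solution \<Omega> p w"
  obtains v M where "continuous_on UNIV v" "AE x in lebesgue. v x = w x"
    "\<And>x. 0 < v x" "\<And>x. v x \<le> M"
    "mean_value_identity v (\<lambda>x. Q \<Omega> x * v x powr (p - 1))"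
    "integrable lborel (\<lambda>x. v x powr critical_exponent CARD('n))"
proof -
  define q where "q = critical_exponent CARD('n)"
  have N2: "real CARD('n) - 2 > 0" using N by simp
  have q1: "q \<ge> 1" using N2 by (simp add: q_def critical_exponent_def field_simps)
  have qp: "real DIM(real^'n) * (p - 2) \<le> q"
  proof -
    have "(p - 2) * (real CARD('n) - 2) \<le> 2" using p(2) N2 by (simp add: field_simps)
    then have "real CARD('n) * ((p - 2) * (real CARD('n) - 2)) \<le> real CARD('n) * 2"
      by (intro mult_left_mono) auto
    then show ?thesis using N2 by (simp add: q_def critical_exponent_def field_simps)
  qed
  from w(2) obtain g where pos: "AE x in lebesgue. w x > 0" and g: "weak_gradient w g"
    and eq: "\<And>\<phi>. test_function \<phi> \<Longrightarrow>
         (LINT x|lebesgue. g x \<bullet> grad \<phi> x) = (LINT x|lebesgue. Q \<Omega> x * w x powr (p - 1) * \<phi> x)"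
    unfolding positive_solution_def by blast
  have wm [measurable]: "w \<in> borel_measurable lebesgue"
    and wp: "integrable lebesgue (\<lambda>x. norm (w x) powr p)" and wq: "integrable lebesgue (\<lambda>x. norm (w x) powr q)"
    using w(1) by (auto simp: X_def D12_def Lspace_def q_def)
  obtain w0 where w0: "w0 \<in> borel_measurable lborel" "AE x in lborel. w x = w0 x"
    using completion_ex_borel_measurable_real[OF wm] by blast
  define u where "u x = max 0 (w0 x)" for x
  have um [measurable]: "u \<in> borel_measurable borel" using w0(1) unfolding u_def[abs_def] by simp
  have u0: "0 \<le> u x" for x by (simp add: u_def)
  have uw: "AE x in lebesgue. u x = w x"
    using AE_completion[OF w0(2)] pos by eventually_elim (simp add: u_def)
  have transfer: "integrable lborel (\<lambda>x. z x powr a)"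
    if z [measurable]: "z \<in> borel_measurable borel" and "AE x in lebesgue. z x = w x"
      and "\<And>x. 0 \<le> z x" and i: "integrable lebesgue (\<lambda>x. norm (w x) powr a)" for z :: "real^'n \<Rightarrow> real" and a
  proof -
    have "AE x in lebesgue. norm (w x) powr a = z x powr a"
      using that(2) by eventually_elim (use that(3) in \<open>metis abs_of_nonneg real_norm_def\<close>)
    moreover have "(\<lambda>x. z x powr a) \<in> borel_measurable lebesgue"
      by (intro measurable_completion) measurable
    ultimately have "integrable lebesgue (\<lambda>x. z x powr a)"
      using i by (subst integrable_cong_AE[symmetric, of "\<lambda>x. norm (w x) powr a"]) auto
    then show ?thesis by (subst (asm) integrable_completion) auto
  qed
  have fin: "(LBNN x. ennreal (u x powr a)) < \<infinity>"
    if "integrable lebesgue (\<lambda>x. norm (w x) powr a)" for a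
    using transfer[OF um uw u0 that] by (subst nn_integral_eq_integral) auto
  have loc: "integrable lborel (\<lambda>y. indicator (cball x b) y * z y)"
    if z [measurable]: "z \<in> borel_measurable borel" and zw: "AE x in lebesgue. z x = w x"
      and z0: "\<And>x. 0 \<le> z x" for z :: "real^'n \<Rightarrow> real" and x b
  proof (rule Bochner_Integration.integrable_bound)
    show "integrable lborel (\<lambda>y. indicator (cball x b) y + z y powr q)"
      using transfer[OF z zw z0 wq] emeasure_lborel_cball_finite[of x b]
      by (intro Bochner_Integration.integrable_add integrable_real_indicator) auto
    have "z y \<le> 1 + z y powr q" for y
    proof (cases "z y \<le> 1")
      case False
      then have "z y powr 1 \<le> z y powr q" using q1 by (intro powr_mono) auto
      then show ?thesis using z0[of y] by simp
    qed (simp add: add_increasing2)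
    then show "AE y in lborel. norm (indicator (cball x b) y * z y) \<le> norm (indicator (cball x b) y + z y powr q)"
      by (auto simp: indicator_def z0)
    show "(\<lambda>y. indicator (cball x b) y * z y) \<in> borel_measurable lborel"
      using z by (intro borel_measurable_times borel_measurable_indicator) auto
  qed
  have ident: "mean_value_identity z (\<lambda>x. Q \<Omega> x * z x powr (p - 1))"
    if "z \<in> borel_measurable borel" "AE x in lebesgue. z x = w x"
      "\<And>x b. integrable lborel (\<lambda>y. indicator (cball x b) y * z y)" for z
    by (rule weak_solution_mean_value_identity[OF g wm _ \<Omega> that]) (rule eq)
  have Qle: "Q \<Omega> x * t \<le> t" "\<bar>Q \<Omega> x * t\<bar> = \<bar>t\<bar>" "- t \<le> Q \<Omega> x * t" if "t \<ge> 0" for x t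
    using that by (auto simp: Q_def)
  have Qm [measurable]: "Q \<Omega> \<in> borel_measurable borel" by (rule borel_measurable_Q[OF \<Omega>])
  obtain M where M: "M > 0" "AE x in lborel. u x \<le> M"
  proof (rule bounded_of_subsolution[OF um u0 p(1) fin[OF wp] qp q1 fin[OF wq]])
    fix x and a r :: real assume "0 < a" "a < r"
    then show "(LBNN h. ennreal (bump h) * ennreal (u (x + a *\<^sub>R h)))
       \<le> (LBNN h. ennreal (bump h) * ennreal (u (x + r *\<^sub>R h))) + potential r (\<lambda>y. ennreal (u y powr (p - 1))) x"
      by (intro subsolution_inequality[OF ident[OF um uw loc[OF um uw u0]] um _ u0 loc[OF um uw u0]] Qle) auto
  qed
  have bounds: "\<bar>Q \<Omega> x * t powr (p - 1)\<bar> \<le> M powr (p - 1)" if "0 \<le> t" "t \<le> M" for t x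
    using that p by (simp add: Qle powr_mono2)
  \<comment> \<open>The truncation changes \<open>u\<close> on a null set only and makes the right-hand side bounded everywhere.\<close>
  define u2 where "u2 x = min (u x) M" for x
  have u2m: "u2 \<in> borel_measurable borel" unfolding u2_def[abs_def] by measurable
  have u2b: "0 \<le> u2 x" "u2 x \<le> M" for x using u0[of x] M by (auto simp: u2_def)
  have u2w: "AE x in lebesgue. u2 x = w x"
    using uw AE_completion[OF M(2)] by eventually_elim (simp add: u2_def)
  have f2m: "(\<lambda>x. Q \<Omega> x * z x powr (p - 1)) \<in> borel_measurable borel" if [measurable]: "z \<in> borel_measurable borel" for z
    by measurable
  have f2b: "\<bar>Q \<Omega> x * u2 x powr (p - 1)\<bar> \<le> M powr (p - 1)" for x by (rule bounds[OF u2b])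
  obtain v where v: "continuous_on UNIV v" "\<And>x. 0 \<le> v x" "\<And>x. v x \<le> M" "AE x in lborel. v x = u2 x"
    using continuous_representative[OF u2m f2m[OF u2m] u2b f2b ident[OF u2m u2w loc[OF u2m u2w u2b(1)]]]
    by blast
  have vm: "v \<in> borel_measurable borel" using v(1) by (rule borel_measurable_continuous_onI)
  have vw: "AE x in lebesgue. v x = w x"
    using AE_completion[OF v(4)] u2w by eventually_elim simp
  have vb: "\<bar>Q \<Omega> x * v x powr (p - 1)\<bar> \<le> M powr (p - 1)" for x by (rule bounds[OF v(2,3)])
  note vi = ident[OF vm vw loc[OF vm vw v(2)]]
  obtain x1 where x1: "v x1 > 0"
  proof -
    have "\<exists>x. v x > 0"
    proof (rule ccontr)
      assume none: "\<nexists>x. v x > 0"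
      have "AE x in lebesgue. x \<notin> (UNIV :: (real^'n) set)"
        using vw pos by eventually_elim (use none in metis)
      then have "(UNIV :: (real^'n) set) \<in> null_sets lebesgue"
        by (subst AE_iff_null_sets) auto
      then show False by (simp add: null_sets_def)
    qed
    then show ?thesis using that by blast
  qed
  have vpos: "0 < v x" for x
  proof (rule strong_maximum_principle[OF vi v(1,2,3) f2m[OF vm] vb _ _ x1])
    show "M powr (p - 2) > 0" using M by simp
    fix x
    have "v x powr (p - 1) = v x powr (p - 2) * v x"
      using v(2)[of x] powr_add[of "v x" "p - 2" 1] by simp
    also have "\<dots> \<le> M powr (p - 2) * v x"
      using v p by (intro mult_right_mono powr_mono2) auto
    finally show "- (M powr (p - 2) * v x) \<le> Q \<Omega> x * v x powr (p - 1)"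
      using Qle(3)[of "v x powr (p - 1)" x] by simp
  qed
  show ?thesis
    by (rule that[OF v(1) vw vpos v(3) vi transfer[OF vm vw v(2)]]) (use wq in \<open>simp add: q_def\<close>)
qed

section \<open>Decay of positive solutions\<close>

text \<open>With \<open>\<beta> = 1/(p - 2)\<close> the power profile solves \<open>\<Delta>U = k U\<^sup>p\<^sup>-\<^sup>1\<close> with \<open>k > 0\<close> precisely when \<open>2\<beta> > N - 2\<close>,
that is, \<open>p < p\<^sub>s\<close>; at \<open>p = p\<^sub>s\<close> the power becomes harmonic and the logarithm corrects it. The barrier bound
holds outside a ball that contains \<open>\<Omega>\<close>; on the remaining compact range the positive lower and the upper bound of
\<open>v\<close> suffice. In the critical case the profile blows up as \<open>|x|\<close> decreases to \<open>1\<close>, which limits the lower bound to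
\<open>|x| \<ge> R\<close> with \<open>R > 1\<close>.\<close>

theorem proposition1p6:
  fixes \<Omega> :: "(real^'n) set" and w :: "real^'n \<Rightarrow> real" and N :: nat and p p\<^sub>s :: real
  assumes "N = CARD('n)" and "N \<ge> 3"
    and "bounded \<Omega>" and "smooth_open \<Omega>"
    and "p\<^sub>s = (2 * real N - 2) / (real N - 2)"
    and "2 < p" and "p \<le> p\<^sub>s"
    and "w \<in> X p" and "positive_solution \<Omega> p w"
  shows "\<exists>v. continuous_on UNIV v \<and> (AE x in lebesgue. v x = w x) \<and>
    (\<forall>R>1. \<exists>C>1.
      (p < p\<^sub>s \<longrightarrow>
        (\<forall>x. norm x > 1 \<longrightarrow>
          inverse C * norm x powr (- 2 / (p - 2)) \<le> v x \<and>
          v x \<le> C * norm x powr (- 2 / (p - 2)))) \<and>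
      (p = p\<^sub>s \<longrightarrow>
        (\<forall>x. norm x \<ge> R \<longrightarrow>
          inverse C * (norm x * sqrt (ln (norm x))) powr (2 - real N) \<le> v x) \<and>
        (\<forall>x. norm x > 1 \<longrightarrow>
          v x \<le> C * (norm x * sqrt (ln (norm x))) powr (2 - real N))))"
proof -
  define n where "n = real N"
  have n: "n = real DIM(real^'n)" "n = real CARD('n)" "n > 2" using assms(1,2) by (simp_all add: n_def)
  have \<Omega>: "open \<Omega>" using assms(4) by (simp add: smooth_open_def)
  have ps: "p\<^sub>s = (2 * n - 2) / (n - 2)" using assms(5) by (simp add: n_def)
  obtain v M where v: "continuous_on UNIV v" and vw: "AE x in lebesgue. v x = w x"
    and v0: "\<And>x. 0 < v x" and vM: "\<And>x. v x \<le> M"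
    and I: "mean_value_identity v (\<lambda>x. Q \<Omega> x * v x powr (p - 1))"
    and vq: "integrable lborel (\<lambda>x. v x powr critical_exponent CARD('n))"
    using solution_regularity[OF _ \<Omega> assms(6) _ assms(8,9)] assms(1,2,5,7) by auto
  define f where "f = (\<lambda>x. Q \<Omega> x * v x powr (p - 1))"
  note I = I[folded f_def]
  have p2: "p > 2" by fact
  have q1: "critical_exponent CARD('n) \<ge> 1"
    using n by (simp add: critical_exponent_def field_simps)
  have M0: "M > 0" using v0[of 0] vM[of 0] by linarith
  have fm: "f \<in> borel_measurable borel"
  proof -
    have [measurable]: "v \<in> borel_measurable borel" using v by (rule borel_measurable_continuous_onI)
    note [measurable] = borel_measurable_Q[OF \<Omega>]
    show ?thesis unfolding f_def by measurable
  qed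
  have fb: "\<bar>f x\<bar> \<le> M powr (p - 1)" for x
  proof -
    have "\<bar>f x\<bar> = v x powr (p - 1)" by (simp add: f_def Q_def)
    also have "\<dots> \<le> M powr (p - 1)" using v0[of x] vM[of x] p2 by (intro powr_mono2) auto
    finally show ?thesis .
  qed
  obtain R0 where R0: "\<And>x. x \<in> \<Omega> \<Longrightarrow> norm x \<le> R0" using assms(3) by (auto simp: bounded_iff)
  define R1 where "R1 = max 2 R0"
  have R1: "R1 \<ge> 2" "R1 > 0" by (auto simp: R1_def)
  have feq: "f x = - (v x powr (p - 1))" if "norm x > R1" for x
  proof -
    have "x \<notin> \<Omega>" using R0[of x] that by (auto simp: R1_def)
    then show ?thesis by (simp add: f_def Q_def)
  qed
  have decay: "\<exists>R'. \<forall>x. norm x \<ge> R' \<longrightarrow> v x \<le> e" if "e > 0" for e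
  proof -
    have "f x \<le> 0" if "norm x > R1" for x using feq[OF that] by simp
    from decay_of_integrable_subsolution[OF I v less_imp_le[OF v0] vM fm fb this q1 vq \<open>e > 0\<close>]
    show ?thesis by blast
  qed
  have "R1\<^sup>2 \<ge> 2\<^sup>2" using R1 by (intro power_mono) auto
  then have R1sq: "R1\<^sup>2 \<ge> 4" by simp
  note barrier = two_sided_barrier_bound[OF I v v0 vM fm fb feq _ R1(2) decay, folded n(1)]
  obtain \<mu> where \<mu>: "\<mu> > 0" "\<And>x. norm x \<le> R1 \<Longrightarrow> \<mu> \<le> v x"
  proof -
    have "\<exists>x\<in>cball 0 R1. \<forall>y\<in>cball 0 R1. v x \<le> v y"
      using R1 by (intro continuous_attains_inf compact_cball continuous_on_subset[OF v]) auto
    then obtain x where x: "\<forall>y\<in>cball 0 R1. v x \<le> v y" by blast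
    then show ?thesis by (intro that[of "v x"] v0) simp
  qed
  have "\<exists>C>1.
      (p < p\<^sub>s \<longrightarrow>
        (\<forall>x. norm x > 1 \<longrightarrow>
          inverse C * norm x powr (- 2 / (p - 2)) \<le> v x \<and>
          v x \<le> C * norm x powr (- 2 / (p - 2)))) \<and>
      (p = p\<^sub>s \<longrightarrow>
        (\<forall>x. norm x \<ge> R \<longrightarrow>
          inverse C * (norm x * sqrt (ln (norm x))) powr (2 - real N) \<le> v x) \<and>
        (\<forall>x. norm x > 1 \<longrightarrow>
          v x \<le> C * (norm x * sqrt (ln (norm x))) powr (2 - real N)))" if R: "R > 1" for R
  proof -
    \<comment> \<open>A bound outside \<open>ball 0 R1\<close> extends inwards, as \<open>v\<close> lies between \<open>\<mu>\<close> and \<open>M\<close> there; \<open>K\<close> bounds the profile from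
      above where the lower estimate is claimed.\<close>
    have glue: "\<exists>C>1. (\<forall>x. norm x \<ge> r \<longrightarrow> inverse C * P (norm x) \<le> v x) \<and>
        (\<forall>x. norm x > 1 \<longrightarrow> v x \<le> C * P (norm x))"
      if C1: "C1 > 1" "\<And>x. norm x \<ge> R1 \<Longrightarrow> inverse C1 * P (norm x) \<le> v x"
          "\<And>x. norm x \<ge> R1 \<Longrightarrow> v x \<le> C1 * P (norm x)"
        and P0: "P R1 > 0" and anti: "\<And>s t. 1 < s \<Longrightarrow> s \<le> t \<Longrightarrow> P t \<le> P s"
        and r: "r \<ge> 1" "K > 0" "\<And>s. r \<le> s \<Longrightarrow> P s \<le> K"
        and Pp: "\<And>t. t \<ge> 1 \<Longrightarrow> P t \<ge> 0"
      for C1 r K and P :: "real \<Rightarrow> real"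
    proof -
      define C where "C = max C1 (max (K / \<mu>) (M / P R1))"
      have C: "C > 1" "C \<ge> C1" "C \<ge> K / \<mu>" "C \<ge> M / P R1" using C1 by (auto simp: C_def)
      have "inverse C * P (norm x) \<le> v x" if x: "norm x \<ge> r" for x
      proof (cases "norm x \<ge> R1")
        case True
        have "inverse C * P (norm x) \<le> inverse C1 * P (norm x)"
          using C C1(1) Pp[of "norm x"] x r by (intro mult_right_mono le_imp_inverse_le) auto
        then show ?thesis using C1(2)[OF True] by linarith
      next
        case False
        have "P (norm x) \<le> K" using r x by blast
        also have "K \<le> C * \<mu>" using C(3) \<mu>(1) by (simp add: field_simps)
        also have "\<dots> \<le> C * v x" using False C \<mu>(2)[of x] by (intro mult_left_mono) auto
        finally show ?thesis using C(1) by (simp add: field_simps)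
      qed
      moreover have "v x \<le> C * P (norm x)" if x: "norm x > 1" for x
      proof (cases "norm x \<ge> R1")
        case True
        have "C1 * P (norm x) \<le> C * P (norm x)"
          using C Pp[of "norm x"] x by (intro mult_right_mono) auto
        then show ?thesis using C1(3)[OF True] by linarith
      next
        case False
        have "v x \<le> M" by (rule vM)
        also have "M \<le> C * P R1" using C(4) P0 by (simp add: field_simps)
        also have "\<dots> \<le> C * P (norm x)" using False C x by (intro mult_left_mono anti) auto
        finally show ?thesis .
      qed
      ultimately show ?thesis using C(1) by blast
    qed
    show ?thesis
    proof (cases "p < p\<^sub>s")
      case True
      define \<beta> where "\<beta> = 1 / (p - 2)"
      have \<beta>: "\<beta> > 0" using p2 by (simp add: \<beta>_def)
      have \<beta>p: "\<beta> * (p - 1) = \<beta> + 1" using p2 by (simp add: \<beta>_def field_simps)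
      define k where "k = \<beta> * (4 * \<beta> + 4 - 2 * n)"
      let ?P1 = "\<lambda>t. - \<beta> * t powr (- \<beta> - 1)"
      let ?P2 = "\<lambda>t. \<beta> * (\<beta> + 1) * t powr (- \<beta> - 2)"
      have k: "k > 0"
      proof -
        have "(p - 2) * (n - 2) < 2" using True n p2 unfolding ps by (simp add: field_simps)
        then have "n - 2 < 2 * \<beta>" using p2 by (simp add: \<beta>_def field_simps)
        then show ?thesis using \<beta> by (simp add: k_def)
      qed
      have pw: "(t powr (- \<beta>)) powr (p - 1) = t powr (- \<beta> - 1)" if "t > 0" for t
        using \<beta>p by (simp add: powr_powr)
      obtain C1 where C1: "C1 > 1" "\<And>x. norm x \<ge> R1 \<Longrightarrow> inverse C1 * (x \<bullet> x) powr (- \<beta>) \<le> v x"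
        "\<And>x. norm x \<ge> R1 \<Longrightarrow> v x \<le> C1 * (x \<bullet> x) powr (- \<beta>)"
      proof (rule barrier[of 0 "\<lambda>t. t powr (- \<beta>)" ?P1 ?P2 k k])
        show "((\<lambda>t. t powr (- \<beta>)) \<longlongrightarrow> 0) at_top"
          using \<beta> by (intro tendsto_neg_powr filterlim_ident) auto
        show "((\<lambda>t. t powr (- \<beta>)) has_real_derivative - \<beta> * t powr (- \<beta> - 1)) (at t)" if "t > 0" for t
          by (rule power_profile(1)[OF \<beta> that])
        show "((\<lambda>t. - \<beta> * t powr (- \<beta> - 1)) has_real_derivative \<beta> * (\<beta> + 1) * t powr (- \<beta> - 2)) (at t)" if "t > 0" for t
          by (rule power_profile(2)[OF \<beta> that])
        fix t assume "t \<ge> R1\<^sup>2"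
        then have t: "t > 0" using R1sq by simp
        show "k * (t powr (- \<beta>)) powr (p - 1) \<le> 2 * n * ?P1 t + 4 * t * ?P2 t"
          "2 * n * ?P1 t + 4 * t * ?P2 t \<le> k * (t powr (- \<beta>)) powr (p - 1)"
          unfolding power_profile(3)[OF \<beta> t] pw[OF t] k_def by simp_all
      qed (use p2 R1 k in auto)
      have eq: "(x \<bullet> x) powr (- \<beta>) = norm x powr (- 2 / (p - 2))" if "norm x > 1" for x :: "real^'n"
      proof -
        have "(x \<bullet> x) powr (- \<beta>) = (norm x powr 2) powr (- \<beta>)"
          using order_less_trans[OF zero_less_one that] by (simp add: power2_norm_eq_inner[symmetric])
        also have "\<dots> = norm x powr (2 * (- \<beta>))" by (rule powr_powr)
        also have "2 * (- \<beta>) = - 2 / (p - 2)" by (simp add: \<beta>_def)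
        finally show ?thesis .
      qed
      have neg: "- 2 / (p - 2) \<le> 0" using p2 by simp
      have "\<exists>C>1. (\<forall>x. norm x \<ge> 1 \<longrightarrow> inverse C * norm x powr (- 2 / (p - 2)) \<le> v x) \<and>
        (\<forall>x. norm x > 1 \<longrightarrow> v x \<le> C * norm x powr (- 2 / (p - 2)))"
      proof (rule glue[OF C1(1), where K = 1])
        show "inverse C1 * norm x powr (- 2 / (p - 2)) \<le> v x" if "norm x \<ge> R1" for x
        proof -
          from that R1 have "norm x > 1" by linarith
          then show ?thesis using C1(2)[OF that] eq[of x] by simp
        qed
        show "v x \<le> C1 * norm x powr (- 2 / (p - 2))" if "norm x \<ge> R1" for x
        proof -
          from that R1 have "norm x > 1" by linarith
          then show ?thesis using C1(3)[OF that] eq[of x] by simp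
        qed
        show "t powr (- 2 / (p - 2)) \<le> s powr (- 2 / (p - 2))" if "1 < s" "s \<le> t" for s t :: real
          using that neg by (intro powr_mono2') auto
        show "s powr (- 2 / (p - 2)) \<le> 1" if "1 \<le> s" for s :: real
          using powr_mono2'[OF neg, of 1 s] that by simp
      qed (use R1(2) in simp_all)
      then obtain C where "C > 1" "\<And>x. norm x \<ge> 1 \<Longrightarrow> inverse C * norm x powr (- 2 / (p - 2)) \<le> v x"
        "\<And>x. norm x > 1 \<Longrightarrow> v x \<le> C * norm x powr (- 2 / (p - 2))" by blast
      then show ?thesis using True by (intro exI[of _ C]) (simp add: less_imp_le)
    next
      case False
      then have pps: "p = p\<^sub>s" using assms(7) by simp
      define m where "m = (n - 2) / 2"
      have m: "m > 0" using n by (simp add: m_def)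
      define g where "g t = t * (ln t / 2)" for t :: real
      have mp: "m * (p - 1) = m + 1" using n unfolding pps ps m_def by (simp add: field_simps)
      \<comment> \<open>The two constants bound the coefficient in the Laplacian of the profile for \<open>t \<ge> R1\<^sup>2 \<ge> 4\<close>.\<close>
      define k1 where "k1 = m * (n - 2)"
      define k2 where "k2 = m * (n - 2 + n / (2 * (ln 4 / 2)))"
      have k: "k1 > 0" "k2 > 0" using n m by (simp_all add: k1_def k2_def add_pos_pos)
      have g0: "g t > 0" if "t > 1" for t using that by (simp add: g_def)
      have pw: "(g t powr (- m)) powr (p - 1) = g t powr (- m - 1)" for t
        using mp by (simp add: powr_powr)
      note prof = logarithmic_profile[OF n(3), folded m_def, folded g_def]
      let ?P1 = "\<lambda>t. - m * g t powr (- m - 1) * (ln t / 2 + 1 / 2)"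
      let ?P2 = "\<lambda>t. m * (m + 1) * g t powr (- m - 2) * (ln t / 2 + 1 / 2)\<^sup>2 - m * g t powr (- m - 1) / (2 * t)"
      obtain C1 where C1: "C1 > 1" "\<And>x. norm x \<ge> R1 \<Longrightarrow> inverse C1 * g (x \<bullet> x) powr (- m) \<le> v x"
        "\<And>x. norm x \<ge> R1 \<Longrightarrow> v x \<le> C1 * g (x \<bullet> x) powr (- m)"
      proof (rule barrier[of 1 "\<lambda>t. g t powr (- m)" ?P1 ?P2 k1 k2])
        have "filterlim (\<lambda>t::real. t * (ln t * (1 / 2))) at_top at_top"
          by (intro filterlim_at_top_mult_at_top filterlim_ident ln_at_top
              filterlim_at_top_mult_tendsto_pos[OF tendsto_const]) auto
        then show "((\<lambda>t. g t powr (- m)) \<longlongrightarrow> 0) at_top"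
          using m by (intro tendsto_neg_powr) (auto simp: g_def)
        show "((\<lambda>t. g t powr (- m)) has_real_derivative - m * g t powr (- m - 1) * (ln t / 2 + 1 / 2)) (at t)" if "t > 1" for t
          by (rule prof(1)[OF that])
        show "((\<lambda>t. - m * g t powr (- m - 1) * (ln t / 2 + 1 / 2)) has_real_derivative
          m * (m + 1) * g t powr (- m - 2) * (ln t / 2 + 1 / 2)\<^sup>2 - m * g t powr (- m - 1) / (2 * t)) (at t)" if "t > 1" for t
          by (rule prof(2)[OF that])
        fix t assume "t \<ge> R1\<^sup>2"
        then have t: "t \<ge> 4" "t > 1" using R1sq by auto
        have "ln 4 \<le> ln t" "ln t > 0" using t by simp_all
        then have "n / (2 * (ln t / 2)) \<le> n / (2 * (ln 4 / 2))" "n / (2 * (ln t / 2)) \<ge> 0"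
          using n(3) by (auto intro!: divide_left_mono mult_pos_pos divide_nonneg_pos)
        then have "k1 \<le> m * (n - 2 + n / (2 * (ln t / 2)))" "m * (n - 2 + n / (2 * (ln t / 2))) \<le> k2"
          using m unfolding k1_def k2_def by (intro mult_left_mono; simp)+
        then show "k1 * (g t powr (- m)) powr (p - 1) \<le> 2 * n * ?P1 t + 4 * t * ?P2 t"
          "2 * n * ?P1 t + 4 * t * ?P2 t \<le> k2 * (g t powr (- m)) powr (p - 1)"
          unfolding prof(3)[OF t(2)] pw by (intro mult_right_mono; simp)+
      next
        show "g t powr (- m) > 0" if "t > 1" for t using g0[OF that] by simp
      qed (use p2 R1sq k in auto)
      define P where "P s = (s * sqrt (ln s)) powr (2 - n)" for s :: real
      have eq: "g (x \<bullet> x) powr (- m) = P (norm x)" if "norm x > 1" for x :: "real^'n"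
      proof -
        define s where "s = norm x"
        have s: "s > 1" "ln s > 0" using that ln_gt_zero[of "norm x"] by (simp_all add: s_def)
        have "g (x \<bullet> x) = s\<^sup>2 * ln s"
          using s by (simp add: g_def s_def[symmetric] power2_norm_eq_inner[symmetric] ln_realpow)
        also have "\<dots> = (s * sqrt (ln s)) powr 2"
          using s by (simp add: power_mult_distrib)
        finally have "g (x \<bullet> x) powr (- m) = (s * sqrt (ln s)) powr (2 * (- m))"
          by (simp only: powr_powr)
        also have "2 * (- m) = 2 - n" by (simp add: m_def field_simps)
        finally show ?thesis by (simp add: P_def s_def)
      qed
      have anti: "P t \<le> P s" if "1 < s" "s \<le> t" for s t
        unfolding P_def using that n by (intro powr_mono2' mult_mono mult_pos_pos) auto
      have "\<exists>C>1. (\<forall>x. norm x \<ge> R \<longrightarrow> inverse C * P (norm x) \<le> v x) \<and>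
        (\<forall>x. norm x > 1 \<longrightarrow> v x \<le> C * P (norm x))"
      proof (rule glue[OF C1(1), where K = "P R"])
        show "inverse C1 * P (norm x) \<le> v x" if "norm x \<ge> R1" for x
        proof -
          from that R1 have "norm x > 1" by linarith
          then show ?thesis using C1(2)[OF that] eq[of x] by simp
        qed
        show "v x \<le> C1 * P (norm x)" if "norm x \<ge> R1" for x
        proof -
          from that R1 have "norm x > 1" by linarith
          then show ?thesis using C1(3)[OF that] eq[of x] by simp
        qed
        show "P R1 > 0" "P R > 0" using R1 R by (simp_all add: P_def)
        show "P t \<le> P s" if "1 < s" "s \<le> t" for s t using that by (rule anti)
        show "P s \<le> P R" if "R \<le> s" for s using R that by (rule anti)
      qed (use R in \<open>simp_all add: P_def\<close>)
      then obtain C where "C > 1" "\<And>x. norm x \<ge> R \<Longrightarrow> inverse C * P (norm x) \<le> v x"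
        "\<And>x. norm x > 1 \<Longrightarrow> v x \<le> C * P (norm x)" by blast
      then show ?thesis using False by (intro exI[of _ C]) (simp add: P_def n_def)
    qed
  qed
  then show ?thesis using v vw by blast
qed

end
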